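(* Let $\mathcal{A}'$ be an essential central arrangement in $V=\mathbb{K}^\ell$ with $\operatorname{pd}_S\Omega^1(\mathcal{A}')=p<\ell-2$. Let $X\subset V$ be a linear subspace with $X\notin L(\mathcal{A}')$ which is generic with respect to $\mathcal{A}'$. If $k:=\dim_{\mathbb{K}}X\ge 3$ and $p\le k-2$, then the arrangement $\mathcal{A}'\cap X:=\{L\cap X\mid L\in\mathcal{A}'\}$ in $X$ is not free.
   Context: $S=\mathbb{K}[x_1,\dots,x_\ell]$. For an arrangement $\mathcal{B}$, $\alpha_L$ is a fixed linear form with kernel $L$, $Q(\mathcal{B})=\prod_{L\in\mathcal{B}}\alpha_L$, $\Omega^1(\mathcal{B})=\{\omega\in\frac{1}{Q(\mathcal{B})}\bigoplus_iS\,dx_i\mid\omega\wedge d\alpha_L\in\frac{\alpha_L}{Q(\mathcal{B})}\Omega^2_V\ \forall L\in\mathcal{B}\}$; an arrangement (in $V$ or in a subspace $X$, using the coordinate ring of $X$) is free if its module of logarithmic derivations, equivalently of logarithmic 1-forms, is free. $L(\mathcal{A}')$ is the set of intersections of subsets of $\mathcal{A}'$; essential means $\bigcap_{L\in\mathcal{A}'}L=0$. $X\notin L(\mathcal{A}')$ is generic with respect to $\mathcal{A}'$ if $\operatorname{codim}_V(X\cap Y)=\operatorname{codim}_VX+\operatorname{codim}_VY$ for all $Y\in L(\mathcal{A}')$ with $\operatorname{codim}_VY\le\ell-\operatorname{codim}_VX$. $\operatorname{pd}$ denotes projective dimension. *)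

theory Defs
  imports
    "HOL-Analysis.Analysis"
    "HOL-Library.Poly_Mapping"
    "HOL-Library.Extended_Nat"
    "HOL-Computational_Algebra.Fraction_Field"
begin

section \<open>Free modules, projective modules and projective dimension\<close>

text \<open>
  Modules are submodules, given as sets, of a type carrying a scalar multiplication in the sense
  of the locale \<^locale>\<open>module\<close>.
\<close>

definition free_mod :: "('a::comm_ring_1 \<Rightarrow> 'b::ab_group_add \<Rightarrow> 'b) \<Rightarrow> 'b set \<Rightarrow> bool" where
  "free_mod s M \<longleftrightarrow> (\<exists>B. \<not> module.dependent s B \<and> module.span s B = M)"

definition hom_on :: "('a::comm_ring_1 \<Rightarrow> 'b::ab_group_add \<Rightarrow> 'b) \<Rightarrow> 'b set \<Rightarrow>
    ('a \<Rightarrow> 'c::ab_group_add \<Rightarrow> 'c) \<Rightarrow> 'c set \<Rightarrow> ('b \<Rightarrow> 'c) \<Rightarrow> bool" where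
  "hom_on s M t N f \<longleftrightarrow>
     (\<forall>x\<in>M. f x \<in> N) \<and>
     (\<forall>x\<in>M. \<forall>y\<in>M. f (x + y) = f x + f y) \<and>
     (\<forall>c. \<forall>x\<in>M. f (s c x) = t c (f x))"

text \<open>Scalar multiplication on the free module \<^typ>\<open>'u \<Rightarrow>\<^sub>0 'a\<close> with basis the type \<^typ>\<open>'u\<close>.\<close>

definition fscale :: "'a::comm_ring_1 \<Rightarrow> ('u \<Rightarrow>\<^sub>0 'a) \<Rightarrow> ('u \<Rightarrow>\<^sub>0 'a)" where
  "fscale c f = Poly_Mapping.map (\<lambda>x. c * x) f"

lemma lookup_fscale [simp]: "Poly_Mapping.lookup (fscale c f) u = c * Poly_Mapping.lookup f u"
  by (simp add: fscale_def Poly_Mapping.map.rep_eq when_def)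

lemma module_fscale: "module fscale"
  by unfold_locales (auto intro!: poly_mapping_eqI simp: lookup_add algebra_simps)

text \<open>
  Projective means direct summand of a free module. A direct summand \<open>P\<close> of some free module is
  already a direct summand of the free module on the underlying set of \<open>P\<close>, so free modules on
  the ambient type of \<open>P\<close> suffice.
\<close>

definition projective_mod :: "('a::comm_ring_1 \<Rightarrow> 'b::ab_group_add \<Rightarrow> 'b) \<Rightarrow> 'b set \<Rightarrow> bool" where
  "projective_mod s P \<longleftrightarrow>
     (\<exists>(i :: 'b \<Rightarrow> ('b \<Rightarrow>\<^sub>0 'a)) r.
        hom_on s P fscale UNIV i \<and> hom_on fscale UNIV s P r \<and> (\<forall>x\<in>P. r (i x) = x))"

text \<open>
  \<open>0 \<rightarrow> P n \<rightarrow> \<dots> \<rightarrow> P 0 \<rightarrow> M \<rightarrow> 0\<close> with augmentation \<open>e\<close> and differentials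
  \<open>d i : P (i + 1) \<rightarrow> P i\<close>; the sequence is continued by zero modules.
\<close>

definition projective_resolution ::
  "('a::comm_ring_1 \<Rightarrow> 'b::ab_group_add \<Rightarrow> 'b) \<Rightarrow> 'b set \<Rightarrow> ('a \<Rightarrow> 'c::ab_group_add \<Rightarrow> 'c) \<Rightarrow> nat \<Rightarrow>
   (nat \<Rightarrow> 'c set) \<Rightarrow> (nat \<Rightarrow> 'c \<Rightarrow> 'c) \<Rightarrow> ('c \<Rightarrow> 'b) \<Rightarrow> bool" where
  "projective_resolution s M t n P d e \<longleftrightarrow>
     (\<forall>i. module.subspace t (P i) \<and> projective_mod t (P i)) \<and>
     (\<forall>i>n. P i = {0}) \<and>
     hom_on t (P 0) s M e \<and>
     (\<forall>i. hom_on t (P (Suc i)) t (P i) (d i)) \<and>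
     e ` P 0 = M \<and>
     {x \<in> P 0. e x = 0} = d 0 ` P 1 \<and>
     (\<forall>i. {x \<in> P (Suc i). d i x = 0} = d (Suc i) ` P (Suc (Suc i)))"

text \<open>
  The terms of the resolution are taken as submodules of the free module on
  \<^typ>\<open>'b \<times> 'a \<times> nat\<close>. This is no restriction: the free module on a generating set of \<open>M\<close>, and
  then on generating sets of the successive syzygies, embeds there for cardinality reasons.
\<close>

definition projdim :: "('a::comm_ring_1 \<Rightarrow> 'b::ab_group_add \<Rightarrow> 'b) \<Rightarrow> 'b set \<Rightarrow> enat" where
  "projdim s M = Inf {enat n | n.
     \<exists>(P :: nat \<Rightarrow> ('b \<times> 'a \<times> nat \<Rightarrow>\<^sub>0 'a) set) d e. projective_resolution s M fscale n P d e}"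


section \<open>Hyperplane arrangements\<close>

definition codim :: "('k::field ^ 'n) set \<Rightarrow> nat" where
  "codim Y = CARD('n) - vec.dim Y"

definition hyperplane :: "('k::field ^ 'n) set \<Rightarrow> bool" where
  "hyperplane L \<longleftrightarrow> vec.subspace L \<and> codim L = 1"

definition central_arrangement :: "('k::field ^ 'n) set set \<Rightarrow> bool" where
  "central_arrangement A \<longleftrightarrow> finite A \<and> (\<forall>L\<in>A. hyperplane L)"

definition essential :: "('k::field ^ 'n) set set \<Rightarrow> bool" where
  "essential A \<longleftrightarrow> \<Inter>A = {0}"

definition intersection_lattice :: "('k::field ^ 'n) set set \<Rightarrow> ('k ^ 'n) set set" where
  "intersection_lattice A = {\<Inter>B | B. B \<subseteq> A}"

definition generic_wrt :: "('k::field ^ 'n) set \<Rightarrow> ('k ^ 'n) set set \<Rightarrow> bool" where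
  "generic_wrt X A \<longleftrightarrow>
     (\<forall>Y \<in> intersection_lattice A. codim Y \<le> CARD('n) - codim X \<longrightarrow>
        codim (X \<inter> Y) = codim X + codim Y)"

definition restricted_arrangement ::
  "('k::field ^ 'n) set set \<Rightarrow> ('k ^ 'n) set \<Rightarrow> ('k ^ 'n) set set" where
  "restricted_arrangement A X = {L \<inter> X | L. L \<in> A}"

text \<open>
  Linear coordinates on a subspace \<open>X\<close>: they identify the coordinate ring of \<open>X\<close> with a polynomial
  ring in \<open>dim X\<close> variables, and an arrangement in \<open>X\<close> with one in \<open>K^(dim X)\<close>.
\<close>

definition coordinates :: "('k::field ^ 'm \<Rightarrow> 'k ^ 'n) \<Rightarrow> ('k ^ 'n) set \<Rightarrow> bool" where
  "coordinates \<phi> X \<longleftrightarrow> Vector_Spaces.linear (*s) (*s) \<phi> \<and> inj \<phi> \<and> range \<phi> = X"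

definition in_coordinates ::
  "('k::field ^ 'm \<Rightarrow> 'k ^ 'n) \<Rightarrow> ('k ^ 'n) set set \<Rightarrow> ('k ^ 'm) set set" where
  "in_coordinates \<phi> B = {\<phi> -` H | H. H \<in> B}"


section \<open>Logarithmic 1-forms\<close>

text \<open>
  \<open>S = K[x_i | i :: 'n]\<close>. The linear order on the index type makes \<open>S\<close> an instance of
  \<^class>\<open>idom\<close> and orders the basis \<open>dx_i \<and> dx_j\<close>, \<open>i < j\<close>, of the 2-forms.
  A rational 1-form is the vector of its coefficients with respect to the \<open>dx_i\<close>, and a rational
  2-form \<open>\<eta>\<close> is given by its coefficients \<open>\<eta> i j\<close> of \<open>dx_i \<and> dx_j\<close> for \<open>i < j\<close>.
\<close>

type_synonym ('k, 'n) mpoly = "('n \<Rightarrow>\<^sub>0 nat) \<Rightarrow>\<^sub>0 'k"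

type_synonym ('k, 'n) rational_form = "('k, 'n) mpoly fract ^ 'n"

definition const_poly :: "'k::field \<Rightarrow> ('k, 'n) mpoly" where
  "const_poly c = Poly_Mapping.single 0 c"

definition var_poly :: "'n \<Rightarrow> ('k::field, 'n) mpoly" where
  "var_poly i = Poly_Mapping.single (Poly_Mapping.single i 1) 1"

text \<open>The coefficient vector of the chosen linear form \<open>\<alpha>_L\<close> with kernel \<open>L\<close>.\<close>

definition alpha_coeff :: "('k::field ^ 'n) set \<Rightarrow> 'k ^ 'n" where
  "alpha_coeff L = (SOME a. L = {v. (\<Sum>i\<in>UNIV. a $ i * v $ i) = 0})"

definition alpha :: "('k::field ^ 'n) set \<Rightarrow> ('k, 'n) mpoly" where
  "alpha L = (\<Sum>i\<in>UNIV. const_poly (alpha_coeff L $ i) * var_poly i)"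

definition d_alpha :: "('k::field ^ 'n::{finite,linorder}) set \<Rightarrow> ('k, 'n) rational_form" where
  "d_alpha L = (\<chi> i. Fract (const_poly (alpha_coeff L $ i)) 1)"

definition Qpoly :: "('k::field ^ 'n::{finite,linorder}) set set \<Rightarrow> ('k, 'n) mpoly" where
  "Qpoly B = (\<Prod>L\<in>B. alpha L)"

definition wedge :: "('k::field, 'n::{finite,linorder}) rational_form \<Rightarrow> ('k, 'n) rational_form \<Rightarrow>
    'n \<Rightarrow> 'n \<Rightarrow> ('k, 'n) mpoly fract" where
  "wedge \<omega> \<eta> i j = \<omega> $ i * \<eta> $ j - \<omega> $ j * \<eta> $ i"

definition log_forms ::
  "('k::field ^ 'n::{finite,linorder}) set set \<Rightarrow> ('k, 'n) rational_form set" where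
  "log_forms B = {\<omega>.
     (\<exists>f. \<forall>i. \<omega> $ i = Fract (f i) (Qpoly B)) \<and>
     (\<forall>L\<in>B. \<exists>g. \<forall>i j. i < j \<longrightarrow> wedge \<omega> (d_alpha L) i j = Fract (alpha L * g i j) (Qpoly B))}"

definition form_scale :: "('k::field, 'n::{finite,linorder}) mpoly \<Rightarrow>
    ('k, 'n) rational_form \<Rightarrow> ('k, 'n) rational_form" where
  "form_scale f \<omega> = (\<chi> i. Fract f 1 * \<omega> $ i)"

lemma module_form_scale: "module form_scale"
proof -
  have add: "Fract (a + b) 1 = Fract a 1 + Fract b 1" for a b :: "('k::field, 'n::{finite,linorder}) mpoly"
    by simp
  show ?thesis
    by unfold_locales
      (simp_all add: form_scale_def vec_eq_iff distrib_left distrib_right add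
        mult.assoc[symmetric] One_fract_def[symmetric] del: add_fract)
qed

definition free_arrangement :: "('k::field ^ 'n::{finite,linorder}) set set \<Rightarrow> bool" where
  "free_arrangement B \<longleftrightarrow> free_mod form_scale (log_forms B)"

end

(*
  Let M and N be the modules of logarithmic forms of A' and of the restriction to X, let I be the ideal of X
  and let y_1, ..., y_c be linear forms generating I. Restriction maps M to N and kills IM and the dy_b.
  Away from the origin of X the arrangement is, by genericity, a product along directions transversal to X,
  so there N = M / (IM + <dy>) and the y_b are regular on M / <dy>. Hence a projective resolution of
  M / <dy>, of length at most max(p, 1) <= k - 2, reduced modulo I and augmented to N, has homology
  supported at the origin, and the acyclicity lemma of Peskine and Szpiro makes it exact: M maps onto N
  with kernel IM + <dy>. If N were free, M / IM would be the direct sum of N and the free module on the dy_b.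
  But A' is essential, so dy is a combination of the d alpha = alpha (d alpha / alpha) and lies in the
  maximal ideal times M.
*)
theory Submission
  imports Defs
begin

section \<open>Subquotient complexes and the acyclicity lemma\<close>

text \<open>The obstacle is that surjectivity of the restriction, its kernel and the regularity of
  the y_b on \<open>M / <dy>\<close> are under control only after localization away from the origin.
  Quotients and localizations are replaced by statements about elements: each term of a complex is a
  pair of submodules, and vanishing after inverting \<open>h\<close> means that some power of
  \<open>h\<close> carries a given cycle into the boundaries. Near a flat, \<open>h\<close> is the
  product of the \<open>\<alpha>\<close> of the hyperplanes that do not contain it. Genericity
  supplies vectors inside the flat that are transversal to X, and projection along them extends
  forms from X explicitly. The numerical bounds come from counting positions: N stands at position 1
  of the complex, \<open>P j\<close> at position j + 2 and the dy_b at position 3. The k coordinates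
  of X are the regular sequence, so no term may stand beyond position k, that is p + 2 \<le> k and 3
  \<le> k. At position 1 the acyclicity lemma asks for depth two of N, which is checked directly by
  cancelling independent linear forms.\<close>

lemma hom_onD:
  assumes "hom_on s M t N f"
  shows "x \<in> M \<Longrightarrow> f x \<in> N" "x \<in> M \<Longrightarrow> y \<in> M \<Longrightarrow> f (x + y) = f x + f y" "x \<in> M \<Longrightarrow> f (s c x) = t c (f x)"
  using assms by (auto simp: hom_on_def)

lemma hom_on_minus:
  assumes "module s" "module t" "module.subspace s M" "hom_on s M t N f" "x \<in> M"
  shows "f (- x) = - f x"
proof -
  interpret m1: module s by fact
  interpret m2: module t by fact
  have "f (s (- 1) x) = t (- 1) (f x)" using assms by (intro hom_onD(3))
  then show ?thesis by simp
qed

lemma hom_on_diff: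
  assumes "module s" "module t" "module.subspace s M" "hom_on s M t N f" "x \<in> M" "y \<in> M"
  shows "f (x - y) = f x - f y"
proof -
  interpret m1: module s by fact
  have "f (x + (- y)) = f x + f (- y)" using assms by (intro hom_onD(2)) (auto simp: m1.subspace_neg)
  then show ?thesis using hom_on_minus[OF assms(1-4,6)] by simp
qed

lemma hom_on_zero:
  assumes "module s" "module t" "module.subspace s M" "hom_on s M t N f"
  shows "f 0 = 0"
proof -
  interpret m1: module s by fact
  show ?thesis using hom_on_diff[OF assms m1.subspace_0[OF assms(3)] m1.subspace_0[OF assms(3)]] by simp
qed

lemma hom_on_sum:
  assumes "module s" "module t" "module.subspace s M" "hom_on s M t N f" "\<And>i. i \<in> I \<Longrightarrow> g i \<in> M"
  shows "f (sum g I) = (\<Sum>i\<in>I. f (g i))"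
proof -
  interpret m1: module s by fact
  show ?thesis using assms(5)
  proof (induction I rule: infinite_finite_induct)
    case (insert i I)
    have "sum g I \<in> M" using insert.prems by (intro m1.subspace_sum[OF assms(3)]) auto
    moreover have "g i \<in> M" using insert.prems by auto
    ultimately show ?case using insert hom_onD(2)[OF assms(4), of "g i" "sum g I"] by simp
  qed (use hom_on_zero[OF assms(1-4)] in auto)
qed

locale ring_module = module scale
  for scale :: "'a::comm_ring_1 \<Rightarrow> 'b::ab_group_add \<Rightarrow> 'b"
begin

text \<open>With \<open>B\<close> inside \<open>A\<close> this represents
  \<open>(A / B) / g (A / B)\<close>: quotients are never formed as types, only the submodule
  divided out grows.\<close>

definition add_multiples :: "'a \<Rightarrow> 'b set \<Rightarrow> 'b set \<Rightarrow> 'b set" where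
  "add_multiples g A B = {scale g x + b | x b. x \<in> A \<and> b \<in> B}"

lemma add_multiplesI: "x \<in> A \<Longrightarrow> b \<in> B \<Longrightarrow> scale g x + b \<in> add_multiples g A B"
  by (auto simp: add_multiples_def)

lemma add_multiplesE:
  assumes "u \<in> add_multiples g A B"
  obtains x b where "x \<in> A" "b \<in> B" "u = scale g x + b"
  using assms by (auto simp: add_multiples_def)

lemma subspace_image_plus:
  assumes f: "hom_on scale A scale M f" and A: "subspace A" and B: "subspace B"
  shows "subspace {f x + b | x b. x \<in> A \<and> b \<in> B}"
proof (rule subspaceI)
  have "f 0 = 0" by (rule hom_on_zero[OF module_axioms module_axioms A f])
  then show "0 \<in> {f x + b | x b. x \<in> A \<and> b \<in> B}" using subspace_0[OF A] subspace_0[OF B] by force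
next
  fix x y assume "x \<in> {f x + b | x b. x \<in> A \<and> b \<in> B}" "y \<in> {f x + b | x b. x \<in> A \<and> b \<in> B}"
  then obtain a b a' b' where *: "a \<in> A" "b \<in> B" "x = f a + b" "a' \<in> A" "b' \<in> B" "y = f a' + b'" by blast
  have "x + y = f (a + a') + (b + b')" using * by (simp add: hom_onD(2)[OF f])
  then show "x + y \<in> {f x + b | x b. x \<in> A \<and> b \<in> B}"
    using subspace_add[OF A *(1,4)] subspace_add[OF B *(2,5)] by blast
next
  fix c x assume "x \<in> {f x + b | x b. x \<in> A \<and> b \<in> B}"
  then obtain a b where *: "a \<in> A" "b \<in> B" "x = f a + b" by blast
  have "scale c x = f (scale c a) + scale c b" using * by (simp add: hom_onD(3)[OF f] scale_right_distrib)
  then show "scale c x \<in> {f x + b | x b. x \<in> A \<and> b \<in> B}"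
    using subspace_scale[OF A *(1)] subspace_scale[OF B *(2)] by blast
qed

lemma subspace_add_multiples: "subspace A \<Longrightarrow> subspace B \<Longrightarrow> subspace (add_multiples g A B)"
  unfolding add_multiples_def
  by (rule subspace_image_plus[of _ UNIV]) (auto simp: hom_on_def scale_right_distrib mult.commute)

lemma add_multiples_superset: "subspace A \<Longrightarrow> B \<subseteq> add_multiples g A B"
  using add_multiplesI[OF subspace_0, of A _ B g] by auto

lemma scale_in_add_multiples: "subspace B \<Longrightarrow> x \<in> A \<Longrightarrow> scale g x \<in> add_multiples g A B"
  using add_multiplesI[OF _ subspace_0, of x A B g] by auto

lemma add_multiples_subset: "subspace A \<Longrightarrow> B \<subseteq> A \<Longrightarrow> add_multiples g A B \<subseteq> A"
  by (auto elim!: add_multiplesE intro!: subspace_add subspace_scale)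

lemma add_multiples_mono: "A \<subseteq> A' \<Longrightarrow> B \<subseteq> B' \<Longrightarrow> add_multiples g A B \<subseteq> add_multiples g A' B'"
  by (auto simp: add_multiples_def)

text \<open>The head of the list is divided out last; regularity of a sequence therefore concerns
  each entry modulo the entries behind it.\<close>

definition adjoin :: "'a list \<Rightarrow> 'b set \<Rightarrow> 'b set \<Rightarrow> 'b set" where
  "adjoin gs A B = foldr (\<lambda>g. add_multiples g A) gs B"

lemma adjoin_simps [simp]: "adjoin [] A B = B" "adjoin (g # gs) A B = add_multiples g A (adjoin gs A B)"
  by (simp_all add: adjoin_def)

lemma subspace_adjoin: "subspace A \<Longrightarrow> subspace B \<Longrightarrow> subspace (adjoin gs A B)"
  by (induction gs) (auto simp: subspace_add_multiples)

lemma adjoin_superset: "subspace A \<Longrightarrow> B \<subseteq> adjoin gs A B"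
  by (induction gs) (auto dest: add_multiples_superset)

lemma adjoin_subset: "subspace A \<Longrightarrow> B \<subseteq> A \<Longrightarrow> adjoin gs A B \<subseteq> A"
  by (induction gs) (auto dest: add_multiples_subset)

lemma adjoin_mono: "A \<subseteq> A' \<Longrightarrow> B \<subseteq> B' \<Longrightarrow> adjoin gs A B \<subseteq> adjoin gs A' B'"
  by (induction gs) (simp_all add: add_multiples_mono)

lemma scale_in_adjoin: "subspace A \<Longrightarrow> subspace B \<Longrightarrow> g \<in> set gs \<Longrightarrow> x \<in> A \<Longrightarrow> scale g x \<in> adjoin gs A B"
proof (induction gs)
  case (Cons a gs)
  then show ?case
    by (cases "g = a") (auto intro!: scale_in_add_multiples subspace_adjoin dest: add_multiples_superset[of A "adjoin gs A B" a])
qed simp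

text \<open>Encodes the complex of the subquotients \<open>A i / B i\<close>.\<close>

definition complex_on :: "(nat \<Rightarrow> 'b set) \<Rightarrow> (nat \<Rightarrow> 'b set) \<Rightarrow> (nat \<Rightarrow> 'b \<Rightarrow> 'b) \<Rightarrow> bool" where
  "complex_on A B d \<longleftrightarrow>
     (\<forall>i. subspace (A i) \<and> subspace (B i) \<and> B i \<subseteq> A i \<and>
          hom_on scale (A (Suc i)) scale (A i) (d i) \<and> d i ` B (Suc i) \<subseteq> B i \<and>
          (\<forall>x\<in>A (Suc (Suc i)). d i (d (Suc i) x) \<in> B i))"

text \<open>The full preimage in \<open>A i\<close> of the boundaries of the quotient
  complex.\<close>

definition boundaries :: "(nat \<Rightarrow> 'b set) \<Rightarrow> (nat \<Rightarrow> 'b set) \<Rightarrow> (nat \<Rightarrow> 'b \<Rightarrow> 'b) \<Rightarrow> nat \<Rightarrow> 'b set" where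
  "boundaries A B d i = {d i v + b | v b. v \<in> A (Suc i) \<and> b \<in> B i}"

text \<open>The homology at position \<open>Suc i\<close> vanishes after inverting \<open>h\<close>;
  the exponent may depend on the cycle. Position 0 is never tested, and the shift in
  \<open>acyclicity\<close> relies on that.\<close>

definition torsion_at :: "'a \<Rightarrow> (nat \<Rightarrow> 'b set) \<Rightarrow> (nat \<Rightarrow> 'b set) \<Rightarrow> (nat \<Rightarrow> 'b \<Rightarrow> 'b) \<Rightarrow> nat \<Rightarrow> bool" where
  "torsion_at h A B d i \<longleftrightarrow>
     (\<forall>x\<in>A (Suc i). d i x \<in> B i \<longrightarrow> (\<exists>s. scale (h ^ s) x \<in> boundaries A B d (Suc i)))"

lemma boundariesI: "v \<in> A (Suc i) \<Longrightarrow> b \<in> B i \<Longrightarrow> d i v + b \<in> boundaries A B d i"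
  by (auto simp: boundaries_def)

lemma boundariesE:
  assumes "x \<in> boundaries A B d i"
  obtains v b where "v \<in> A (Suc i)" "b \<in> B i" "x = d i v + b"
  using assms by (auto simp: boundaries_def)

context
  fixes A B d
  assumes cx: "complex_on A B d"
begin

lemma complexD:
  "subspace (A i)" "subspace (B i)" "x \<in> B i \<Longrightarrow> x \<in> A i"
  "hom_on scale (A (Suc i)) scale (A i) (d i)" "x \<in> B (Suc i) \<Longrightarrow> d i x \<in> B i"
  "x \<in> A (Suc (Suc i)) \<Longrightarrow> d i (d (Suc i) x) \<in> B i"
  using cx unfolding complex_on_def by blast+

lemma complex_hom:
  "x \<in> A (Suc i) \<Longrightarrow> d i x \<in> A i" "x \<in> A (Suc i) \<Longrightarrow> y \<in> A (Suc i) \<Longrightarrow> d i (x + y) = d i x + d i y"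
  "x \<in> A (Suc i) \<Longrightarrow> d i (scale c x) = scale c (d i x)"
  using hom_onD[OF complexD(4)] by auto

lemma complex_hom_diff: "x \<in> A (Suc i) \<Longrightarrow> y \<in> A (Suc i) \<Longrightarrow> d i (x - y) = d i x - d i y"
  by (rule hom_on_diff[OF _ _ _ complexD(4)]) (auto intro: module_axioms complexD)

lemma subspace_boundaries: "subspace (boundaries A B d i)"
  unfolding boundaries_def by (rule subspace_image_plus[OF complexD(4,1,2)])

lemma boundaries_superset: "B i \<subseteq> boundaries A B d i"
proof -
  have "d i 0 = 0" using complex_hom_diff[of 0 i 0] subspace_0[OF complexD(1)] by simp
  then show ?thesis using boundariesI[of 0 A i _ B d] subspace_0[OF complexD(1)] by force
qed

lemma boundary_in_boundaries: "v \<in> A (Suc i) \<Longrightarrow> d i v \<in> boundaries A B d i"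
  using boundariesI[of v A i 0 B d] subspace_0[OF complexD(2)] by simp

lemma complex_quotient: "complex_on A (\<lambda>i. add_multiples f (A i) (B i)) d"
  unfolding complex_on_def
proof (intro allI conjI ballI)
  fix i
  show "subspace (A i)" "subspace (add_multiples f (A i) (B i))"
    by (auto intro!: subspace_add_multiples complexD(1,2))
  show "add_multiples f (A i) (B i) \<subseteq> A i" by (intro add_multiples_subset) (auto simp: complexD)
  show "hom_on scale (A (Suc i)) scale (A i) (d i)" by (rule complexD)
  show "d i ` add_multiples f (A (Suc i)) (B (Suc i)) \<subseteq> add_multiples f (A i) (B i)"
    by (auto elim!: add_multiplesE simp: complex_hom complexD(3,5) subspace_scale[OF complexD(1)] intro!: add_multiplesI)
  fix x assume "x \<in> A (Suc (Suc i))"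
  then show "d i (d (Suc i) x) \<in> add_multiples f (A i) (B i)"
    using complexD add_multiples_superset by blast
qed

text \<open>From the long exact homology sequence of multiplication by \<open>f\<close>.\<close>

lemma torsion_at_quotient:
  assumes tors: "torsion_at h A B d i" "i > 0 \<Longrightarrow> torsion_at h A B d (i - 1)"
    and reg: "\<And>x. i > 0 \<Longrightarrow> x \<in> A (i - 1) \<Longrightarrow> scale f x \<in> B (i - 1) \<Longrightarrow> \<exists>s. scale (h ^ s) x \<in> B (i - 1)"
    and zero: "i = 0 \<Longrightarrow> A 0 = {0}"
  shows "torsion_at h A (\<lambda>i. add_multiples f (A i) (B i)) d i"
  unfolding torsion_at_def
proof (intro ballI impI)
  fix x assume x: "x \<in> A (Suc i)" and "d i x \<in> add_multiples f (A i) (B i)"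
  then obtain u b where u: "u \<in> A i" and b: "b \<in> B i" and dx: "d i x = scale f u + b"
    by (metis add_multiplesE)
  have bA: "b \<in> A i" by (rule complexD) fact
  \<comment> \<open>The connecting map sends the class of \<open>x\<close> to that of
    \<open>u\<close>. Applying the differential to \<open>d i x = f u + b\<close> shows that
    \<open>f\<close> carries the differential of \<open>u\<close> into the relations, so some power
    of \<open>h\<close> makes \<open>u\<close> a cycle and a higher one a boundary. Correcting a
    multiple of \<open>x\<close> by \<open>f v\<close> below then gives a cycle of the original
    complex.\<close>
  have "\<exists>s v b'. v \<in> A (Suc i) \<and> b' \<in> B i \<and> scale (h ^ s) u = d i v + b'"
  proof (cases i)
    case 0
    then have "u = 0" using u zero by auto
    moreover have "d i 0 = 0" using complex_hom_diff[of 0 i 0] subspace_0[OF complexD(1)] by simp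
    ultimately show ?thesis by (auto intro!: exI[of _ 0] subspace_0 complexD)
  next
    case (Suc j)
    have "scale f u \<in> A (Suc j)" "b \<in> A (Suc j)" using u bA by (auto simp: Suc subspace_scale[OF complexD(1)])
    then have "scale f (d j u) = d j (d i x) - d j b"
      using u unfolding dx by (simp add: complex_hom Suc)
    also have "\<dots> \<in> B j"
      using x b Suc by (auto intro!: subspace_diff[OF complexD(2)] complexD(5,6))
    finally obtain s where s: "scale (h ^ s) (d j u) \<in> B j"
      using reg[of "d j u"] u Suc by (auto simp: complex_hom)
    then have "d j (scale (h ^ s) u) \<in> B j" "scale (h ^ s) u \<in> A (Suc j)"
      using u Suc by (simp_all add: complex_hom subspace_scale[OF complexD(1)])
    then obtain s' where "scale (h ^ s') (scale (h ^ s) u) \<in> boundaries A B d (Suc j)"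
      using tors(2) Suc unfolding torsion_at_def by auto
    then show ?thesis
      unfolding scale_scale power_add[symmetric] Suc by (metis boundariesE)
  qed
  then obtain s v b' where v: "v \<in> A (Suc i)" and b': "b' \<in> B i" and s: "scale (h ^ s) u = d i v + b'"
    by auto
  let ?x = "scale (h ^ s) x - scale f v"
  have "d i ?x = scale (h ^ s) (d i x) - scale f (d i v)"
    using x v by (simp add: complex_hom_diff complex_hom subspace_scale[OF complexD(1)])
  also have "\<dots> = scale f (scale (h ^ s) u) + scale (h ^ s) b - scale f (d i v)"
    unfolding dx by (simp add: scale_right_distrib mult.commute)
  also have "\<dots> = scale f b' + scale (h ^ s) b"
    unfolding s by (simp add: scale_right_distrib)
  finally have "d i ?x \<in> B i" using b b' by (auto intro!: subspace_add[OF complexD(2)] subspace_scale[OF complexD(2)])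
  moreover have "?x \<in> A (Suc i)" using x v by (auto intro!: subspace_diff[OF complexD(1)] subspace_scale[OF complexD(1)])
  ultimately obtain t where "scale (h ^ t) ?x \<in> boundaries A B d (Suc i)"
    using tors(1) unfolding torsion_at_def by blast
  then obtain v' b'' where v': "v' \<in> A (Suc (Suc i))" "b'' \<in> B (Suc i)" "scale (h ^ t) ?x = d (Suc i) v' + b''"
    by (metis boundariesE)
  have "scale (h ^ (t + s)) x = scale (h ^ t) ?x + scale (h ^ t) (scale f v)"
    by (simp add: scale_right_diff_distrib power_add)
  also have "\<dots> = d (Suc i) v' + (scale f (scale (h ^ t) v) + b'')"
    unfolding v'(3) by (simp add: mult.commute)
  also have "\<dots> \<in> boundaries A (\<lambda>i. add_multiples f (A i) (B i)) d (Suc i)"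
    using v v' by (intro boundariesI add_multiplesI subspace_scale[OF complexD(1)])
  finally show "\<exists>s. scale (h ^ s) x \<in> boundaries A (\<lambda>i. add_multiples f (A i) (B i)) d (Suc i)" ..
qed

end

lemma complex_adjoin:
  assumes "complex_on A B d"
  shows "complex_on A (\<lambda>i. adjoin gs (A i) (B i)) d"
proof (induction gs)
  case (Cons g gs)
  show ?case using complex_quotient[OF Cons.IH] by simp
qed (use assms in simp)

text \<open>Iterates \<open>torsion_at_quotient\<close>. Regularity of the sequence is asked for
  only after inverting \<open>h\<close>, which is all that holds near a flat.\<close>

lemma torsion_at_adjoin:
  assumes cx: "complex_on A B d" and zero: "A 0 = {0}"
    and tors: "\<And>i. torsion_at h A B d i"
    and reg: "\<And>hs g gs' i x. gs = hs @ g # gs' \<Longrightarrow> x \<in> A i \<Longrightarrow> scale g x \<in> adjoin gs' (A i) (B i) \<Longrightarrow>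
      \<exists>s. scale (h ^ s) x \<in> adjoin gs' (A i) (B i)"
  shows "torsion_at h A (\<lambda>i. adjoin gs (A i) (B i)) d i"
  using reg
proof (induction gs arbitrary: i)
  case Nil
  show ?case using tors by simp
next
  case (Cons g gs i)
  have IH: "torsion_at h A (\<lambda>i. adjoin gs (A i) (B i)) d i" for i
    by (rule Cons.IH) (metis append_Cons Cons.prems)
  have "torsion_at h A (\<lambda>i. add_multiples g (A i) (adjoin gs (A i) (B i))) d i"
    by (rule torsion_at_quotient[OF complex_adjoin[OF cx] IH IH])
      (use Cons.prems[of "[]"] zero in auto)
  then show ?case by simp
qed

text \<open>At position \<open>n\<close> of the complex, a regular sequence of length \<open>n + 1\<close> suffices for the acyclicity lemma.\<close>

fun regular_upto :: "'a list \<Rightarrow> nat \<Rightarrow> 'b set \<Rightarrow> 'b set \<Rightarrow> bool" where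
  "regular_upto [] n A B \<longleftrightarrow> True"
| "regular_upto (z # zs) n A B \<longleftrightarrow>
     (\<forall>x\<in>A. scale z x \<in> B \<longrightarrow> x \<in> B) \<and>
     (n > 0 \<longrightarrow> regular_upto zs (n - 1) A (add_multiples z A B))"

text \<open>
  The acyclicity lemma of Peskine and Szpiro. A homology class killed by \<open>z\<close> comes from a homology class
  one degree higher of the complex modulo \<open>z\<close>, to which the induction hypothesis applies.
\<close>

lemma acyclicity:
  assumes "complex_on A B d"
    and "\<And>i. i > length zs \<Longrightarrow> A i \<subseteq> B i"
    and "\<And>i. regular_upto zs i (A i) (B i)"
    and "\<And>i z. z \<in> set zs \<Longrightarrow> torsion_at z A B d i"
    and "x \<in> A (Suc i)" "d i x \<in> B i"
  shows "x \<in> boundaries A B d (Suc i)"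
  using assms
proof (induction zs arbitrary: A B d x i)
  case Nil
  show ?case using Nil.prems(2)[of "Suc i"] Nil.prems(5) boundaries_superset[OF Nil.prems(1), of "Suc i"] by auto
next
  case (Cons z zs)
  note cx = Cons.prems(1)
  note D = complexD[OF cx] and H = complex_hom[OF cx] complex_hom_diff[OF cx]
  define B' where "B' j = add_multiples z (A j) (B j)" for j
  have cx': "complex_on A B' d" unfolding B'_def by (rule complex_quotient[OF cx])
  have reg: "x \<in> B j" if "x \<in> A j" "scale z x \<in> B j" for x j
    using Cons.prems(3)[of j] that by auto
  \<comment> \<open>Division by \<open>z\<close> spends one regular element at every position.
    Dropping position 0 lowers the positions and the bound on the length by one as well, so the
    hypotheses are again those of the lemma.\<close>
  let ?A = "\<lambda>j. A (Suc j)" and ?B = "\<lambda>j. B' (Suc j)" and ?d = "\<lambda>j. d (Suc j)"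
  have cx'': "complex_on ?A ?B ?d" using cx' unfolding complex_on_def by blast
  have ex: "x \<in> boundaries ?A ?B ?d (Suc i)" if "x \<in> ?A (Suc i)" "?d i x \<in> ?B i" for x i
  proof (rule Cons.IH[OF cx'' _ _ _ that])
    show "A (Suc j) \<subseteq> B' (Suc j)" if "length zs < j" for j
      using Cons.prems(2)[of "Suc j"] that add_multiples_superset[OF D(1), of "B (Suc j)" z] by (auto simp: B'_def)
    show "regular_upto zs j (A (Suc j)) (B' (Suc j))" for j
      using Cons.prems(3)[of "Suc j"] by (simp add: B'_def)
    show "torsion_at y ?A ?B ?d j" if y: "y \<in> set zs" for j y
    proof -
      have "torsion_at y A B' d (Suc j)" unfolding B'_def
        by (rule torsion_at_quotient[OF cx])
          (use y Cons.prems(4) reg in \<open>auto intro!: exI[of _ 0]\<close>)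
      then show ?thesis unfolding torsion_at_def boundaries_def by simp
    qed
  qed
  have cancel: "x \<in> boundaries A B d (Suc i)"
    if x: "x \<in> A (Suc i)" and zx: "scale z x \<in> boundaries A B d (Suc i)" for x
  proof -
    obtain y b where y: "y \<in> A (Suc (Suc i))" and b: "b \<in> B (Suc i)" and eq: "scale z x = d (Suc i) y + b"
      using zx by (metis boundariesE)
    \<comment> \<open>Hence \<open>y\<close> is a cycle modulo \<open>z\<close>, and the induction
      hypothesis writes it as a boundary plus \<open>z u\<close> plus a relation. Comparing
      differentials leaves \<open>z (x - d u)\<close> in the relations, where \<open>z\<close> can
      be cancelled.\<close>
    have "d (Suc i) y = scale z x + - b" using eq by simp
    also have "\<dots> \<in> B' (Suc i)" unfolding B'_def using x b by (intro add_multiplesI subspace_neg[OF D(2)])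
    finally have "y \<in> boundaries ?A ?B ?d (Suc i)" using y by (intro ex)
    then obtain v b' where v: "v \<in> A (Suc (Suc (Suc i)))" and "b' \<in> B' (Suc (Suc i))" and "y = d (Suc (Suc i)) v + b'"
      by (metis boundariesE)
    then obtain u b'' where u: "u \<in> A (Suc (Suc i))" and b'': "b'' \<in> B (Suc (Suc i))"
      and y_eq: "y = d (Suc (Suc i)) v + (scale z u + b'')"
      unfolding B'_def by (metis add_multiplesE)
    have "d (Suc i) y = d (Suc i) (d (Suc (Suc i)) v) + (scale z (d (Suc i) u) + d (Suc i) b'')"
      unfolding y_eq using u v D(3)[OF b''] by (simp add: H subspace_add[OF D(1)] subspace_scale[OF D(1)])
    then have "scale z (x - d (Suc i) u) = d (Suc i) (d (Suc (Suc i)) v) + d (Suc i) b'' + b"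
      using eq by (simp add: scale_right_diff_distrib algebra_simps)
    also have "\<dots> \<in> B (Suc i)" using v b'' b by (intro subspace_add[OF D(2)] D(5,6))
    finally have "x - d (Suc i) u \<in> B (Suc i)"
      using reg[of "x - d (Suc i) u" "Suc i"] x u by (auto intro!: subspace_diff[OF D(1)] H(1))
    then show ?thesis using boundariesI[of u A "Suc i" "x - d (Suc i) u" B d] u by simp
  qed
  have powers: "x \<in> boundaries A B d (Suc i)"
    if "x \<in> A (Suc i)" "scale (z ^ s) x \<in> boundaries A B d (Suc i)" for s x
    using that
  proof (induction s arbitrary: x)
    case (Suc s)
    have "scale (z ^ s) (scale z x) \<in> boundaries A B d (Suc i)"
      using Suc.prems(2) by (simp only: scale_scale power_Suc2)
    then have "scale z x \<in> boundaries A B d (Suc i)"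
      by (rule Suc.IH[OF subspace_scale[OF D(1) Suc.prems(1)]])
    then show ?case using cancel Suc.prems(1) by blast
  qed simp
  obtain s where "scale (z ^ s) x \<in> boundaries A B d (Suc i)"
    using Cons.prems(4)[of z i] Cons.prems(5,6) unfolding torsion_at_def by auto
  then show ?case using Cons.prems(5) powers by blast
qed

end

section \<open>Polynomials and linear substitutions\<close>

lemma const_poly_0 [simp]: "const_poly 0 = 0"
  and const_poly_1 [simp]: "const_poly 1 = 1"
  and const_poly_add: "const_poly (a + b) = const_poly a + const_poly b"
  and const_poly_mult: "const_poly (a * b) = const_poly a * const_poly b"
  and const_poly_minus: "const_poly (- a) = - const_poly a"
  by (simp_all add: const_poly_def single_add mult_single single_uminus)

lemma const_poly_diff: "const_poly (a - b) = const_poly a - const_poly b"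
  using const_poly_add[of a "- b"] by (simp add: const_poly_minus)

lemma const_poly_sum: "const_poly (sum f I) = (\<Sum>i\<in>I. const_poly (f i))"
  by (induction I rule: infinite_finite_induct) (auto simp: const_poly_add)

lemma const_poly_eq_iff [simp]: "const_poly a = const_poly b \<longleftrightarrow> a = b"
  by (simp add: const_poly_def inj_single[THEN inj_eq])

lemma const_poly_eq_0_iff [simp]: "const_poly a = 0 \<longleftrightarrow> a = 0"
  using const_poly_eq_iff[of a 0] by simp

lemma poly_mapping_sum_singles: "f = (\<Sum>m\<in>Poly_Mapping.keys f. Poly_Mapping.single m (Poly_Mapping.lookup f m))"
  by (rule poly_mapping_eqI)
    (auto simp: lookup_sum lookup_single when_def in_keys_iff)

lemma single_eq_prod_var_poly:
  fixes m :: "'n::finite \<Rightarrow>\<^sub>0 nat"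
  shows "(Poly_Mapping.single m 1 :: ('k::field, 'n) mpoly) = (\<Prod>i\<in>UNIV. var_poly i ^ Poly_Mapping.lookup m i)"
proof -
  have pow: "(var_poly i :: ('k, 'n) mpoly) ^ e = Poly_Mapping.single (Poly_Mapping.single i e) 1" for i e
    by (induction e) (auto simp: var_poly_def mult_single single_add[symmetric])
  have "(\<Prod>i\<in>I. (var_poly i :: ('k, 'n) mpoly) ^ Poly_Mapping.lookup m i) =
      Poly_Mapping.single (\<Sum>i\<in>I. Poly_Mapping.single i (Poly_Mapping.lookup m i)) 1" for I
    by (induction I rule: infinite_finite_induct) (auto simp: pow mult_single)
  moreover have "(\<Sum>i\<in>UNIV. Poly_Mapping.single i (Poly_Mapping.lookup m i)) = m"
    by (rule poly_mapping_eqI) (auto simp: lookup_sum lookup_single when_def)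
  ultimately show ?thesis by simp
qed

lemma mpoly_induct [case_names const var add mult]:
  fixes f :: "('k::field, 'n::finite) mpoly"
  assumes const: "\<And>c. P (const_poly c)" and var: "\<And>i. P (var_poly i)"
    and add: "\<And>f g. P f \<Longrightarrow> P g \<Longrightarrow> P (f + g)" and mult: "\<And>f g. P f \<Longrightarrow> P g \<Longrightarrow> P (f * g)"
  shows "P f"
proof -
  have one: "P 1" using const[of 1] by simp
  have pow: "P (f ^ e)" if "P f" for f e by (induction e) (auto simp: one mult that)
  have prod: "P (prod f I)" if "\<And>i. P (f i)" for I :: "'n set" and f
    by (induction I rule: infinite_finite_induct) (auto simp: one mult that)
  have "P (Poly_Mapping.single m c)" for m c
  proof -
    have "Poly_Mapping.single m c = const_poly c * Poly_Mapping.single m 1"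
      by (simp add: const_poly_def mult_single)
    then show ?thesis
      unfolding single_eq_prod_var_poly by (simp add: const var mult prod pow)
  qed
  then have "P (\<Sum>m\<in>I. Poly_Mapping.single m (Poly_Mapping.lookup f m))" for I
    using const[of 0] by (induction I rule: infinite_finite_induct) (auto simp: add)
  from this[of "Poly_Mapping.keys f"] show ?thesis by (simp flip: poly_mapping_sum_singles)
qed

definition poly_subst :: "('n \<Rightarrow> ('k::field, 'm) mpoly) \<Rightarrow> ('k, 'n::finite) mpoly \<Rightarrow> ('k, 'm) mpoly" where
  "poly_subst g f =
     (\<Sum>m\<in>Poly_Mapping.keys f. const_poly (Poly_Mapping.lookup f m) * (\<Prod>i\<in>UNIV. g i ^ Poly_Mapping.lookup m i))"

lemma poly_subst_superset:
  assumes "finite I" "Poly_Mapping.keys f \<subseteq> I"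
  shows "poly_subst g f =
     (\<Sum>m\<in>I. const_poly (Poly_Mapping.lookup f m) * (\<Prod>i\<in>UNIV. g i ^ Poly_Mapping.lookup m i))"
  unfolding poly_subst_def by (rule sum.mono_neutral_left[OF assms]) (simp add: in_keys_iff)

lemma poly_subst_add: "poly_subst g (f + h) = poly_subst g f + poly_subst g h"
proof -
  let ?I = "Poly_Mapping.keys f \<union> Poly_Mapping.keys h"
  have "poly_subst g u = (\<Sum>m\<in>?I. const_poly (Poly_Mapping.lookup u m) * (\<Prod>i\<in>UNIV. g i ^ Poly_Mapping.lookup m i))"
    if "u \<in> {f, h, f + h}" for u
    using that keys_add[of f h] by (intro poly_subst_superset) auto
  then show ?thesis by (simp add: lookup_add const_poly_add distrib_right sum.distrib)
qed

lemma poly_subst_0 [simp]: "poly_subst g 0 = 0"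
  by (simp add: poly_subst_def)

lemma poly_subst_sum: "poly_subst g (sum f I) = (\<Sum>i\<in>I. poly_subst g (f i))"
  by (induction I rule: infinite_finite_induct) (auto simp: poly_subst_add)

lemma poly_subst_single: "poly_subst g (Poly_Mapping.single m c) = const_poly c * (\<Prod>i\<in>UNIV. g i ^ Poly_Mapping.lookup m i)"
  by (cases "c = 0") (auto simp: poly_subst_def)

lemma poly_subst_const [simp]: "poly_subst g (const_poly c) = const_poly c"
  unfolding const_poly_def poly_subst_single by (simp add: const_poly_def)

lemma poly_subst_1 [simp]: "poly_subst g 1 = 1"
  using poly_subst_const[of g 1] by simp

lemma poly_subst_var [simp]: "poly_subst g (var_poly i) = g i"
proof -
  have "(\<Prod>j\<in>UNIV. g j ^ Poly_Mapping.lookup (Poly_Mapping.single i 1) j) = (\<Prod>j\<in>UNIV. if i = j then g j else 1)"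
    by (intro prod.cong) (auto simp: lookup_single when_def)
  then show ?thesis unfolding var_poly_def poly_subst_single by simp
qed

lemma poly_subst_mult: "poly_subst g (f * h) = poly_subst g f * poly_subst g h"
proof -
  have single: "poly_subst g (Poly_Mapping.single m c * Poly_Mapping.single m' c') =
      poly_subst g (Poly_Mapping.single m c) * poly_subst g (Poly_Mapping.single m' c')" for m c m' c'
    by (simp add: mult_single poly_subst_single lookup_add power_add const_poly_mult prod.distrib mult_ac)
  let ?F = "\<lambda>f m. Poly_Mapping.single m (Poly_Mapping.lookup f m)"
  have "poly_subst g (sum (?F f) I * sum (?F h) J) = poly_subst g (sum (?F f) I) * poly_subst g (sum (?F h) J)" for I J
    by (simp add: sum_product poly_subst_sum single)
  from this[of "Poly_Mapping.keys f" "Poly_Mapping.keys h"] show ?thesis by (simp flip: poly_mapping_sum_singles)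
qed

lemma poly_subst_uminus: "poly_subst g (- f) = - poly_subst g f"
  using poly_subst_add[of g f "- f"] by (simp add: eq_neg_iff_add_eq_0 add.commute)

lemma poly_subst_diff: "poly_subst g (f - h) = poly_subst g f - poly_subst g h"
  using poly_subst_add[of g f "- h"] by (simp add: poly_subst_uminus)

lemma poly_subst_prod: "poly_subst g (prod f I) = (\<Prod>i\<in>I. poly_subst g (f i))"
  by (induction I rule: infinite_finite_induct) (auto simp: poly_subst_mult)

lemma poly_subst_power: "poly_subst g (f ^ e) = poly_subst g f ^ e"
  by (induction e) (auto simp: poly_subst_mult)

lemmas poly_subst_hom = poly_subst_add poly_subst_mult poly_subst_uminus poly_subst_diff
  poly_subst_sum poly_subst_prod poly_subst_power

lemma poly_subst_poly_subst: "poly_subst g (poly_subst h f) = poly_subst (\<lambda>i. poly_subst g (h i)) f"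
  by (induction f rule: mpoly_induct) (simp_all add: poly_subst_hom)

text \<open>Compared with the identity substitution, this shows that \<open>f\<close> differs from
  its pullback along a projection by an element of the ideal of the forms projected away.\<close>

lemma poly_subst_cong_ideal:
  fixes f :: "('k::field, 'n::finite) mpoly"
  assumes "0 \<in> J" and add_J: "\<And>a b. a \<in> J \<Longrightarrow> b \<in> J \<Longrightarrow> a + b \<in> J" and mult_J: "\<And>a b. b \<in> J \<Longrightarrow> a * b \<in> J"
    and "\<And>i. g i - h i \<in> J"
  shows "poly_subst g f - poly_subst h f \<in> J"
proof (induction f rule: mpoly_induct)
  case (mult a b)
  have "poly_subst g (a * b) - poly_subst h (a * b) =
    poly_subst g b * (poly_subst g a - poly_subst h a) + poly_subst h a * (poly_subst g b - poly_subst h b)"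
    by (simp add: poly_subst_mult algebra_simps)
  then show ?case using mult by (simp add: add_J mult_J)
next
  case (add a b)
  have "poly_subst g (a + b) - poly_subst h (a + b) =
    (poly_subst g a - poly_subst h a) + (poly_subst g b - poly_subst h b)"
    by (simp add: poly_subst_add)
  then show ?case using add by (simp only: add_J)
qed (use assms in auto)

lemma poly_subst_var_id [simp]: "poly_subst var_poly f = f"
  by (induction f rule: mpoly_induct) (simp_all add: poly_subst_hom)

section \<open>Linear forms as coefficient vectors\<close>

definition dot :: "'k::field ^ 'n::finite \<Rightarrow> 'k ^ 'n \<Rightarrow> 'k" where
  "dot a v = (\<Sum>i\<in>UNIV. a $ i * v $ i)"

lemma dot_simps [simp]:
  "dot (a + b) v = dot a v + dot b v" "dot a (v + w) = dot a v + dot a w"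
  "dot (a - b) v = dot a v - dot b v" "dot a (v - w) = dot a v - dot a w"
  "dot (c *s a) v = c * dot a v" "dot a (c *s v) = c * dot a v"
  "dot 0 v = 0" "dot a 0 = 0" "dot (axis j 1) v = v $ j" "dot a (axis j 1) = a $ j"
  by (simp_all add: dot_def algebra_simps sum.distrib sum_subtractf sum_distrib_left axis_def
        if_distrib[of "\<lambda>x. x * _"] if_distrib[of "\<lambda>x. _ * x"] cong: if_cong)

lemma dot_sum_left: "dot (\<Sum>i\<in>I. f i) v = (\<Sum>i\<in>I. dot (f i) v)"
  by (induction I rule: infinite_finite_induct) auto

lemma dot_sum_right: "dot a (\<Sum>i\<in>I. f i) = (\<Sum>i\<in>I. dot a (f i))"
  by (induction I rule: infinite_finite_induct) auto

lemma dot_eq_0_imp: "(\<And>v. dot a v = 0) \<Longrightarrow> a = 0"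
  using dot_simps(10)[of a] by (auto simp: vec_eq_iff simp del: dot_simps)

definition lin_poly :: "'k::field ^ 'n::finite \<Rightarrow> ('k, 'n) mpoly" where
  "lin_poly a = (\<Sum>i\<in>UNIV. const_poly (a $ i) * var_poly i)"

lemma lin_poly_simps: "lin_poly 0 = 0" "lin_poly (a + b) = lin_poly a + lin_poly b"
  "lin_poly (c *s a) = const_poly c * lin_poly a" "lin_poly (a - b) = lin_poly a - lin_poly b"
  "lin_poly (axis i 1) = var_poly i"
  by (simp_all add: lin_poly_def const_poly_add const_poly_mult const_poly_diff algebra_simps sum.distrib
      sum_subtractf sum_distrib_left axis_def if_distrib[of const_poly] if_distrib[of "\<lambda>x. x * _"] if_distrib[of "\<lambda>x. _ * x"] cong: if_cong)

lemma lin_poly_sum: "lin_poly (\<Sum>i\<in>I. f i) = (\<Sum>i\<in>I. lin_poly (f i))"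
  by (induction I rule: infinite_finite_induct) (auto simp: lin_poly_simps)

lemma lookup_lin_poly:
  fixes a :: "'k::field ^ 'n::finite"
  shows "Poly_Mapping.lookup (lin_poly a) (Poly_Mapping.single i 1) = a $ i"
proof -
  have *: "const_poly c * var_poly j = Poly_Mapping.single (Poly_Mapping.single j 1) c" for c :: 'k and j :: 'n
    by (simp add: const_poly_def var_poly_def mult_single)
  have "Poly_Mapping.single j (1::nat) = Poly_Mapping.single i 1 \<longleftrightarrow> j = i" for i j :: 'n
    by (metis keys_single singleton_iff zero_neq_one)
  then show ?thesis unfolding lin_poly_def * by (simp add: lookup_sum lookup_single when_def cong: if_cong)
qed

lemma lin_poly_eq_0_iff [simp]: "lin_poly a = 0 \<longleftrightarrow> a = 0"
proof
  assume "lin_poly a = 0"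
  then have "a $ i = 0" for i using lookup_lin_poly[of a i] by simp
  then show "a = 0" by (simp add: vec_eq_iff)
qed (simp add: lin_poly_simps)

lemma poly_subst_lin_poly: "poly_subst g (lin_poly a) = (\<Sum>i\<in>UNIV. const_poly (a $ i) * g i)"
  by (simp add: lin_poly_def poly_subst_hom)

lemma poly_subst_zero_lin_poly [simp]: "poly_subst (\<lambda>_. 0) (lin_poly a) = 0"
  by (simp add: poly_subst_lin_poly)

text \<open>The first \<open>c\<close> vectors \<open>w\<close> span a complement of the common
  zeros of the first \<open>c\<close> forms \<open>y\<close>. The \<open>y\<close> stay fixed
  throughout, whereas \<open>w\<close> is chosen anew inside each flat.\<close>

abbreviation dual_systems :: "nat \<Rightarrow> (nat \<Rightarrow> 'k::field ^ 'n::finite) \<Rightarrow> (nat \<Rightarrow> 'k ^ 'n) \<Rightarrow> bool" where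
  "dual_systems c y w \<equiv> \<forall>a<c. \<forall>b<c. dot (y a) (w b) = (if a = b then 1 else 0)"

lemma exists_dot_eq_1:
  assumes "a \<noteq> 0"
  obtains w where "dot a w = 1"
proof -
  obtain v where "dot a v \<noteq> 0" using dot_eq_0_imp assms by blast
  then show ?thesis using that[of "inverse (dot a v) *s v"] by simp
qed

lemma proportional_if_kernel_subset:
  assumes "\<And>v. dot a v = 0 \<Longrightarrow> dot b v = 0"
  obtains c where "b = c *s a"
proof (cases "a = 0")
  case True
  then have "b = 0" using assms by (intro dot_eq_0_imp) simp
  then show ?thesis using that[of 0] by simp
next
  case False
  then obtain w where w: "dot a w = 1" using exists_dot_eq_1 by blast
  have "dot (b - dot b w *s a) v = 0" for v
    using assms[of "v - dot a v *s w"] w by (simp add: mult.commute)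
  then have "b - dot b w *s a = 0" by (rule dot_eq_0_imp)
  then have "b = dot b w *s a" by simp
  then show ?thesis by (rule that)
qed

lemma lin_poly_dvd_lin_poly:
  assumes "\<And>v. dot a v = 0 \<Longrightarrow> dot b v = 0"
  shows "lin_poly a dvd lin_poly b"
  using proportional_if_kernel_subset[of a b] assms by (metis dvd_triv_right lin_poly_simps(3))

section \<open>Pullback of polynomials along linear maps\<close>

definition pullback_coeff :: "('k::field ^ 'm::finite \<Rightarrow> 'k ^ 'n::finite) \<Rightarrow> 'k ^ 'n \<Rightarrow> 'k ^ 'm" where
  "pullback_coeff \<phi> a = (\<chi> j. dot a (\<phi> (axis j 1)))"

definition pullback :: "('k::field ^ 'm::finite \<Rightarrow> 'k ^ 'n::finite) \<Rightarrow> ('k, 'n) mpoly \<Rightarrow> ('k, 'm) mpoly" where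
  "pullback \<phi> = poly_subst (\<lambda>i. lin_poly (pullback_coeff \<phi> (axis i 1)))"

lemmas pullback_hom [simp] = poly_subst_hom[of "\<lambda>i. lin_poly (pullback_coeff \<phi> (axis i 1))" for \<phi>, folded pullback_def]
  poly_subst_0[of "\<lambda>i. lin_poly (pullback_coeff \<phi> (axis i 1))" for \<phi>, folded pullback_def]
  poly_subst_1[of "\<lambda>i. lin_poly (pullback_coeff \<phi> (axis i 1))" for \<phi>, folded pullback_def]
  poly_subst_const[of "\<lambda>i. lin_poly (pullback_coeff \<phi> (axis i 1))" for \<phi>, folded pullback_def]

lemma pullback_dvd: "f dvd g \<Longrightarrow> pullback \<phi> f dvd pullback \<phi> g"
  by (auto elim!: dvdE)

lemma linear_eq_sum_axis:
  assumes "Vector_Spaces.linear (*s) (*s) \<phi>"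
  shows "\<phi> v = (\<Sum>j\<in>UNIV. v $ j *s \<phi> (axis j 1))"
  using linear_componentwise[OF assms, of v] by (simp add: vec_eq_iff)

lemma dot_pullback_coeff:
  assumes "Vector_Spaces.linear (*s) (*s) \<phi>"
  shows "dot (pullback_coeff \<phi> a) v = dot a (\<phi> v)"
proof -
  have "dot a (\<phi> v) = (\<Sum>j\<in>UNIV. v $ j * dot a (\<phi> (axis j 1)))"
    by (subst linear_eq_sum_axis[OF assms]) (simp add: dot_sum_right)
  also have "\<dots> = dot (pullback_coeff \<phi> a) v"
    unfolding dot_def[of "pullback_coeff \<phi> a"] by (simp add: pullback_coeff_def mult.commute)
  finally show ?thesis ..
qed

lemma pullback_coeff_hom: "pullback_coeff \<phi> (a + b) = pullback_coeff \<phi> a + pullback_coeff \<phi> b"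
  "pullback_coeff \<phi> (c *s a) = c *s pullback_coeff \<phi> a"
  by (simp_all add: vec_eq_iff pullback_coeff_def)

lemma pullback_lin_poly [simp]: "pullback \<phi> (lin_poly a) = lin_poly (pullback_coeff \<phi> a)"
proof -
  have 0: "pullback_coeff \<phi> 0 = 0" using pullback_coeff_hom(2)[of \<phi> 0 0] by simp
  have "pullback_coeff \<phi> (\<Sum>i\<in>I. a $ i *s axis i 1) = (\<Sum>i\<in>I. a $ i *s pullback_coeff \<phi> (axis i 1))" for I
    by (induction I rule: infinite_finite_induct) (auto simp: pullback_coeff_hom 0)
  then have "pullback_coeff \<phi> a = (\<Sum>i\<in>UNIV. a $ i *s pullback_coeff \<phi> (axis i 1))"
    by (metis basis_expansion)
  then show ?thesis
    by (simp add: pullback_def poly_subst_lin_poly lin_poly_sum lin_poly_simps)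
qed

lemma pullback_pullback:
  assumes "Vector_Spaces.linear (*s) (*s) \<phi>" "Vector_Spaces.linear (*s) (*s) \<psi>"
  shows "pullback \<psi> (pullback \<phi> f) = pullback (\<lambda>v. \<phi> (\<psi> v)) f"
proof -
  have eq: "pullback_coeff \<psi> (pullback_coeff \<phi> a) = pullback_coeff (\<lambda>v. \<phi> (\<psi> v)) a" for a
    by (simp add: pullback_coeff_def[of \<psi>] pullback_coeff_def[of "\<lambda>v. \<phi> (\<psi> v)"] dot_pullback_coeff[OF assms(1)])
  have "pullback \<psi> (pullback \<phi> f) = poly_subst (\<lambda>i. pullback \<psi> (lin_poly (pullback_coeff \<phi> (axis i 1)))) f"
    unfolding pullback_def by (rule poly_subst_poly_subst)
  also have "\<dots> = pullback (\<lambda>v. \<phi> (\<psi> v)) f"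
    by (simp only: pullback_lin_poly eq pullback_def[of "\<lambda>v. \<phi> (\<psi> v)"])
  finally show ?thesis .
qed

lemma pullback_id [simp]:
  fixes f :: "('k::field, 'n::finite) mpoly"
  shows "pullback (\<lambda>v. v) f = f"
proof -
  have "pullback_coeff (\<lambda>v. v) a = a" for a :: "'k ^ 'n" by (simp add: pullback_coeff_def vec_eq_iff)
  then show ?thesis by (simp add: pullback_def lin_poly_simps)
qed

section \<open>Projection along a vector as reduction modulo a linear form\<close>

definition proj_along :: "'k::field ^ 'n::finite \<Rightarrow> 'k ^ 'n \<Rightarrow> 'k ^ 'n \<Rightarrow> 'k ^ 'n" where
  "proj_along y w v = v - dot y v *s w"

lemma linear_proj_along: "Vector_Spaces.linear (*s) (*s) (proj_along y w)"
  by unfold_locales (simp_all add: proj_along_def vec_eq_iff algebra_simps)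

lemma pullback_coeff_proj_along: "pullback_coeff (proj_along y w) a = a - dot a w *s y"
proof -
  have "dot (pullback_coeff (proj_along y w) a - (a - dot a w *s y)) v = 0" for v
    by (simp add: dot_pullback_coeff linear_proj_along) (simp add: proj_along_def)
  then have "pullback_coeff (proj_along y w) a - (a - dot a w *s y) = 0" by (rule dot_eq_0_imp)
  then show ?thesis by simp
qed

lemma lin_poly_dvd_diff_pullback: "lin_poly y dvd f - pullback (proj_along y w) f"
proof -
  have "poly_subst var_poly f - pullback (proj_along y w) f \<in> {g. lin_poly y dvd g}" unfolding pullback_def
    by (rule poly_subst_cong_ideal) (auto simp: pullback_coeff_proj_along lin_poly_simps)
  then show ?thesis by simp
qed

text \<open>The pullback is a retraction of the polynomial ring onto a subring, with kernel
  generated by \<open>lin_poly y\<close>. Divisibility thus becomes vanishing under a ring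
  homomorphism into a domain, which makes nonzero linear forms prime at once.\<close>

lemma lin_poly_dvd_iff_pullback:
  assumes "dot y w = 1"
  shows "lin_poly y dvd f \<longleftrightarrow> pullback (proj_along y w) f = 0"
proof
  assume "lin_poly y dvd f"
  then show "pullback (proj_along y w) f = 0"
    using assms by (auto elim!: dvdE simp: pullback_coeff_proj_along lin_poly_simps)
qed (use lin_poly_dvd_diff_pullback[of y f w] in simp)

lemma lin_poly_dvd_multD:
  fixes f g :: "('k::field, 'n::{finite,linorder}) mpoly"
  assumes "lin_poly a dvd f * g"
  shows "lin_poly a dvd f \<or> lin_poly a dvd g"
proof (cases "a = 0")
  case False
  then obtain w where "dot a w = 1" using exists_dot_eq_1 by blast
  then show ?thesis using assms by (simp add: lin_poly_dvd_iff_pullback)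
qed (use assms in \<open>simp add: lin_poly_simps\<close>)

lemma lin_poly_dvd_prodD:
  fixes f :: "'i \<Rightarrow> ('k::field, 'n::{finite,linorder}) mpoly"
  assumes "finite I" "a \<noteq> 0" "lin_poly a dvd prod f I"
  shows "\<exists>i\<in>I. lin_poly a dvd f i"
proof -
  obtain w where "dot a w = 1" using exists_dot_eq_1 assms by blast
  then show ?thesis using assms(1,3) by (simp add: lin_poly_dvd_iff_pullback)
qed

lemma lin_poly_dvd_lin_polyD:
  assumes "lin_poly a dvd lin_poly b" "dot a v = 0"
  shows "dot b v = 0"
proof (cases "a = 0")
  case True
  then show ?thesis using assms by (simp add: lin_poly_simps)
next
  case False
  then obtain w where w: "dot a w = 1" using exists_dot_eq_1 by blast
  have "b - dot b w *s a = 0"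
    using assms(1) unfolding lin_poly_dvd_iff_pullback[OF w] by (simp add: pullback_coeff_proj_along)
  then have "dot b v = dot (dot b w *s a) v" by simp
  then show ?thesis using assms(2) by simp
qed

text \<open>Each factor is prime and divides none of the others, so the factors split off one at a
  time.\<close>

lemma prod_lin_poly_dvd:
  fixes f :: "('k::field, 'n::{finite,linorder}) mpoly"
  assumes "finite I" "\<And>i. i \<in> I \<Longrightarrow> a i \<noteq> 0" "\<And>i. i \<in> I \<Longrightarrow> lin_poly (a i) dvd f"
    "\<And>i j. i \<in> I \<Longrightarrow> j \<in> I \<Longrightarrow> lin_poly (a i) dvd lin_poly (a j) \<Longrightarrow> i = j"
  shows "(\<Prod>i\<in>I. lin_poly (a i)) dvd f"
  using assms
proof (induction I arbitrary: f rule: finite_induct)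
  case (insert i I)
  obtain g where g: "f = lin_poly (a i) * g" using insert.prems(2) by (auto elim: dvdE)
  have "lin_poly (a j) dvd g" if "j \<in> I" for j
    using lin_poly_dvd_multD[of "a j" "lin_poly (a i)" g] insert.prems insert.hyps that g by blast
  then have "(\<Prod>j\<in>I. lin_poly (a j)) dvd g" using insert.prems by (intro insert.IH) auto
  then show ?case using insert.hyps by (simp add: g)
qed simp

text \<open>For dual systems this is reduction modulo \<open>y 0, ..., y (j - 1)\<close>, realised
  as a ring endomorphism instead of a quotient ring.\<close>

primrec eliminate :: "(nat \<Rightarrow> 'k::field ^ 'n::finite) \<Rightarrow> (nat \<Rightarrow> 'k ^ 'n) \<Rightarrow> nat \<Rightarrow> ('k, 'n) mpoly \<Rightarrow> ('k, 'n) mpoly" where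
  "eliminate y w 0 f = f"
| "eliminate y w (Suc j) f = pullback (proj_along (y j) (w j)) (eliminate y w j f)"

lemma eliminate_hom [simp]: "eliminate y w j (f + g) = eliminate y w j f + eliminate y w j g"
  "eliminate y w j (f * g) = eliminate y w j f * eliminate y w j g"
  "eliminate y w j (f - g) = eliminate y w j f - eliminate y w j g"
  "eliminate y w j (const_poly c) = const_poly c" "eliminate y w j 0 = 0"
  "eliminate y w j (sum h I) = (\<Sum>i\<in>I. eliminate y w j (h i))"
  "eliminate y w j (prod h I) = (\<Prod>i\<in>I. eliminate y w j (h i))"
  by (induction j) auto

lemma eliminate_lin_poly_fixed:
  assumes "\<And>b. b < j \<Longrightarrow> dot a (w b) = 0"
  shows "eliminate y w j (lin_poly a) = lin_poly a"
  using assms by (induction j) (auto simp: pullback_coeff_proj_along)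

lemma eliminate_lin_poly_killed:
  assumes "dual_systems c y w" "i < j" "j \<le> c"
  shows "eliminate y w j (lin_poly (y i)) = 0"
  using assms(2,3)
proof (induction j)
  case (Suc j)
  show ?case
  proof (cases "i = j")
    case True
    have "eliminate y w j (lin_poly (y j)) = lin_poly (y j)"
      using assms(1) Suc.prems by (intro eliminate_lin_poly_fixed) auto
    then show ?thesis using assms(1) Suc.prems by (simp add: True pullback_coeff_proj_along lin_poly_simps)
  qed (use Suc in auto)
qed simp

lemma eliminate_lin_poly_later:
  assumes "dual_systems c y w" "j \<le> i" "i < c"
  shows "eliminate y w j (lin_poly (y i)) = lin_poly (y i)"
  using assms by (intro eliminate_lin_poly_fixed) auto

section \<open>Dual bases and regular sequences of linear forms\<close>

primrec ideal_gen :: "'a::comm_ring_1 list \<Rightarrow> 'a set" where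
  "ideal_gen [] = {0}"
| "ideal_gen (g # gs) = {g * x + b | x b. b \<in> ideal_gen gs}"

lemma zero_in_ideal_gen [simp]: "0 \<in> ideal_gen gs"
proof (induction gs)
  case (Cons g gs)
  then show ?case by (auto intro!: exI[of _ 0])
qed simp

lemma ideal_gen_add: "a \<in> ideal_gen gs \<Longrightarrow> b \<in> ideal_gen gs \<Longrightarrow> a + b \<in> ideal_gen gs"
proof (induction gs arbitrary: a b)
  case (Cons g gs)
  then obtain x a' y b' where *: "a = g * x + a'" "b = g * y + b'" "a' \<in> ideal_gen gs" "b' \<in> ideal_gen gs" by auto
  then have "a + b = g * (x + y) + (a' + b')" by (simp add: algebra_simps)
  then show ?case using Cons.IH[OF *(3,4)] by auto
qed simp

lemma ideal_gen_mult: "a \<in> ideal_gen gs \<Longrightarrow> c * a \<in> ideal_gen gs"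
proof (induction gs arbitrary: a)
  case (Cons g gs)
  then obtain x a' where *: "a = g * x + a'" "a' \<in> ideal_gen gs" by auto
  then have "c * a = g * (c * x) + c * a'" by (simp add: algebra_simps)
  then show ?case using Cons.IH[OF *(2)] by auto
qed simp

text \<open>Listed by descending index, so that behind each form stand exactly those of smaller
  index.\<close>

abbreviation lin_polys :: "(nat \<Rightarrow> 'k::field ^ 'n::finite) \<Rightarrow> nat \<Rightarrow> ('k, 'n) mpoly list" where
  "lin_polys y j \<equiv> map (\<lambda>i. lin_poly (y i)) (rev [0..<j])"

lemma diff_eliminate_in_ideal_gen: "f - eliminate y w j f \<in> ideal_gen (lin_polys y j)"
proof (induction j)
  case (Suc j)
  obtain g where g: "eliminate y w j f - eliminate y w (Suc j) f = lin_poly (y j) * g"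
    using lin_poly_dvd_diff_pullback[of "y j" "eliminate y w j f" "w j"] by (auto elim: dvdE)
  have "f - eliminate y w (Suc j) f = (f - eliminate y w j f) + (eliminate y w j f - eliminate y w (Suc j) f)" by simp
  also have "\<dots> = lin_poly (y j) * g + (f - eliminate y w j f)" unfolding g by simp
  also have "\<dots> \<in> ideal_gen (lin_polys y (Suc j))" using Suc by auto
  finally show ?case .
qed simp

text \<open>\<open>eliminate\<close> kills the generators and moves every polynomial only within its
  class modulo the ideal. Regularity of the next form then reduces to cancellation in a
  domain.\<close>

lemma in_ideal_gen_iff_eliminate:
  assumes "dual_systems c y w" "j \<le> c"
  shows "f \<in> ideal_gen (lin_polys y j) \<longleftrightarrow> eliminate y w j f = 0"
proof
  have "eliminate y w j f = 0" if "f \<in> ideal_gen (lin_polys y i)" "i \<le> j" for i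
    using that
  proof (induction i arbitrary: f)
    case (Suc i)
    then show ?case using eliminate_lin_poly_killed[OF assms(1), of i j] assms(2) by auto
  qed simp
  then show "f \<in> ideal_gen (lin_polys y j) \<Longrightarrow> eliminate y w j f = 0" by blast
qed (use diff_eliminate_in_ideal_gen[of f y w j] in simp)

lemma lin_poly_regular:
  fixes f :: "('k::field, 'n::{finite,linorder}) mpoly"
  assumes d: "dual_systems c y w" and j: "j < c" and f: "lin_poly (y j) * f \<in> ideal_gen (lin_polys y j)"
  shows "f \<in> ideal_gen (lin_polys y j)"
proof -
  have "eliminate y w j (lin_poly (y j) * f) = 0"
    using f in_ideal_gen_iff_eliminate[OF d] j by (metis less_imp_le)
  moreover have "eliminate y w j (lin_poly (y j)) = lin_poly (y j)"
    using eliminate_lin_poly_later[OF d, of j j] j by simp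
  moreover have "y j \<noteq> 0" using d j by (metis dot_simps(7) zero_neq_one)
  ultimately have "eliminate y w j f = 0" by simp
  then show ?thesis using in_ideal_gen_iff_eliminate[OF d] j by (metis less_imp_le)
qed

context ring_module
begin

text \<open>The dual basis criterion for projectivity, asked for one element at a time with a finite
  list. This form passes to direct sums and suffices to transfer regular sequences from the ring to
  the module.\<close>

definition has_dual_bases :: "'b set \<Rightarrow> bool" where
  "has_dual_bases A \<longleftrightarrow> (\<forall>x\<in>A. \<exists>ts. (\<forall>(l, a)\<in>set ts. hom_on scale A (*) UNIV l \<and> a \<in> A) \<and>
     x = (\<Sum>(l, a)\<leftarrow>ts. scale (l x) a))"

lemma scale_ideal_gen_in_adjoin: "f \<in> ideal_gen gs \<Longrightarrow> a \<in> A \<Longrightarrow> subspace A \<Longrightarrow> scale f a \<in> adjoin gs A {0}"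
proof (induction gs arbitrary: f)
  case (Cons g gs)
  then obtain x b where "f = g * x + b" and b: "b \<in> ideal_gen gs" by auto
  then have eq: "scale f a = scale g (scale x a) + scale b a" by (simp add: scale_left_distrib)
  show ?case unfolding eq adjoin_simps
    by (rule add_multiplesI[OF subspace_scale[OF Cons.prems(3,2)] Cons.IH[OF b Cons.prems(2,3)]])
qed simp

lemma hom_adjoin_in_ideal_gen:
  assumes l: "hom_on scale A (*) UNIV l" and A: "subspace A"
  shows "y \<in> adjoin gs A {0} \<Longrightarrow> l y \<in> ideal_gen gs"
proof (induction gs arbitrary: y)
  case Nil
  have "l (scale 0 0) = 0 * l 0" using l A by (intro hom_onD(3)[OF l]) (auto simp: subspace_0)
  then show ?case using Nil by simp
next
  case (Cons g gs)
  then obtain x b where x: "x \<in> A" and b: "b \<in> adjoin gs A {0}" and y: "y = scale g x + b" by (auto elim: add_multiplesE)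
  have "b \<in> A" using adjoin_subset[OF A, of "{0}" gs] b subspace_0[OF A] by auto
  then have "l y = g * l x + l b"
    using x A by (simp add: y hom_onD(2,3)[OF l] subspace_scale)
  then show ?case using Cons.IH[OF b] by auto
qed

text \<open>The functionals \<open>l\<close> carry the hypothesis on \<open>x\<close> to one on
  \<open>l x\<close> in the ring, where regularity is known; the expansion of \<open>x\<close>
  brings the conclusion back.\<close>

lemma regular_if_dual_bases:
  assumes A: "subspace A" "has_dual_bases A" and x: "x \<in> A" "scale g x \<in> adjoin gs A {0}"
    and reg: "\<And>f. g * f \<in> ideal_gen gs \<Longrightarrow> f \<in> ideal_gen gs"
  shows "x \<in> adjoin gs A {0}"
proof -
  obtain ts where ts: "\<And>l a. (l, a) \<in> set ts \<Longrightarrow> hom_on scale A (*) UNIV l \<and> a \<in> A"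
    and x_eq: "x = (\<Sum>(l, a)\<leftarrow>ts. scale (l x) a)"
    using A(2) x(1) unfolding has_dual_bases_def by blast
  have sub: "subspace (adjoin gs A {0})" by (intro subspace_adjoin A subspace_single_0)
  have "scale (l x) a \<in> adjoin gs A {0}" if "(l, a) \<in> set ts" for l a
  proof -
    have l: "hom_on scale A (*) UNIV l" and a: "a \<in> A" using ts that by auto
    have "g * l x \<in> ideal_gen gs"
      using hom_adjoin_in_ideal_gen[OF l A(1) x(2)] hom_onD(3)[OF l x(1)] by simp
    then show ?thesis using reg a A by (intro scale_ideal_gen_in_adjoin) auto
  qed
  then have "(\<Sum>(l, a)\<leftarrow>ts'. scale (l x) a) \<in> adjoin gs A {0}" if "set ts' \<subseteq> set ts" for ts'
    using that by (induction ts') (auto intro!: subspace_add[OF sub] simp: subspace_0[OF sub])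
  then show ?thesis using x_eq by (metis order_refl)
qed

text \<open>The elements below index \<open>a\<close> are already divided out, as in the reduction
  to X; the others are then tested in ascending order.\<close>

lemma regular_upto_if_dual_bases:
  fixes z :: "nat \<Rightarrow> 'a"
  assumes A: "subspace A" "has_dual_bases A"
    and reg: "\<And>f j. a \<le> j \<Longrightarrow> j < b \<Longrightarrow> z j * f \<in> ideal_gen (map z (rev [0..<j])) \<Longrightarrow> f \<in> ideal_gen (map z (rev [0..<j]))"
  shows "regular_upto (map z [a..<b]) n A (adjoin (map z (rev [0..<a])) A {0})"
  using reg
proof (induction "b - a" arbitrary: a n)
  case (Suc m)
  then have "a < b" by simp
  then have eq: "map z [a..<b] = z a # map z [Suc a..<b]" by (simp add: upt_conv_Cons)
  have eq': "add_multiples (z a) A (adjoin (map z (rev [0..<a])) A {0}) = adjoin (map z (rev [0..<Suc a])) A {0}"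
    by simp
  show ?case unfolding eq regular_upto.simps eq'
  proof (intro conjI impI ballI)
    show "regular_upto (map z [Suc a..<b]) (n - 1) A (adjoin (map z (rev [0..<Suc a])) A {0})"
      by (rule Suc.hyps(1)) (use Suc in auto)
  qed (use Suc.prems \<open>a < b\<close> in \<open>auto intro: regular_if_dual_bases[OF A]\<close>)
qed simp

lemma adjoin_image:
  assumes "\<And>x y. \<iota> (x + y) = \<iota> x + \<iota> y" "\<And>c x. \<iota> (s c x) = scale c (\<iota> x)" "ring_module s"
  shows "adjoin gs (\<iota> ` A) (\<iota> ` B) = \<iota> ` ring_module.adjoin s gs A B"
proof -
  interpret s: ring_module s by fact
  show ?thesis
  proof (induction gs)
    case (Cons g gs)
    show ?case unfolding adjoin_simps s.adjoin_simps Cons.IH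
    proof (intro equalityI subsetI)
      fix u assume "u \<in> add_multiples g (\<iota> ` A) (\<iota> ` s.adjoin gs A B)"
      then obtain x b where "x \<in> A" "b \<in> s.adjoin gs A B" "u = scale g (\<iota> x) + \<iota> b"
        by (auto elim!: add_multiplesE)
      then show "u \<in> \<iota> ` s.add_multiples g A (s.adjoin gs A B)"
        by (intro image_eqI[of _ _ "s g x + b"] s.add_multiplesI) (simp_all add: assms(1,2))
    next
      fix u assume "u \<in> \<iota> ` s.add_multiples g A (s.adjoin gs A B)"
      then obtain x b where *: "x \<in> A" "b \<in> s.adjoin gs A B" "u = \<iota> (s g x + b)"
        by (auto elim!: s.add_multiplesE)
      show "u \<in> add_multiples g (\<iota> ` A) (\<iota> ` s.adjoin gs A B)"
        unfolding *(3) assms(1,2) using * by (intro add_multiplesI imageI)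
    qed
  qed simp
qed

lemma adjoin_scale:
  assumes "\<And>x. x \<in> A \<Longrightarrow> scale h x \<in> A'" "\<And>x. x \<in> B \<Longrightarrow> scale h x \<in> B'" "x \<in> adjoin gs A B"
  shows "scale h x \<in> adjoin gs A' B'"
  using assms(3)
proof (induction gs arbitrary: x)
  case (Cons g gs)
  then obtain a b where "a \<in> A" and b: "b \<in> adjoin gs A B" and "x = scale g a + b" by (auto elim: add_multiplesE)
  then have eq: "scale h x = scale g (scale h a) + scale h b" by (simp add: scale_right_distrib mult.commute)
  show ?case unfolding eq adjoin_simps using Cons.IH[OF b] assms(1)[OF \<open>a \<in> A\<close>] by (intro add_multiplesI)
qed (use assms in simp)

lemma adjoin_add:
  assumes "subspace A" "x \<in> adjoin gs A B" "y \<in> adjoin gs A B'"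
  shows "x + y \<in> adjoin gs A {b + b' | b b'. b \<in> B \<and> b' \<in> B'}"
  using assms(2,3)
proof (induction gs arbitrary: x y)
  case (Cons g gs)
  then obtain a b a' b' where *: "a \<in> A" "b \<in> adjoin gs A B" "x = scale g a + b"
    "a' \<in> A" "b' \<in> adjoin gs A B'" "y = scale g a' + b'" by (auto elim!: add_multiplesE)
  have eq: "x + y = scale g (a + a') + (b + b')" using * by (simp add: scale_right_distrib)
  show ?case unfolding eq adjoin_simps
    using Cons.IH[OF *(2,5)] * by (intro add_multiplesI subspace_add[OF assms(1)]) auto
qed auto

end

lemma ring_module_vec: "ring_module ((*s) :: 'a::comm_ring_1 \<Rightarrow> 'a ^ 'n \<Rightarrow> 'a ^ 'n)"
  by unfold_locales (simp_all add: vec_eq_iff algebra_simps)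

lemma ring_module_fscale: "ring_module fscale"
  using module_fscale by (simp add: ring_module_def)

interpretation form: ring_module "(*s) :: 'a::comm_ring_1 \<Rightarrow> 'a ^ 'n \<Rightarrow> 'a ^ 'n"
  by (rule ring_module_vec)

section \<open>Numerators of logarithmic forms\<close>

text \<open>A basis of X is extended to one of V and the added vectors are numbered first. The
  coordinate functionals \<open>y\<close> of that basis then define X by the first
  \<open>codim X\<close> of them.\<close>

lemma adapted_dual_systems:
  fixes X :: "('k::field ^ 'n::finite) set"
  assumes X: "vec.subspace X"
  obtains y v where "dual_systems CARD('n) y v" "\<And>u. u \<in> X \<longleftrightarrow> (\<forall>b<codim X. dot (y b) u = 0)"
proof -
  obtain B where B: "B \<subseteq> X" "vec.independent B" "X \<subseteq> vec.span B" "card B = vec.dim X"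
    by (rule vec.basis_exists)
  obtain C where C: "B \<subseteq> C" "vec.independent C" "UNIV \<subseteq> vec.span C"
    using vec.maximal_independent_subset_extend[of B UNIV] B by auto
  have fin: "finite C" using vec.finiteI_independent C by blast
  have card_C: "card C = CARD('n)"
    using vec.dim_eq_card[of C UNIV] C vec.dim_UNIV card_cart_basis by (metis top.extremum_unique vec.span_UNIV)
  have card_D: "card (C - B) = codim X"
    using C(1) fin B(4) card_C by (simp add: card_Diff_subset finite_subset codim_def)
  obtain f where f: "bij_betw f {0..<codim X} (C - B)" using ex_bij_betw_nat_finite[of "C - B"] fin card_D by auto
  obtain g where g: "bij_betw g {0..<vec.dim X} B" using ex_bij_betw_nat_finite[of B] B(4) finite_subset[OF C(1) fin] by auto
  define v where "v t = (if t < codim X then f t else g (t - codim X))" for t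
  have sum_n: "codim X + vec.dim X = CARD('n)"
    using card_mono[OF fin C(1)] card_C B(4) by (simp add: codim_def)
  have v_D: "v t \<in> C - B" if "t < codim X" for t using f that by (auto simp: v_def bij_betw_def)
  have v_B: "v t \<in> B" if "\<not> t < codim X" "t < CARD('n)" for t
    using g that sum_n by (auto simp: v_def bij_betw_def)
  have inj: "a = b" if "a < CARD('n)" "b < CARD('n)" "v a = v b" for a b
  proof (cases "a < codim X \<longleftrightarrow> b < codim X")
    case True
    show ?thesis
    proof (cases "a < codim X")
      case a: True
      then show ?thesis using that True f by (auto simp: v_def bij_betw_def inj_on_def)
    next
      case a: False
      then have "a - codim X = b - codim X"
        using that True g sum_n by (intro inj_onD[OF bij_betw_imp_inj_on[OF g]]) (auto simp: v_def)
      then show ?thesis using a True by linarith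
    qed
  next
    case False
    then show ?thesis using v_D v_B that by (metis DiffD2)
  qed
  have D_v: "\<exists>t<codim X. v t = u" if "u \<in> C - B" for u
  proof -
    have "u \<in> f ` {0..<codim X}" using f that by (simp add: bij_betw_def)
    then obtain t where "t < codim X" "u = f t" by auto
    then show ?thesis by (intro exI[of _ t]) (simp add: v_def)
  qed
  define y where "y a = (\<chi> i. vec.representation C (axis i 1) (v a))" for a
  have dot_y: "dot (y a) u = vec.representation C u (v a)" for a u
  proof -
    have span: "x \<in> vec.span C" for x using C(3) by auto
    have "vec.representation C u (v a) = vec.representation C (\<Sum>i\<in>UNIV. u $ i *s axis i 1) (v a)"
      by (simp add: basis_expansion)
    also have "\<dots> = (\<Sum>i\<in>UNIV. u $ i * vec.representation C (axis i 1) (v a))"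
      by (subst vec.representation_sum) (auto simp: C(2) span vec.representation_scale)
    finally show ?thesis by (simp add: dot_def y_def mult.commute)
  qed
  show ?thesis
  proof
    show "dual_systems CARD('n) y v"
    proof (intro allI impI)
      fix a b assume "a < CARD('n)" "b < CARD('n)"
      moreover have "v b \<in> C" using v_D v_B[of b] C(1) \<open>b < CARD('n)\<close> by blast
      ultimately show "dot (y a) (v b) = (if a = b then 1 else 0)"
        using inj by (auto simp: dot_y vec.representation_basis[OF C(2)])
    qed
    fix u
    show "u \<in> X \<longleftrightarrow> (\<forall>b<codim X. dot (y b) u = 0)"
    proof
      assume "u \<in> X"
      then have "vec.representation C u = vec.representation B u"
        using B(3) by (intro vec.representation_extend C) auto
      then show "\<forall>b<codim X. dot (y b) u = 0"
        using v_D vec.representation_ne_zero[of B u] by (auto simp: dot_y)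
    next
      assume *: "\<forall>b<codim X. dot (y b) u = 0"
      have "u = (\<Sum>b\<in>C. vec.representation C u b *s b)"
        by (rule vec.sum_representation_eq[symmetric, OF C(2) _ fin order_refl]) (use C(3) in blast)
      also have "\<dots> = (\<Sum>b\<in>B. vec.representation C u b *s b)"
        using D_v * by (intro sum.mono_neutral_right fin C) (auto simp: dot_y)
      also have "\<dots> \<in> X"
        using B(1) X by (intro vec.subspace_sum vec.subspace_scale) auto
      finally show "u \<in> X" .
    qed
  qed
qed

lemma exists_separating_functional:
  fixes U :: "('k::field ^ 'n::finite) set"
  assumes "vec.subspace U" "x \<notin> U"
  obtains y where "\<And>u. u \<in> U \<Longrightarrow> dot y u = 0" "dot y x \<noteq> 0"
proof -
  obtain y v where "dual_systems CARD('n) y v" "\<And>u. u \<in> U \<longleftrightarrow> (\<forall>b<codim U. dot (y b) u = 0)"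
    using adapted_dual_systems[OF assms(1)] by blast
  then show ?thesis using that assms(2) by blast
qed

lemma dot_commute: "dot a b = dot b a"
  by (simp add: dot_def mult.commute)

lemma span_eq_UNIV_if_orthogonal_trivial:
  fixes S :: "('k::field ^ 'n::finite) set"
  assumes "\<And>u. (\<And>a. a \<in> S \<Longrightarrow> dot a u = 0) \<Longrightarrow> u = 0"
  shows "x \<in> vec.span S"
proof (rule ccontr)
  assume "x \<notin> vec.span S"
  then obtain u where u: "\<And>a. a \<in> vec.span S \<Longrightarrow> dot u a = 0" "dot u x \<noteq> 0"
    using exists_separating_functional[OF vec.subspace_span] by blast
  have "u = 0" using u(1)[OF vec.span_base] by (intro assms) (simp add: dot_commute)
  then show False using u(2) by simp
qed

abbreviation kernel_of_alpha :: "('k::field ^ 'n::finite) set \<Rightarrow> bool" where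
  "kernel_of_alpha L \<equiv> L = {v. dot (alpha_coeff L) v = 0}"

lemma kernel_of_alphaI: "L = {v. dot a v = 0} \<Longrightarrow> kernel_of_alpha L"
  unfolding alpha_coeff_def dot_def by (rule someI)

lemma hyperplane_kernel_of_alpha:
  fixes L :: "('k::field ^ 'n::finite) set"
  assumes "hyperplane L"
  shows "kernel_of_alpha L" "alpha_coeff L \<noteq> 0"
proof -
  obtain y v where d: "dual_systems CARD('n) y (v :: nat \<Rightarrow> 'k ^ 'n)"
    and L: "\<And>u. u \<in> L \<longleftrightarrow> (\<forall>b<codim L. dot (y b) u = 0)"
    using adapted_dual_systems[of L] assms by (auto simp: hyperplane_def)
  have "L = {v. dot (y 0) v = 0}" using L assms by (auto simp: hyperplane_def)
  then show k: "kernel_of_alpha L" by (rule kernel_of_alphaI)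
  show "alpha_coeff L \<noteq> 0"
  proof
    assume "alpha_coeff L = 0"
    then have "L = UNIV" using k by simp
    then show False using assms card_cart_basis[where 'a='k and 'i='n]
      by (simp add: hyperplane_def codim_def vec.dim_UNIV)
  qed
qed

lemma alpha_eq_lin_poly: "alpha L = lin_poly (alpha_coeff L)"
  by (simp add: alpha_def lin_poly_def)

lemma alpha_dvd_multD:
  fixes f :: "('k::field, 'n::{finite,linorder}) mpoly"
  assumes "alpha L dvd f * g" "\<not> alpha L dvd f"
  shows "alpha L dvd g"
  using lin_poly_dvd_multD assms unfolding alpha_eq_lin_poly by blast

definition pairing :: "('k::field, 'n::finite) mpoly ^ 'n \<Rightarrow> 'k ^ 'n \<Rightarrow> ('k, 'n) mpoly" where
  "pairing f v = (\<Sum>i\<in>UNIV. f $ i * const_poly (v $ i))"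

lemma pairing_simps [simp]:
  "pairing (f + g) v = pairing f v + pairing g v" "pairing (f - g) v = pairing f v - pairing g v"
  "pairing (c *s f) v = c * pairing f v" "pairing 0 v = 0" "pairing f 0 = 0"
  "pairing f (v + w) = pairing f v + pairing f w" "pairing f (v - w) = pairing f v - pairing f w"
  "pairing f (a *s v) = const_poly a * pairing f v"
  by (simp_all add: pairing_def algebra_simps sum.distrib sum_subtractf sum_distrib_left
      const_poly_add const_poly_diff const_poly_mult)

lemma pairing_axis [simp]: "pairing f (axis i 1) = f $ i"
proof -
  have "f $ j * const_poly (axis i 1 $ j) = (if j = i then f $ j else 0)" for j by (simp add: axis_def)
  then show ?thesis by (simp add: pairing_def)
qed

lemma pairing_sum: "pairing (\<Sum>i\<in>I. f i) v = (\<Sum>i\<in>I. pairing (f i) v)"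
  "pairing g (\<Sum>i\<in>I. w i) = (\<Sum>i\<in>I. pairing g (w i))"
  by (induction I rule: infinite_finite_induct) auto

lemma form_eqI: "(\<And>v. pairing f v = pairing g v) \<Longrightarrow> f = g"
  using pairing_axis by (metis vec_eq_iff)

definition const_form :: "'k::field ^ 'n::finite \<Rightarrow> ('k, 'n) mpoly ^ 'n" where
  "const_form y = (\<chi> i. const_poly (y $ i))"

lemma pairing_const_form [simp]: "pairing (const_form y) v = const_poly (dot y v)"
  by (simp add: pairing_def const_form_def dot_def const_poly_sum const_poly_mult)

text \<open>
  The numerators \<open>f\<close> of the logarithmic forms \<open>f / Q\<close>: contracting the condition on \<open>f \<and> d\<alpha>\<close> with
  pairs of vectors turns it into the condition that \<open>f\<close> restricted to \<open>L\<close> is divisible by \<open>\<alpha>\<close>.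
\<close>

definition log_numerators :: "('k::field ^ 'n::{finite,linorder}) set set \<Rightarrow> (('k, 'n) mpoly ^ 'n::{finite,linorder}) set" where
  "log_numerators B = {f. \<forall>L\<in>B. \<forall>v\<in>L. alpha L dvd pairing f v}"

lemma subspace_log_numerators: "form.subspace (log_numerators B)"
  by (rule form.subspaceI) (auto simp: log_numerators_def)

text \<open>With \<open>q\<close> the defining polynomial these are the numerators of combinations
  of the dy_b. The coefficients run through \<open>J\<close>, which is either the whole ring or, in
  the final contradiction, the maximal ideal of the origin.\<close>

definition conormal_forms_in :: "('k, 'n) mpoly set \<Rightarrow> nat \<Rightarrow> (nat \<Rightarrow> 'k::field ^ 'n::finite) \<Rightarrow> ('k, 'n) mpoly \<Rightarrow>
    (('k, 'n) mpoly ^ 'n::finite) set" where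
  "conormal_forms_in J c y q = {(\<Sum>b<c. (q * g b) *s const_form (y b)) | g. \<forall>b<c. g b \<in> J}"

abbreviation "conormal_forms \<equiv> conormal_forms_in UNIV"

lemma subspace_conormal_forms_in:
  assumes J: "0 \<in> J" "\<And>a b. a \<in> J \<Longrightarrow> b \<in> J \<Longrightarrow> a + b \<in> J" "\<And>a b. b \<in> J \<Longrightarrow> a * b \<in> J"
  shows "form.subspace (conormal_forms_in J c y q)"
proof (rule form.subspaceI)
  show "0 \<in> conormal_forms_in J c y q" unfolding conormal_forms_in_def
    by (rule CollectI, rule exI[of _ "\<lambda>_. 0"]) (simp add: J)
next
  fix f g assume "f \<in> conormal_forms_in J c y q" "g \<in> conormal_forms_in J c y q"
  then obtain f' g' where *: "f = (\<Sum>b<c. (q * f' b) *s const_form (y b))" "g = (\<Sum>b<c. (q * g' b) *s const_form (y b))"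
    "\<forall>b<c. f' b \<in> J" "\<forall>b<c. g' b \<in> J" unfolding conormal_forms_in_def by blast
  then have "f + g = (\<Sum>b<c. (q * (f' b + g' b)) *s const_form (y b))"
    by (simp add: distrib_left form.scale_left_distrib sum.distrib)
  then show "f + g \<in> conormal_forms_in J c y q" unfolding conormal_forms_in_def
    using *(3,4) J(2) by (intro CollectI exI[of _ "\<lambda>b. f' b + g' b"]) simp
next
  fix r f assume "f \<in> conormal_forms_in J c y q"
  then obtain f' where *: "f = (\<Sum>b<c. (q * f' b) *s const_form (y b))" "\<forall>b<c. f' b \<in> J"
    unfolding conormal_forms_in_def by blast
  then have "r *s f = (\<Sum>b<c. (q * (r * f' b)) *s const_form (y b))"
    by (simp add: form.scale_sum_right mult_ac)
  then show "r *s f \<in> conormal_forms_in J c y q" unfolding conormal_forms_in_def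
    using *(2) J(3) by (intro CollectI exI[of _ "\<lambda>b. r * f' b"]) simp
qed

lemma subspace_conormal_forms: "form.subspace (conormal_forms c y q)"
  by (rule subspace_conormal_forms_in) auto

text \<open>Only the coefficients are reduced modulo the \<open>y\<close>. The differentials remain,
  so the dy_b are not lost as they are under restriction to X.\<close>

definition eliminate_form :: "(nat \<Rightarrow> 'k::field ^ 'n::finite) \<Rightarrow> (nat \<Rightarrow> 'k ^ 'n) \<Rightarrow> nat \<Rightarrow>
    ('k, 'n) mpoly ^ 'n \<Rightarrow> ('k, 'n) mpoly ^ 'n" where
  "eliminate_form y w j f = (\<chi> i. eliminate y w j (f $ i))"

lemma pairing_eliminate_form [simp]: "pairing (eliminate_form y w j f) v = eliminate y w j (pairing f v)"
  by (simp add: pairing_def eliminate_form_def)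

lemma eliminate_form_hom:
  "eliminate_form y w j (f + g) = eliminate_form y w j f + eliminate_form y w j g"
  "eliminate_form y w j (c *s f) = eliminate y w j c *s eliminate_form y w j f"
  by (rule form_eqI, simp)+

lemma eliminate_dvd: "f dvd g \<Longrightarrow> eliminate y w j f dvd eliminate y w j g"
  by (auto elim!: dvdE)

lemma eliminate_alpha:
  assumes "kernel_of_alpha L" "\<And>b. b < j \<Longrightarrow> w b \<in> L"
  shows "eliminate y w j (alpha L) = alpha L"
  unfolding alpha_eq_lin_poly using assms by (intro eliminate_lin_poly_fixed) blast

text \<open>This is where the \<open>w b\<close> have to lie in all hyperplanes: elimination along
  them leaves every \<open>alpha L\<close> unchanged.\<close>

lemma eliminate_form_log_numerators:
  fixes B :: "('k::field ^ 'n::{finite,linorder}) set set"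
  assumes B: "\<And>L. L \<in> B \<Longrightarrow> hyperplane L" "\<And>L b. L \<in> B \<Longrightarrow> b < j \<Longrightarrow> w b \<in> L" and f: "f \<in> log_numerators B"
  shows "eliminate_form y w j f \<in> log_numerators B"
  unfolding log_numerators_def
proof (intro CollectI ballI)
  fix L v assume L: "L \<in> B" "v \<in> L"
  then have "eliminate y w j (alpha L) dvd eliminate y w j (pairing f v)"
    using f by (intro eliminate_dvd) (auto simp: log_numerators_def)
  then show "alpha L dvd pairing (eliminate_form y w j f) v"
    using eliminate_alpha[OF hyperplane_kernel_of_alpha(1)[OF B(1)[OF L(1)]] B(2)[OF L(1)]] by simp
qed

lemma not_alpha_dvd_lin_poly: "kernel_of_alpha L \<Longrightarrow> w \<in> L \<Longrightarrow> dot y w \<noteq> 0 \<Longrightarrow> \<not> alpha L dvd lin_poly y"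
  using lin_poly_dvd_lin_polyD[of "alpha_coeff L" y w] by (auto simp: alpha_eq_lin_poly)

text \<open>That the coefficients of the difference lie in the ideal of the \<open>y\<close> is
  clear; the point is that the cofactors are logarithmic. They are, because \<open>w j\<close> lies
  in \<open>L\<close> while \<open>y j\<close> does not vanish at \<open>w j\<close>, so that the
  prime \<open>alpha L\<close> does not divide \<open>lin_poly (y j)\<close>.\<close>

lemma diff_eliminate_form:
  fixes B :: "('k::field ^ 'n::{finite,linorder}) set set"
  assumes B: "\<And>L. L \<in> B \<Longrightarrow> hyperplane L" "\<And>L b. L \<in> B \<Longrightarrow> b < c \<Longrightarrow> w b \<in> L"
    and f: "f \<in> log_numerators B" and d: "dual_systems c y w" and j: "j \<le> c"
  shows "f - eliminate_form y w j f \<in> form.adjoin (lin_polys y j) (log_numerators B) {0}"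
  using j
proof (induction j)
  case 0
  then show ?case by (simp add: eliminate_form_def)
next
  case (Suc j)
  let ?E = "eliminate_form y w"
  have "\<exists>g. \<forall>i. ?E j f $ i - ?E (Suc j) f $ i = lin_poly (y j) * g i"
    using lin_poly_dvd_diff_pullback[of "y j" _ "w j"]
    by (intro choice) (auto simp: eliminate_form_def elim!: dvdE)
  then obtain g' where g': "\<And>i. ?E j f $ i - ?E (Suc j) f $ i = lin_poly (y j) * g' i" by blast
  define g where "g = (\<chi> i. g' i)"
  have g: "?E j f - ?E (Suc j) f = lin_poly (y j) *s g" by (simp add: vec_eq_iff g_def g')
  have "?E i f \<in> log_numerators B" if "i \<le> c" for i
    using B f that by (intro eliminate_form_log_numerators) auto
  then have "lin_poly (y j) *s g \<in> log_numerators B"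
    unfolding g[symmetric] using Suc.prems by (intro form.subspace_diff subspace_log_numerators) auto
  then have "alpha L dvd pairing g v" if "L \<in> B" "v \<in> L" for L v
    using that not_alpha_dvd_lin_poly[OF hyperplane_kernel_of_alpha(1)[OF B(1)[OF that(1)]] B(2)[OF that(1), of j]]
      d Suc.prems alpha_dvd_multD[of L "lin_poly (y j)" "pairing g v"]
    by (auto simp: log_numerators_def)
  then have "g \<in> log_numerators B" by (simp add: log_numerators_def)
  moreover have "f - ?E j f \<in> form.adjoin (lin_polys y j) (log_numerators B) {0}"
    using Suc by auto
  moreover have eq: "f - ?E (Suc j) f = lin_poly (y j) *s g + (f - ?E j f)" unfolding g[symmetric] by simp
  ultimately show ?case unfolding eq by (auto intro: form.add_multiplesI)
qed

lemma log_numerators_antimono: "B \<subseteq> B' \<Longrightarrow> log_numerators B' \<subseteq> log_numerators B"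
  by (auto simp: log_numerators_def)

lemma scale_log_numerators:
  assumes "finite A" "B \<subseteq> A" "f \<in> log_numerators B"
  shows "(\<Prod>L\<in>A - B. alpha L) *s f \<in> log_numerators A"
  unfolding log_numerators_def
proof (intro CollectI ballI)
  fix L v assume L: "L \<in> A" "v \<in> L"
  show "alpha L dvd pairing ((\<Prod>L\<in>A - B. alpha L) *s f) v"
  proof (cases "L \<in> B")
    case True
    then show ?thesis using assms(3) L by (auto simp: log_numerators_def)
  next
    case False
    then have "alpha L dvd (\<Prod>L\<in>A - B. alpha L)" using assms(1) L by (intro dvd_prodI) auto
    then show ?thesis by simp
  qed
qed

lemma Qpoly_Diff: "finite A \<Longrightarrow> B \<subseteq> A \<Longrightarrow> Qpoly A = (\<Prod>L\<in>A - B. alpha L) * Qpoly B"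
  by (simp add: Qpoly_def prod.subset_diff)

lemma conormal_formsI: "(\<And>b. b < c \<Longrightarrow> g b = q * g' b) \<Longrightarrow> (\<Sum>b<c. g b *s const_form (y b)) \<in> conormal_forms c y q"
  unfolding conormal_forms_in_def by (auto intro!: sum.cong exI[of _ g'])

lemma conormal_forms_mult: "conormal_forms c y (h * q) \<subseteq> conormal_forms c y q"
proof
  fix x assume "x \<in> conormal_forms c y (h * q)"
  then obtain g where "x = (\<Sum>b<c. ((h * q) * g b) *s const_form (y b))" unfolding conormal_forms_in_def by auto
  then show "x \<in> conormal_forms c y q" using conormal_formsI[of c "\<lambda>b. h * q * g b" q "\<lambda>b. h * g b" y] by (simp add: mult_ac)
qed

lemma scale_conormal_forms: "x \<in> conormal_forms c y q \<Longrightarrow> h *s x \<in> conormal_forms c y (h * q)"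
proof -
  assume "x \<in> conormal_forms c y q"
  then obtain g where "x = (\<Sum>b<c. (q * g b) *s const_form (y b))" unfolding conormal_forms_in_def by auto
  then have "h *s x = (\<Sum>b<c. ((h * q) * g b) *s const_form (y b))" by (simp add: form.scale_sum_right mult.assoc)
  then show ?thesis using conormal_formsI[of c "\<lambda>b. h * q * g b" "h * q" g y] by simp
qed

lemma pairing_conormal:
  assumes "dual_systems c y w" "b < c"
  shows "pairing (\<Sum>b<c. g b *s const_form (y b)) (w b) = g b"
proof -
  have "pairing (\<Sum>b<c. g b *s const_form (y b)) (w b) = (\<Sum>a<c. if a = b then g a else 0)"
    unfolding pairing_sum using assms by (intro sum.cong) auto
  then show ?thesis using assms(2) by simp
qed

lemma Qpoly_dvd:
  assumes "finite B" "\<And>L. L \<in> B \<Longrightarrow> hyperplane L" "\<And>L. L \<in> B \<Longrightarrow> alpha L dvd f"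
  shows "Qpoly B dvd f"
  unfolding Qpoly_def alpha_eq_lin_poly
proof (rule prod_lin_poly_dvd)
  show "L = L'" if L: "L \<in> B" "L' \<in> B" and dvd: "lin_poly (alpha_coeff L) dvd lin_poly (alpha_coeff L')" for L L'
  proof -
    obtain c where c: "alpha_coeff L' = c *s alpha_coeff L"
      using proportional_if_kernel_subset lin_poly_dvd_lin_polyD[OF dvd] by blast
    then have "c \<noteq> 0" using hyperplane_kernel_of_alpha(2) assms(2) L by fastforce
    then have eq: "{v. dot (alpha_coeff L') v = 0} = {v. dot (alpha_coeff L) v = 0}" unfolding c by simp
    have "L = {v. dot (alpha_coeff L) v = 0}" by (intro hyperplane_kernel_of_alpha(1) assms(2) L)
    also have "\<dots> = {v. dot (alpha_coeff L') v = 0}" by (rule eq[symmetric])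
    also have "\<dots> = L'" by (intro hyperplane_kernel_of_alpha(1)[symmetric] assms(2) L)
    finally show "L = L'" .
  qed
qed (use assms hyperplane_kernel_of_alpha(2) in \<open>auto simp: alpha_eq_lin_poly\<close>)

section \<open>Arrangements whose hyperplanes all contain the transversal directions\<close>

context
  fixes B :: "('k::field ^ 'n::{finite,linorder}) set set" and c :: nat and y w :: "nat \<Rightarrow> 'k ^ 'n::{finite,linorder}"
  assumes fin: "finite B" and B: "\<And>L. L \<in> B \<Longrightarrow> hyperplane L" "\<And>L b. L \<in> B \<Longrightarrow> b < c \<Longrightarrow> w b \<in> L"
    and d: "dual_systems c y w"
begin

lemma eliminate_Qpoly:
  assumes "j \<le> c"
  shows "eliminate y w j (Qpoly B) = Qpoly B"
  unfolding Qpoly_def eliminate_hom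
proof (intro prod.cong refl)
  fix L assume L: "L \<in> B"
  show "eliminate y w j (alpha L) = alpha L"
    by (rule eliminate_alpha[OF hyperplane_kernel_of_alpha(1)[OF B(1)[OF L]]]) (use B(2)[OF L] assms in simp)
qed

lemma not_lin_poly_dvd_Qpoly:
  assumes "j < c"
  shows "\<not> lin_poly (y j) dvd Qpoly B"
proof
  assume dvd: "lin_poly (y j) dvd Qpoly B"
  have 1: "dot (y j) (w j) = 1" using d assms by simp
  then have "y j \<noteq> 0" by auto
  then obtain L where L: "L \<in> B" "lin_poly (y j) dvd lin_poly (alpha_coeff L)"
    using lin_poly_dvd_prodD[OF fin _ dvd[unfolded Qpoly_def]] by (auto simp: alpha_eq_lin_poly)
  obtain r where r: "alpha_coeff L = r *s y j"
    using proportional_if_kernel_subset lin_poly_dvd_lin_polyD[OF L(2)] by blast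
  have "dot (alpha_coeff L) (w j) = 0"
    using hyperplane_kernel_of_alpha(1)[OF B(1)[OF L(1)]] B(2)[OF L(1) assms] by blast
  then have "alpha_coeff L = 0" using 1 by (simp add: r)
  then show False using hyperplane_kernel_of_alpha(2)[OF B(1)[OF L(1)]] by simp
qed

lemma eliminate_form_conormal:
  assumes "j \<le> c" "x \<in> conormal_forms c y (Qpoly B)"
  shows "eliminate_form y w j x \<in> conormal_forms c y (Qpoly B)"
proof -
  obtain g where "x = (\<Sum>b<c. (Qpoly B * g b) *s const_form (y b))" using assms unfolding conormal_forms_in_def by auto
  then have "eliminate_form y w j x = (\<Sum>b<c. (Qpoly B * eliminate y w j (g b)) *s const_form (y b))"
    using eliminate_Qpoly[OF assms(1)] by (intro form_eqI) (simp add: pairing_sum)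
  then show ?thesis using conormal_formsI[of c _ "Qpoly B" "\<lambda>b. eliminate y w j (g b)" y] by simp
qed

lemma eliminate_form_adjoin:
  assumes "i \<le> j" "j \<le> c" "x \<in> form.adjoin (lin_polys y i) M (conormal_forms c y (Qpoly B))"
  shows "eliminate_form y w j x \<in> conormal_forms c y (Qpoly B)"
  using assms(1,3)
proof (induction i arbitrary: x)
  case 0
  then show ?case using eliminate_form_conormal[OF assms(2)] by simp
next
  case (Suc i)
  then obtain a b where "b \<in> form.adjoin (lin_polys y i) M (conormal_forms c y (Qpoly B))" "x = lin_poly (y i) *s a + b"
    by (auto elim: form.add_multiplesE)
  then show ?case using Suc eliminate_lin_poly_killed[OF d, of i j] assms(2) by (simp add: eliminate_form_hom)
qed

lemma in_adjoin_if_eliminate: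
  assumes "f \<in> log_numerators B" "j \<le> c" "eliminate_form y w j f \<in> conormal_forms c y (Qpoly B)"
  shows "f \<in> form.adjoin (lin_polys y j) (log_numerators B) (conormal_forms c y (Qpoly B))"
proof -
  let ?D = "conormal_forms c y (Qpoly B)"
  have "f - eliminate_form y w j f \<in> form.adjoin (lin_polys y j) (log_numerators B) {0}"
    using B d assms(1,2) by (intro diff_eliminate_form) auto
  moreover have "eliminate_form y w j f \<in> form.adjoin (lin_polys y j) (log_numerators B) ?D"
    using assms(3) form.adjoin_superset[OF subspace_log_numerators] by blast
  ultimately have "f - eliminate_form y w j f + eliminate_form y w j f \<in> form.adjoin (lin_polys y j) (log_numerators B) {b + b' | b b'. b \<in> {0} \<and> b' \<in> ?D}"
    by (rule form.adjoin_add[OF subspace_log_numerators])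
  then show ?thesis using form.adjoin_mono[OF order_refl, of "{b + b' | b b'. b \<in> {0} \<and> b' \<in> ?D}" ?D "lin_polys y j" "log_numerators B"] by auto
qed

text \<open>Elimination of the earlier forms turns the hypothesis into an equation between
  \<open>lin_poly (y j)\<close> times a vector and a combination of the \<open>Q dy_b\<close>.
  Pairing with \<open>w b\<close> isolates \<open>Q\<close> times the coefficient; the prime
  \<open>lin_poly (y j)\<close> does not divide \<open>Q\<close>, so it divides every coefficient
  and can be cancelled.\<close>

lemma regular_mod_conormal:
  assumes f: "f \<in> log_numerators B" and j: "j < c"
    and yf: "lin_poly (y j) *s f \<in> form.adjoin (lin_polys y j) (log_numerators B) (conormal_forms c y (Qpoly B))"
  shows "f \<in> form.adjoin (lin_polys y j) (log_numerators B) (conormal_forms c y (Qpoly B))"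
proof (rule in_adjoin_if_eliminate[OF f])
  let ?E = "eliminate_form y w j"
  have y: "eliminate y w j (lin_poly (y j)) = lin_poly (y j)" using eliminate_lin_poly_later[OF d, of j j] j by simp
  have y0: "y j \<noteq> 0" using d j by (metis dot_simps(7) zero_neq_one)
  have "?E (lin_poly (y j) *s f) \<in> conormal_forms c y (Qpoly B)"
    using j by (intro eliminate_form_adjoin[OF order_refl _ yf]) simp
  then obtain g where g: "lin_poly (y j) *s ?E f = (\<Sum>b<c. (Qpoly B * g b) *s const_form (y b))"
    unfolding eliminate_form_hom y conormal_forms_in_def by auto
  have "lin_poly (y j) dvd g b" if "b < c" for b
  proof -
    have "pairing (lin_poly (y j) *s ?E f) (w b) = Qpoly B * g b" unfolding g by (rule pairing_conormal[OF d that])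
    then have "lin_poly (y j) dvd Qpoly B * g b" by (metis dvd_triv_left pairing_simps(3))
    then show ?thesis using lin_poly_dvd_multD not_lin_poly_dvd_Qpoly[OF j] by blast
  qed
  then have "\<forall>b. \<exists>r. b < c \<longrightarrow> g b = lin_poly (y j) * r" by (auto elim: dvdE)
  then obtain g' where g': "\<And>b. b < c \<Longrightarrow> g b = lin_poly (y j) * g' b" by metis
  have "lin_poly (y j) *s ?E f = lin_poly (y j) *s (\<Sum>b<c. (Qpoly B * g' b) *s const_form (y b))"
    unfolding g form.scale_sum_right using g' by (intro sum.cong) (auto simp: mult_ac)
  then have "?E f = (\<Sum>b<c. (Qpoly B * g' b) *s const_form (y b))"
    using y0 by (auto simp: vec_eq_iff)
  then show "?E f \<in> conormal_forms c y (Qpoly B)" using conormal_formsI[of c _ "Qpoly B" g' y] by simp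
qed (use j in simp)

text \<open>After elimination the form vanishes on all vectors of X, so it is determined by its
  values at the \<open>w b\<close>. Each \<open>w b\<close> lies in every hyperplane, whence these
  values are divisible by every \<open>alpha L\<close> and so by \<open>Q\<close>: the form is a
  combination of the \<open>Q dy_b\<close>.\<close>

lemma in_adjoin_if_restriction_zero:
  assumes f: "f \<in> log_numerators B"
    and zero: "\<And>u. (\<And>b. b < c \<Longrightarrow> dot (y b) u = 0) \<Longrightarrow> pairing f u \<in> ideal_gen (lin_polys y c)"
  shows "f \<in> form.adjoin (lin_polys y c) (log_numerators B) (conormal_forms c y (Qpoly B))"
proof (rule in_adjoin_if_eliminate[OF f order_refl])
  let ?E = "eliminate_form y w c"
  have E: "?E f \<in> log_numerators B" using B f by (intro eliminate_form_log_numerators) auto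
  have "Qpoly B dvd pairing (?E f) (w b)" if "b < c" for b
    using E B that by (intro Qpoly_dvd fin) (auto simp: log_numerators_def)
  then have "\<forall>b. \<exists>r. b < c \<longrightarrow> pairing (?E f) (w b) = Qpoly B * r" by (auto elim: dvdE)
  then obtain g where g: "\<And>b. b < c \<Longrightarrow> pairing (?E f) (w b) = Qpoly B * g b" by metis
  have "?E f = (\<Sum>b<c. pairing (?E f) (w b) *s const_form (y b))"
  proof (rule form_eqI)
    fix v
    \<comment> \<open>The component of \<open>v\<close> along the \<open>w\<close>; the rest
      \<open>v - s\<close> is a common zero of the \<open>y\<close>.\<close>
    define s where "s = (\<Sum>b<c. dot (y b) v *s w b)"
    have "dot (y b) (v - s) = 0" if "b < c" for b
    proof -
      have "(\<Sum>a<c. dot (y a) v * dot (y b) (w a)) = (\<Sum>a<c. if a = b then dot (y a) v else 0)"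
        using d that by (intro sum.cong) auto
      then show ?thesis using that by (simp add: s_def dot_sum_right)
    qed
    then have "pairing f (v - s) \<in> ideal_gen (lin_polys y c)" by (rule zero)
    then have "pairing (?E f) (v - s) = 0"
      unfolding in_ideal_gen_iff_eliminate[OF d order_refl] pairing_eliminate_form .
    then have "pairing (?E f) v = pairing (?E f) s" unfolding pairing_simps by simp
    also have "\<dots> = (\<Sum>b<c. const_poly (dot (y b) v) * pairing (?E f) (w b))"
      unfolding s_def pairing_sum pairing_simps ..
    also have "\<dots> = pairing (\<Sum>b<c. pairing (?E f) (w b) *s const_form (y b)) v"
      unfolding pairing_sum pairing_simps pairing_const_form by (simp add: mult.commute)
    finally show "pairing (?E f) v = pairing (\<Sum>b<c. pairing (?E f) (w b) *s const_form (y b)) v" .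
  qed
  also have "\<dots> \<in> conormal_forms c y (Qpoly B)" using g by (rule conormal_formsI)
  finally show "?E f \<in> conormal_forms c y (Qpoly B)" .
qed

context
  fixes A h
  assumes A: "finite A" "B \<subseteq> A" and h: "h = (\<Prod>L\<in>A - B. alpha L)"
begin

lemma adjoin_log_numerators_mono:
  "form.adjoin gs (log_numerators A) (conormal_forms c y (Qpoly A)) \<subseteq>
   form.adjoin gs (log_numerators B) (conormal_forms c y (Qpoly B))"
  using A by (intro form.adjoin_mono log_numerators_antimono) (auto simp: Qpoly_Diff[of A B] dest: subsetD[OF conormal_forms_mult])

lemma scale_adjoin_log_numerators:
  "x \<in> form.adjoin gs (log_numerators B) (conormal_forms c y (Qpoly B)) \<Longrightarrow>
   h *s x \<in> form.adjoin gs (log_numerators A) (conormal_forms c y (Qpoly A))"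
  using A by (intro form.adjoin_scale[of "log_numerators B" h _ "conormal_forms c y (Qpoly B)"])
    (auto simp: h scale_log_numerators Qpoly_Diff[of A B] scale_conormal_forms)

text \<open>The logarithmic numerators of \<open>A\<close> lie in those of \<open>B\<close>, and
  \<open>h\<close> maps the latter back, so what holds for \<open>B\<close> holds for
  \<open>A\<close> at the price of one factor \<open>h\<close>.\<close>

lemma regular_mod_conormal_local:
  assumes "f \<in> log_numerators A" "j < c"
    and "lin_poly (y j) *s f \<in> form.adjoin (lin_polys y j) (log_numerators A) (conormal_forms c y (Qpoly A))"
  shows "h *s f \<in> form.adjoin (lin_polys y j) (log_numerators A) (conormal_forms c y (Qpoly A))"
  by (rule scale_adjoin_log_numerators[OF regular_mod_conormal[OF
        subsetD[OF log_numerators_antimono[OF A(2)] assms(1)] assms(2)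
        subsetD[OF adjoin_log_numerators_mono assms(3)]]])

lemma in_adjoin_if_restriction_zero_local:
  assumes "f \<in> log_numerators A" "\<And>u. (\<And>b. b < c \<Longrightarrow> dot (y b) u = 0) \<Longrightarrow> pairing f u \<in> ideal_gen (lin_polys y c)"
  shows "h *s f \<in> form.adjoin (lin_polys y c) (log_numerators A) (conormal_forms c y (Qpoly A))"
  by (rule scale_adjoin_log_numerators[OF in_adjoin_if_restriction_zero[OF
        subsetD[OF log_numerators_antimono[OF A(2)] assms(1)] assms(2)]])

end

end

section \<open>Restriction and extension of forms\<close>

definition restrict_form :: "('k::field ^ 'm::finite \<Rightarrow> 'k ^ 'n::finite) \<Rightarrow> ('k, 'n) mpoly ^ 'n \<Rightarrow> ('k, 'm) mpoly ^ 'm" where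
  "restrict_form \<phi> f = (\<chi> j. pullback \<phi> (pairing f (\<phi> (axis j 1))))"

lemma pairing_restrict_form:
  assumes "Vector_Spaces.linear (*s) (*s) \<phi>"
  shows "pairing (restrict_form \<phi> f) v = pullback \<phi> (pairing f (\<phi> v))"
proof -
  have "pullback \<phi> (pairing f (\<phi> v)) = (\<Sum>j\<in>UNIV. const_poly (v $ j) * pullback \<phi> (pairing f (\<phi> (axis j 1))))"
    by (subst linear_eq_sum_axis[OF assms]) (simp add: pairing_sum)
  also have "\<dots> = pairing (restrict_form \<phi> f) v"
    unfolding pairing_def[of "restrict_form \<phi> f"] by (simp add: restrict_form_def mult.commute)
  finally show ?thesis ..
qed

lemma restrict_form_hom:
  "restrict_form \<phi> (f + g) = restrict_form \<phi> f + restrict_form \<phi> g"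
  "restrict_form \<phi> (f - g) = restrict_form \<phi> f - restrict_form \<phi> g"
  "restrict_form \<phi> (c *s f) = pullback \<phi> c *s restrict_form \<phi> f" "restrict_form \<phi> 0 = 0"
  by (simp_all add: restrict_form_def vec_eq_iff)

lemma restrict_form_sum: "restrict_form \<phi> (\<Sum>i\<in>I. f i) = (\<Sum>i\<in>I. restrict_form \<phi> (f i))"
  by (induction I rule: infinite_finite_induct) (auto simp: restrict_form_hom)

text \<open>Applied both to the inclusion of X and to a projection back onto it. Since
  \<open>L'\<close> is mapped into \<open>L\<close>, the pullback of \<open>alpha L\<close> is a
  multiple of \<open>alpha L'\<close>.\<close>

lemma restrict_form_log_numerators_general:
  fixes \<phi> :: "'k::field ^ 'm::{finite,linorder} \<Rightarrow> 'k ^ 'n::{finite,linorder}"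
  assumes \<phi>: "Vector_Spaces.linear (*s) (*s) \<phi>" and f: "f \<in> log_numerators B"
    and ker: "\<And>L. L \<in> B \<Longrightarrow> kernel_of_alpha L" "\<And>L'. L' \<in> B' \<Longrightarrow> kernel_of_alpha L'"
    and B': "\<And>L'. L' \<in> B' \<Longrightarrow> \<exists>L\<in>B. \<phi> ` L' \<subseteq> L"
  shows "restrict_form \<phi> f \<in> log_numerators B'"
  unfolding log_numerators_def
proof (intro CollectI ballI)
  fix L' v assume L': "L' \<in> B'" "v \<in> L'"
  then obtain L where L: "L \<in> B" "\<phi> ` L' \<subseteq> L" using B' by blast
  have "alpha L' dvd pullback \<phi> (alpha L)"
    unfolding alpha_eq_lin_poly pullback_lin_poly
  proof (rule lin_poly_dvd_lin_poly)
    fix u assume "dot (alpha_coeff L') u = 0"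
    then have "\<phi> u \<in> L" using ker(2)[OF L'(1)] L(2) by blast
    then show "dot (pullback_coeff \<phi> (alpha_coeff L)) u = 0"
      using ker(1)[OF L(1)] by (auto simp: dot_pullback_coeff[OF \<phi>])
  qed
  moreover have "pullback \<phi> (alpha L) dvd pullback \<phi> (pairing f (\<phi> v))"
    using f L L'(2) by (intro pullback_dvd) (auto simp: log_numerators_def)
  ultimately show "alpha L' dvd pairing (restrict_form \<phi> f) v"
    unfolding pairing_restrict_form[OF \<phi>] by (rule dvd_trans)
qed

lemma kernel_of_alpha_vimage:
  assumes "Vector_Spaces.linear (*s) (*s) \<phi>" "\<And>L. L \<in> B \<Longrightarrow> hyperplane L" "L' \<in> (\<lambda>L. \<phi> -` L) ` B"
  shows "kernel_of_alpha L'"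
proof -
  obtain L where L: "L' = \<phi> -` L" "L \<in> B" using assms(3) by blast
  show ?thesis
    by (rule kernel_of_alphaI[of _ "pullback_coeff \<phi> (alpha_coeff L)"])
      (use hyperplane_kernel_of_alpha(1)[OF assms(2)[OF L(2)]] in \<open>auto simp: L(1) dot_pullback_coeff[OF assms(1)]\<close>)
qed

section \<open>Flats and genericity\<close>

lemma in_ideal_gen_if_mem: "g \<in> set gs \<Longrightarrow> g \<in> ideal_gen gs"
proof (induction gs)
  case (Cons a gs)
  show ?case
  proof (cases "g = a")
    case True
    show ?thesis unfolding True ideal_gen.simps by (rule CollectI, rule exI[of _ 1], rule exI[of _ 0]) simp
  next
    case False
    then have "g \<in> ideal_gen gs" using Cons by simp
    then show ?thesis unfolding ideal_gen.simps by (intro CollectI exI[of _ 0] exI[of _ g]) simp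
  qed
qed simp

lemma ideal_gen_sum: "(\<And>i. i \<in> I \<Longrightarrow> f i \<in> ideal_gen gs) \<Longrightarrow> sum f I \<in> ideal_gen gs"
  by (induction I rule: infinite_finite_induct) (auto intro: ideal_gen_add)

text \<open>\<open>\<psi>\<close> is the projection onto X along the \<open>w\<close>, followed by
  the inverse of \<open>\<phi>\<close>; the choice of \<open>w\<close> decides which hyperplanes it
  respects.\<close>

lemma exists_linear_section:
  fixes \<phi> :: "'k::field ^ 'm::finite \<Rightarrow> 'k ^ 'n::finite"
  assumes \<phi>: "Vector_Spaces.linear (*s) (*s) \<phi>" "inj \<phi>"
    and range: "\<And>u. u \<in> range \<phi> \<longleftrightarrow> (\<forall>b<c. dot (y b) u = 0)" and d: "dual_systems c y w"
  obtains \<psi> where "Vector_Spaces.linear (*s) (*s) \<psi>" "\<And>v. \<psi> (\<phi> v) = v"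
    "\<And>v. \<phi> (\<psi> v) = v - (\<Sum>b<c. dot (y b) v *s w b)"
proof -
  interpret \<phi>: Vector_Spaces.linear "(*s)" "(*s)" \<phi> by fact
  define \<pi> where "\<pi> v = v - (\<Sum>b<c. dot (y b) v *s w b)" for v
  have "\<pi> v \<in> range \<phi>" for v
    unfolding range
  proof (intro allI impI)
    fix b assume b: "b < c"
    have "(\<Sum>a<c. dot (y a) v * dot (y b) (w a)) = (\<Sum>a<c. if a = b then dot (y a) v else 0)"
      using d b by (intro sum.cong) auto
    then show "dot (y b) (\<pi> v) = 0" using b by (simp add: \<pi>_def dot_sum_right)
  qed
  then have inv: "\<phi> (inv \<phi> (\<pi> v)) = \<pi> v" for v by (rule f_inv_into_f)
  have "\<pi> (u + v) = \<pi> u + \<pi> v" "\<pi> (r *s v) = r *s \<pi> v" for u v r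
    by (simp_all add: \<pi>_def vec_eq_iff algebra_simps sum.distrib sum_distrib_left)
  then have hom: "\<phi> (inv \<phi> (\<pi> (u + v))) = \<phi> (inv \<phi> (\<pi> u) + inv \<phi> (\<pi> v))"
      "\<phi> (inv \<phi> (\<pi> (r *s v))) = \<phi> (r *s inv \<phi> (\<pi> v))" for u v r
    unfolding \<phi>.add \<phi>.scale inv by simp_all
  show ?thesis
  proof (rule that[of "\<lambda>v. inv \<phi> (\<pi> v)"])
    show "Vector_Spaces.linear (*s) (*s) (\<lambda>v. inv \<phi> (\<pi> v))"
      by unfold_locales (auto intro!: injD[OF \<phi>(2)] hom)
    show "inv \<phi> (\<pi> (\<phi> v)) = v" for v
    proof -
      have "\<phi> v \<in> range \<phi>" by simp
      then have "\<pi> (\<phi> v) = \<phi> v" unfolding range \<pi>_def by simp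
      then show ?thesis using \<phi>(2) by simp
    qed
    show "\<phi> (inv \<phi> (\<pi> v)) = v - (\<Sum>b<c. dot (y b) v *s w b)" for v unfolding inv by (rule \<pi>_def)
  qed
qed

context
  fixes \<phi> :: "'k::field ^ 'm::{finite,linorder} \<Rightarrow> 'k ^ 'n::{finite,linorder}"
    and \<psi> :: "'k ^ 'n::{finite,linorder} \<Rightarrow> 'k ^ 'm::{finite,linorder}"
    and y w :: "nat \<Rightarrow> 'k ^ 'n::{finite,linorder}" and c :: nat
  assumes \<phi>: "Vector_Spaces.linear (*s) (*s) \<phi>" and \<psi>: "Vector_Spaces.linear (*s) (*s) \<psi>" "\<And>v. \<psi> (\<phi> v) = v"
    "\<And>v. \<phi> (\<psi> v) = v - (\<Sum>b<c. dot (y b) v *s w b)"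
begin

lemma pullback_section: "pullback \<phi> (pullback \<psi> g) = g"
  by (simp add: pullback_pullback[OF \<psi>(1) \<phi>] \<psi>(2))

lemma restrict_form_section: "restrict_form \<phi> (restrict_form \<psi> g) = g"
  by (rule form_eqI) (simp add: pairing_restrict_form \<phi> \<psi>(1,2) pullback_section)

text \<open>Modulo the forms \<open>y b\<close> the map \<open>\<phi> (\<psi> v)\<close> is the
  identity on coordinates, so \<open>f\<close> is congruent to its pullback along it, and that
  pullback factors through \<open>pullback \<phi> f\<close>.\<close>

lemma in_ideal_gen_if_pullback_eq_0:
  assumes "pullback \<phi> f = 0"
  shows "f \<in> ideal_gen (lin_polys y c)"
proof -
  have coeff: "pullback_coeff (\<lambda>v. \<phi> (\<psi> v)) a = a - (\<Sum>b<c. dot a (w b) *s y b)" for a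
  proof -
    have lin: "Vector_Spaces.linear (*s) (*s) (\<lambda>v. \<phi> (\<psi> v))"
      using Vector_Spaces.linear_compose[OF \<psi>(1) \<phi>] by (simp add: o_def)
    have "dot (pullback_coeff (\<lambda>v. \<phi> (\<psi> v)) a - (a - (\<Sum>b<c. dot a (w b) *s y b))) v = 0" for v
      unfolding dot_simps dot_pullback_coeff[OF lin]
      unfolding \<psi>(3) dot_simps dot_sum_left dot_sum_right by (simp add: mult.commute)
    then have "pullback_coeff (\<lambda>v. \<phi> (\<psi> v)) a - (a - (\<Sum>b<c. dot a (w b) *s y b)) = 0" by (rule dot_eq_0_imp)
    then show ?thesis by simp
  qed
  have "poly_subst var_poly f - pullback (\<lambda>v. \<phi> (\<psi> v)) f \<in> ideal_gen (lin_polys y c)"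
    unfolding pullback_def
  proof (rule poly_subst_cong_ideal)
    fix i
    have "var_poly i - lin_poly (pullback_coeff (\<lambda>v. \<phi> (\<psi> v)) (axis i 1)) =
        (\<Sum>b<c. const_poly (dot (axis i 1) (w b)) * lin_poly (y b))"
      unfolding coeff lin_poly_simps(4) lin_poly_sum lin_poly_simps(3,5) by simp
    also have "\<dots> \<in> ideal_gen (lin_polys y c)"
      by (intro ideal_gen_sum ideal_gen_mult in_ideal_gen_if_mem) auto
    finally show "var_poly i - lin_poly (pullback_coeff (\<lambda>v. \<phi> (\<psi> v)) (axis i 1)) \<in> ideal_gen (lin_polys y c)" .
  qed (auto intro: ideal_gen_add ideal_gen_mult)
  moreover have "pullback (\<lambda>v. \<phi> (\<psi> v)) f = 0"
    using pullback_pullback[OF \<phi> \<psi>(1), of f] assms by simp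
  ultimately show ?thesis by simp
qed

text \<open>Near a flat this makes the restriction surjective: a projection onto X along vectors of
  \<open>L\<close> maps \<open>L\<close> into its intersection with X, so logarithmic forms on X
  extend.\<close>

lemma restrict_form_section_log_numerators:
  fixes B :: "('k ^ 'n::{finite,linorder}) set set"
  assumes B: "\<And>L. L \<in> B \<Longrightarrow> hyperplane L" "\<And>L b. L \<in> B \<Longrightarrow> b < c \<Longrightarrow> w b \<in> L"
    and g: "g \<in> log_numerators ((\<lambda>L. \<phi> -` L) ` B)"
  shows "restrict_form \<psi> g \<in> log_numerators B"
proof (rule restrict_form_log_numerators_general[OF \<psi>(1) g])
  show "\<exists>L'\<in>(\<lambda>L. \<phi> -` L) ` B. \<psi> ` L \<subseteq> L'" if L: "L \<in> B" for L
  proof (rule bexI)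
    have "vec.subspace L" using B(1)[OF L] by (simp add: hyperplane_def)
    then have "v - (\<Sum>b<c. dot (y b) v *s w b) \<in> L" if "v \<in> L" for v
      using that B(2)[OF L] by (intro vec.subspace_diff vec.subspace_sum vec.subspace_scale) auto
    then show "\<psi> ` L \<subseteq> \<phi> -` L" by (auto simp: \<psi>(3))
  qed (use L in auto)
  show "kernel_of_alpha L" if "L \<in> B" for L by (rule hyperplane_kernel_of_alpha(1)[OF B(1)[OF that]])
  show "kernel_of_alpha L'" if "L' \<in> (\<lambda>L. \<phi> -` L) ` B" for L' by (rule kernel_of_alpha_vimage[OF \<phi> B(1) that])
qed

end

section \<open>Radical ideals and hyperplanes\<close>

definition radical_ideal :: "'a::comm_ring_1 set \<Rightarrow> bool" where
  "radical_ideal J \<longleftrightarrow> 0 \<in> J \<and> (\<forall>a\<in>J. \<forall>b\<in>J. a + b \<in> J) \<and> (\<forall>a. \<forall>b\<in>J. a * b \<in> J) \<and> (\<forall>a. a * a \<in> J \<longrightarrow> a \<in> J)"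

lemma radical_idealD:
  assumes "radical_ideal J"
  shows "0 \<in> J" "a \<in> J \<Longrightarrow> b \<in> J \<Longrightarrow> a + b \<in> J" "b \<in> J \<Longrightarrow> a * b \<in> J" "a * a \<in> J \<Longrightarrow> a \<in> J"
  using assms unfolding radical_ideal_def by blast+

text \<open>For radical \<open>J\<close> the colon ideal is the intersection of the primes over
  \<open>J\<close> that avoid \<open>u\<close>. Passing to it replaces the choice of such a
  prime.\<close>

lemma radical_ideal_colon:
  assumes "radical_ideal J"
  shows "radical_ideal {g. u * g \<in> J}"
  unfolding radical_ideal_def
proof (intro conjI ballI allI impI)
  fix a assume "a * a \<in> {g. u * g \<in> J}"
  then have "u * (u * (a * a)) \<in> J" using radical_idealD(3)[OF assms] by blast
  also have "u * (u * (a * a)) = (u * a) * (u * a)" by (simp add: mult_ac)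
  finally show "a \<in> {g. u * g \<in> J}" using radical_idealD(4)[OF assms] by blast
next
  fix a b assume "b \<in> {g. u * g \<in> J}"
  then have "a * (u * b) \<in> J" using radical_idealD(3)[OF assms] by blast
  then show "a * b \<in> {g. u * g \<in> J}" by (simp add: mult_ac)
qed (simp_all add: distrib_left radical_idealD(1,2)[OF assms])

lemma radical_ideal_radical:
  fixes J :: "'a::comm_ring_1 set"
  assumes J: "0 \<in> J" "\<And>a b. a \<in> J \<Longrightarrow> b \<in> J \<Longrightarrow> a + b \<in> J" "\<And>a b. b \<in> J \<Longrightarrow> a * b \<in> J"
  shows "radical_ideal {g. \<exists>s. g ^ s \<in> J}"
  unfolding radical_ideal_def
proof (intro conjI ballI allI impI)
  show "0 \<in> {g. \<exists>s. g ^ s \<in> J}" using J(1) by (auto intro: exI[of _ 1])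
next
  fix a b assume "a \<in> {g. \<exists>s. g ^ s \<in> J}" "b \<in> {g. \<exists>s. g ^ s \<in> J}"
  then obtain s t where s: "a ^ s \<in> J" and t: "b ^ t \<in> J" by auto
  have sum: "sum f I \<in> J" if "\<And>i. i \<in> I \<Longrightarrow> f i \<in> J" for f :: "nat \<Rightarrow> 'a" and I
    using that by (induction I rule: infinite_finite_induct) (auto intro: J)
  have "(a + b) ^ (s + t) = (\<Sum>k\<le>s + t. of_nat (s + t choose k) * a ^ k * b ^ (s + t - k))" by (rule binomial_ring)
  also have "\<dots> \<in> J"
  proof (rule sum)
    fix k assume "k \<in> {..s + t}"
    show "of_nat (s + t choose k) * a ^ k * b ^ (s + t - k) \<in> J"
    proof (cases "s \<le> k")
      case True
      then have "a ^ k = a ^ (k - s) * a ^ s" by (simp flip: power_add)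
      then show ?thesis using J(3)[OF s, of "of_nat (s + t choose k) * a ^ (k - s) * b ^ (s + t - k)"] by (simp add: mult_ac)
    next
      case False
      then have "b ^ (s + t - k) = b ^ (s - k) * b ^ t" by (simp flip: power_add)
      then show ?thesis using J(3)[OF t, of "of_nat (s + t choose k) * a ^ k * b ^ (s - k)"] by (simp add: mult_ac)
    qed
  qed
  finally show "a + b \<in> {g. \<exists>s. g ^ s \<in> J}" by blast
next
  fix a b assume "b \<in> {g. \<exists>s. g ^ s \<in> J}"
  then obtain s where "b ^ s \<in> J" by auto
  then show "a * b \<in> {g. \<exists>s. g ^ s \<in> J}" using J(3) by (auto simp: power_mult_distrib)
next
  fix a assume "a * a \<in> {g. \<exists>s. g ^ s \<in> J}"
  then obtain s where "(a * a) ^ s \<in> J" by auto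
  also have "(a * a) ^ s = a ^ (s + s)" by (simp add: power_mult_distrib power_add)
  finally show "a \<in> {g. \<exists>s. g ^ s \<in> J}" by blast
qed

text \<open>
  A combinatorial Nullstellensatz: \<open>z\<close> lies in every prime containing \<open>J\<close>, since the \<open>L\<close> with
  \<open>\<alpha>\<close> in the prime intersect only in zero on \<open>X\<close>.
\<close>

lemma flats_nullstellensatz:
  fixes A :: "('k::field ^ 'n::{finite,linorder}) set set" and z :: "('k, 'n) mpoly"
  assumes fin: "finite A"
    and base: "\<And>F J. F \<subseteq> A \<Longrightarrow> X \<inter> \<Inter>F = {0} \<Longrightarrow> radical_ideal J \<Longrightarrow> K \<subseteq> J \<Longrightarrow> (\<And>L. L \<in> F \<Longrightarrow> alpha L \<in> J) \<Longrightarrow> z \<in> J"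
    and J: "radical_ideal J" "K \<subseteq> J"
    and flats: "\<And>F. F \<subseteq> A \<Longrightarrow> X \<inter> \<Inter>F \<noteq> {0} \<Longrightarrow> (\<Prod>L\<in>{L\<in>A. \<not> \<Inter>F \<subseteq> L}. alpha L) \<in> J"
  shows "z \<in> J"
proof -
  have "z \<in> J'" if "F \<subseteq> A" "radical_ideal J'" "J \<subseteq> J'" "\<And>L. L \<in> F \<Longrightarrow> alpha L \<in> J'" for F J'
    using that
  proof (induction "card (A - F)" arbitrary: F J' rule: less_induct)
    case less
    show ?case
    proof (cases "X \<inter> \<Inter>F = {0}")
      case True
      show ?thesis by (rule base[OF less.prems(1) True less.prems(2) order_trans[OF J(2) less.prems(3)] less.prems(4)])
    next
      case False
      let ?T = "{L\<in>A. \<not> \<Inter>F \<subseteq> L}"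
      have "z \<in> J''" if "finite T" "T \<subseteq> ?T" "radical_ideal J''" "J' \<subseteq> J''" "(\<Prod>L\<in>T. alpha L) \<in> J''" for T J''
        using that
      proof (induction T arbitrary: J'' rule: finite_induct)
        case empty
        then show ?case using radical_idealD(3)[of J'' 1 z] by simp
      next
        case (insert L T)
        note J'' = radical_idealD[OF insert.prems(2)]
        have "z \<in> {g. alpha L * g \<in> J''}"
        proof (rule insert.IH)
          show "J' \<subseteq> {g. alpha L * g \<in> J''}" using insert.prems(3) J''(3)[of _ "alpha L"] by blast
          show "(\<Prod>L\<in>T. alpha L) \<in> {g. alpha L * g \<in> J''}" using insert.prems(4) insert.hyps by simp
        qed (use insert.prems(1) radical_ideal_colon[OF insert.prems(2)] in blast)+
        then have az: "z * alpha L \<in> J''" by (simp add: mult.commute)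
        have "L \<in> A - F" using insert.prems by auto
        have "z \<in> {g. z * g \<in> J''}"
        proof (rule less.hyps)
          show "card (A - insert L F) < card (A - F)"
            using fin \<open>L \<in> A - F\<close> by (intro psubset_card_mono) auto
          show "alpha L' \<in> {g. z * g \<in> J''}" if "L' \<in> insert L F" for L'
            using that az less.prems(4) insert.prems(3) J''(3)[of "alpha L'" z] by blast
          show "insert L F \<subseteq> A" using less.prems(1) \<open>L \<in> A - F\<close> by blast
          show "radical_ideal {g. z * g \<in> J''}" by (rule radical_ideal_colon[OF insert.prems(2)])
          show "J \<subseteq> {g. z * g \<in> J''}" using less.prems(3) insert.prems(3) J''(3)[of _ z] by blast
        qed
        then have "z * z \<in> J''" by simp
        then show ?case by (rule J''(4))
      qed
      from this[of ?T J', OF _ order_refl less.prems(2) order_refl] show ?thesis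
        using fin subsetD[OF less.prems(3) flats[OF less.prems(1) False]] by simp
    qed
  qed
  from this[of "{}" J] show ?thesis using J(1) by auto
qed

lemma lin_poly_in_ideal_if_span:
  assumes "a \<in> vec.span S" "\<And>s. s \<in> S \<Longrightarrow> lin_poly s \<in> J"
    and J: "0 \<in> J" "\<And>a b. a \<in> J \<Longrightarrow> b \<in> J \<Longrightarrow> a + b \<in> J" "\<And>a b. b \<in> J \<Longrightarrow> a * b \<in> J"
  shows "lin_poly a \<in> J"
  using assms(1)
proof (induction rule: vec.span_induct)
  show "vec.subspace {a. lin_poly a \<in> J}"
    by (rule vec.subspaceI) (auto simp: lin_poly_simps J)
qed (use assms(2) in auto)

section \<open>Codimension and transversality\<close>

lemma subspace_Inter_hyperplanes: "(\<And>L. L \<in> F \<Longrightarrow> hyperplane L) \<Longrightarrow> vec.subspace (\<Inter>F)"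
  by (intro vec.subspace_Inter) (auto simp: hyperplane_def)

lemma dim_le_CARD: "vec.dim (Y :: ('k::field ^ 'n::finite) set) \<le> CARD('n)"
  using vec.dim_subset_UNIV[of Y] by (simp add: vec.dimension_def card_cart_basis)

lemma codim_UNIV: "codim (UNIV :: ('k::field ^ 'n::finite) set) = 0"
  by (simp add: codim_def vec.dim_UNIV card_cart_basis)

lemma codim_Int_hyperplane:
  fixes Y :: "('k::field ^ 'n::finite) set"
  assumes "hyperplane L" "vec.subspace Y"
  shows "codim (L \<inter> Y) \<le> codim Y + 1"
  using vec.dim_sums_Int[of L Y] assms dim_le_CARD[of "{x + y |x y. x \<in> L \<and> y \<in> Y}"] dim_le_CARD[of L]
  unfolding hyperplane_def codim_def by linarith

text \<open>A discrete intermediate value argument, since each further hyperplane raises the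
  codimension by at most one.\<close>

lemma exists_subset_with_codim:
  fixes F :: "('k::field ^ 'n::finite) set set"
  assumes "finite F" "\<And>L. L \<in> F \<Longrightarrow> hyperplane L" "t \<le> codim (\<Inter>F)"
  shows "\<exists>F'\<subseteq>F. codim (\<Inter>F') = t"
  using assms
proof (induction F rule: finite_induct)
  case empty
  then show ?case by (simp add: codim_UNIV)
next
  case (insert L F)
  show ?case
  proof (cases "t \<le> codim (\<Inter>F)")
    case True
    then show ?thesis using insert by (metis insertCI subset_insertI2)
  next
    case False
    then have "codim (\<Inter>(insert L F)) = t"
      using codim_Int_hyperplane[of L "\<Inter>F"] insert.prems subspace_Inter_hyperplanes[of F] by auto
    then show ?thesis by blast
  qed
qed

text \<open>Genericity speaks only of flats of codimension at most dim X. A deeper flat lies in one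
  of codimension exactly dim X, which already meets X in 0. So a flat meeting X nontrivially obeys
  the codimension formula, and this says that its sum with X has full dimension.\<close>

lemma generic_sum_eq_UNIV:
  fixes A :: "('k::field ^ 'n::{finite,linorder}) set set"
  assumes A: "central_arrangement A" and X: "vec.subspace X" "generic_wrt X A"
    and F: "F \<subseteq> A" "X \<inter> \<Inter>F \<noteq> {0}"
  shows "{x + y |x y. x \<in> X \<and> y \<in> \<Inter>F} = UNIV"
proof -
  have hyp: "\<And>L. L \<in> F \<Longrightarrow> hyperplane L" and fin: "finite F"
    using A F(1) finite_subset by (auto simp: central_arrangement_def)
  have Y: "vec.subspace (\<Inter>F)" using hyp by (rule subspace_Inter_hyperplanes)
  have gen: "codim (X \<inter> \<Inter>G) = codim X + codim (\<Inter>G)" if "G \<subseteq> A" "codim (\<Inter>G) \<le> CARD('n) - codim X" for G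
  proof -
    have "\<Inter>G \<in> intersection_lattice A" unfolding intersection_lattice_def using that(1) by blast
    then show ?thesis using X(2) that(2) unfolding generic_wrt_def by simp
  qed
  have le: "codim (\<Inter>F) \<le> CARD('n) - codim X"
  proof (rule ccontr)
    assume "\<not> ?thesis"
    then obtain F' where F': "F' \<subseteq> F" "codim (\<Inter>F') = CARD('n) - codim X"
      using exists_subset_with_codim[OF fin hyp, of "CARD('n) - codim X"] by auto
    then have "codim (X \<inter> \<Inter>F') = codim X + codim (\<Inter>F')"
      using F(1) by (intro gen) auto
    then have "vec.dim (X \<inter> \<Inter>F') = 0"
      using F'(2) dim_le_CARD[of X] dim_le_CARD[of "X \<inter> \<Inter>F'"] unfolding codim_def by linarith
    then have "X \<inter> \<Inter>F' \<subseteq> {0}" by simp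
    moreover have "X \<inter> \<Inter>F \<subseteq> X \<inter> \<Inter>F'" using F'(1) by blast
    moreover have "0 \<in> X \<inter> \<Inter>F" using vec.subspace_0 X(1) Y by blast
    ultimately show False using F(2) by blast
  qed
  then have "codim (X \<inter> \<Inter>F) = codim X + codim (\<Inter>F)"
    using F(1) by (intro gen) auto
  then have "vec.dim {x + y |x y. x \<in> X \<and> y \<in> \<Inter>F} \<ge> CARD('n)"
    using vec.dim_sums_Int[OF X(1) Y] le dim_le_CARD[of X] dim_le_CARD[of "\<Inter>F"] dim_le_CARD[of "X \<inter> \<Inter>F"]
    unfolding codim_def by linarith
  then have "vec.dim {x + y |x y. x \<in> X \<and> y \<in> \<Inter>F} = vec.dim (UNIV :: ('k ^ 'n::{finite,linorder}) set)"
    using dim_le_CARD[of "{x + y |x y. x \<in> X \<and> y \<in> \<Inter>F}"] by (simp add: vec.dim_UNIV card_cart_basis)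
  then show ?thesis
    using vec.subspace_sums[OF X(1) Y] by (intro vec.subspace_dim_equal) auto
qed

text \<open>Depth two of the module: two independent linear forms are a regular sequence on it.
  Coordinatewise division by the prime \<open>lin_poly a\<close> is possible, and the quotient is
  logarithmic because no \<open>alpha L\<close> divides both forms.\<close>

lemma log_numerators_cancel:
  fixes g g' :: "('k::field, 'n::{finite,linorder}) mpoly ^ 'n::{finite,linorder}"
  assumes a: "a \<noteq> 0" "\<not> lin_poly a dvd lin_poly b"
    and g: "g \<in> log_numerators B" "g' \<in> log_numerators B" and eq: "lin_poly b *s g = lin_poly a *s g'"
  obtains h where "h \<in> log_numerators B" "g = lin_poly a *s h"
proof -
  have "lin_poly a dvd g $ i" for i
  proof -
    have "lin_poly b * g $ i = lin_poly a * g' $ i" using eq by (metis vector_smult_component)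
    then have "lin_poly a dvd lin_poly b * g $ i" by simp
    then show ?thesis using lin_poly_dvd_multD a(2) by blast
  qed
  then obtain h' where h': "\<And>i. g $ i = lin_poly a * h' i" by (auto simp: dvd_def) metis
  define h where "h = (\<chi> i. h' i)"
  have gh: "g = lin_poly a *s h" by (simp add: vec_eq_iff h' h_def)
  have "lin_poly a *s (lin_poly b *s h) = lin_poly a *s g'"
    using eq unfolding gh by (simp add: mult.commute)
  then have gh': "g' = lin_poly b *s h" using a(1) by (auto simp: vec_eq_iff)
  have "h \<in> log_numerators B"
    unfolding log_numerators_def
  proof (intro CollectI ballI)
    fix L v assume L: "L \<in> B" "v \<in> L"
    then have dvd: "alpha L dvd lin_poly a * pairing h v" "alpha L dvd lin_poly b * pairing h v"
      using g unfolding gh gh' log_numerators_def by auto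
    show "alpha L dvd pairing h v"
    proof (rule ccontr)
      assume "\<not> alpha L dvd pairing h v"
      then have "lin_poly (alpha_coeff L) dvd lin_poly a" "lin_poly (alpha_coeff L) dvd lin_poly b"
        using dvd lin_poly_dvd_multD unfolding alpha_eq_lin_poly by blast+
      then obtain r s where r: "a = r *s alpha_coeff L" "b = s *s alpha_coeff L"
        using proportional_if_kernel_subset lin_poly_dvd_lin_polyD by metis
      have "r \<noteq> 0" using r(1) a(1) by auto
      then have "dot b u = 0" if "dot a u = 0" for u using that by (simp add: r)
      then show False using lin_poly_dvd_lin_poly a(2) by blast
    qed
  qed
  then show ?thesis using that gh by blast
qed

section \<open>Rational forms and their numerators\<close>

definition to_form :: "('k::field, 'n::{finite,linorder}) mpoly \<Rightarrow> ('k, 'n) mpoly ^ 'n::{finite,linorder} \<Rightarrow> ('k, 'n) rational_form" where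
  "to_form q f = (\<chi> i. Fract (f $ i) q)"

lemma Fract_add_same: "q \<noteq> 0 \<Longrightarrow> Fract a q + Fract b q = Fract (a + b) q"
  and Fract_diff_same: "q \<noteq> 0 \<Longrightarrow> Fract a q - Fract b q = Fract (a - b) q"
  for q :: "'a::idom"
  by (simp_all add: eq_fract algebra_simps)

lemma Fract_eq_same: "q \<noteq> 0 \<Longrightarrow> Fract a q = Fract b q \<longleftrightarrow> a = b" for q :: "'a::idom"
  by (simp add: eq_fract)

lemma module_hom_to_form:
  assumes "q \<noteq> 0"
  shows "module_hom (*s) form_scale (to_form q)"
proof -
  interpret fs: module form_scale by (rule module_form_scale)
  show ?thesis
    by unfold_locales (use assms in \<open>simp_all add: to_form_def form_scale_def vec_eq_iff Fract_add_same del: add_fract\<close>)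
qed

lemma inj_to_form: "q \<noteq> 0 \<Longrightarrow> inj (to_form q)"
  by (auto simp: inj_def to_form_def vec_eq_iff Fract_eq_same)

lemma wedge_to_form:
  assumes "q \<noteq> 0"
  shows "wedge (to_form q f) (d_alpha L) i j =
    Fract (f $ i * const_poly (alpha_coeff L $ j) - f $ j * const_poly (alpha_coeff L $ i)) q"
  using assms by (simp add: wedge_def to_form_def d_alpha_def Fract_diff_same del: diff_fract)

text \<open>The sum contracts the wedge product of \<open>f\<close> with the constant form
  \<open>a\<close> against \<open>v\<close> and \<open>u\<close>. For \<open>v\<close> in the
  hyperplane and \<open>dot a u = 1\<close> the left side is just
  \<open>pairing f v\<close>.\<close>

lemma pairing_const_mult: "pairing f v * const_poly (dot a u) - pairing f u * const_poly (dot a v) =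
  (\<Sum>i\<in>UNIV. \<Sum>j\<in>UNIV. (f $ i * const_poly (a $ j) - f $ j * const_poly (a $ i)) * const_poly (v $ i * u $ j))"
proof -
  have "pairing f v * const_poly (dot a u) = (\<Sum>i\<in>UNIV. \<Sum>j\<in>UNIV. f $ i * const_poly (a $ j) * const_poly (v $ i * u $ j))"
    unfolding pairing_def dot_def const_poly_sum const_poly_mult sum_product by (simp add: mult_ac)
  moreover have "pairing f u * const_poly (dot a v) = (\<Sum>j\<in>UNIV. \<Sum>i\<in>UNIV. f $ j * const_poly (a $ i) * const_poly (v $ i * u $ j))"
    unfolding pairing_def dot_def const_poly_sum const_poly_mult sum_product by (simp add: mult_ac)
  ultimately show ?thesis
    unfolding left_diff_distrib sum_subtractf by (simp add: sum.swap[of "\<lambda>j i. f $ j * const_poly (a $ i) * const_poly (v $ i * u $ j)"])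
qed

text \<open>Kernels of nonzero forms are assumed instead of hyperplanes so that the lemma fits the
  restricted arrangement as well.\<close>

lemma log_forms_eq_image:
  fixes B :: "('k::field ^ 'n::{finite,linorder}) set set"
  assumes Q: "Qpoly B \<noteq> 0" and ker: "\<And>L. L \<in> B \<Longrightarrow> kernel_of_alpha L"
    and nz: "\<And>L. L \<in> B \<Longrightarrow> alpha_coeff L \<noteq> 0"
  shows "log_forms B = to_form (Qpoly B) ` log_numerators B"
proof (intro equalityI subsetI)
  fix \<omega> assume \<omega>: "\<omega> \<in> log_forms B"
  then obtain f' where f': "\<And>i. \<omega> $ i = Fract (f' i) (Qpoly B)" unfolding log_forms_def by blast
  define f where "f = (\<chi> i. f' i)"
  have \<omega>_eq: "\<omega> = to_form (Qpoly B) f" by (simp add: to_form_def vec_eq_iff f' f_def)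
  have "f \<in> log_numerators B" unfolding log_numerators_def
  proof (intro CollectI ballI)
    fix L v assume L: "L \<in> B" "v \<in> L"
    let ?m = "\<lambda>i j. f $ i * const_poly (alpha_coeff L $ j) - f $ j * const_poly (alpha_coeff L $ i)"
    obtain g where g: "\<And>i j. i < j \<Longrightarrow> wedge \<omega> (d_alpha L) i j = Fract (alpha L * g i j) (Qpoly B)"
      using \<omega> L(1) unfolding log_forms_def by blast
    have less: "alpha L dvd ?m i j" if "i < j" for i j
    proof -
      have "Fract (?m i j) (Qpoly B) = Fract (alpha L * g i j) (Qpoly B)"
        using g[OF that] wedge_to_form[OF Q] unfolding \<omega>_eq by simp
      then have "?m i j = alpha L * g i j" using Fract_eq_same[OF Q] by blast
      then show ?thesis by simp
    qed
    have dvd: "alpha L dvd ?m i j" for i j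
    proof (cases i j rule: linorder_cases)
      case greater
      have "?m i j = - ?m j i" by simp
      then show ?thesis using less[OF greater] by (metis dvd_minus_iff)
    qed (use less in auto)
    obtain u where u: "dot (alpha_coeff L) u = 1" using exists_dot_eq_1 nz[OF L(1)] by blast
    have v: "dot (alpha_coeff L) v = 0" using ker[OF L(1)] L(2) by blast
    have "alpha L dvd (\<Sum>i\<in>UNIV. \<Sum>j\<in>UNIV. ?m i j * const_poly (v $ i * u $ j))"
      by (intro dvd_sum dvd_mult2 dvd)
    then show "alpha L dvd pairing f v" unfolding pairing_const_mult[symmetric] u v by simp
  qed
  then show "\<omega> \<in> to_form (Qpoly B) ` log_numerators B" unfolding \<omega>_eq by (rule imageI)
next
  fix \<omega> assume "\<omega> \<in> to_form (Qpoly B) ` log_numerators B"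
  then obtain f where f: "f \<in> log_numerators B" and \<omega>: "\<omega> = to_form (Qpoly B) f" by blast
  show "\<omega> \<in> log_forms B" unfolding log_forms_def
  proof (intro CollectI conjI ballI)
    show "\<exists>f. \<forall>i. \<omega> $ i = Fract (f i) (Qpoly B)"
      by (intro exI[of _ "\<lambda>i. f $ i"]) (simp add: \<omega> to_form_def)
  next
    fix L assume L: "L \<in> B"
    let ?a = "alpha_coeff L"
    have "alpha L dvd f $ i * const_poly (?a $ j) - f $ j * const_poly (?a $ i)" for i j
    proof -
      \<comment> \<open>This vector of \<open>L\<close> contracts \<open>f\<close> to the
        coefficient of the wedge product at \<open>i\<close> and \<open>j\<close>.\<close>
      have "?a $ j *s axis i 1 - ?a $ i *s axis j 1 \<in> L"
        by (subst ker[OF L]) (simp add: mult.commute)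
      then have "alpha L dvd pairing f (?a $ j *s axis i 1 - ?a $ i *s axis j 1)"
        using f L unfolding log_numerators_def by blast
      then show ?thesis by (simp add: mult.commute)
    qed
    then have "\<exists>g. \<forall>i j. f $ i * const_poly (?a $ j) - f $ j * const_poly (?a $ i) = alpha L * g i j"
      unfolding dvd_def by metis
    then show "\<exists>g. \<forall>i j. i < j \<longrightarrow> wedge \<omega> (d_alpha L) i j = Fract (alpha L * g i j) (Qpoly B)"
      unfolding \<omega> wedge_to_form[OF Q] by metis
  qed
qed

lemma (in module_hom) free_mod_if_free_mod_image:
  assumes "inj f" "free_mod s2 (f ` M)"
  shows "free_mod s1 M"
proof -
  obtain E where E: "m2.independent E" "m2.span E = f ` M" using assms(2) unfolding free_mod_def by blast
  define E' where "E' = f -` E"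
  have "E \<subseteq> f ` M" using m2.span_superset[of E] unfolding E(2) .
  also have "\<dots> \<subseteq> range f" by (intro image_mono subset_UNIV)
  finally have img: "f ` E' = E" unfolding E'_def image_vimage_eq by (rule Int_absorb2)
  have "f ` m1.span E' = f ` M" using span_image[of E'] img E(2) by simp
  then have "m1.span E' = M" using assms(1) by (simp add: inj_image_eq_iff)
  moreover have "m1.independent E'"
  proof
    assume "m1.dependent E'"
    then obtain t u v where t: "finite t" "t \<subseteq> E'" "(\<Sum>v\<in>t. s1 (u v) v) = 0" "v \<in> t" "u v \<noteq> 0"
      unfolding m1.dependent_explicit by blast
    have "(\<Sum>x\<in>f ` t. s2 (u (inv f x)) x) = (\<Sum>v\<in>t. s2 (u v) (f v))"
      using assms(1) by (subst sum.reindex) (auto intro: inj_on_subset)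
    also have "\<dots> = f (\<Sum>v\<in>t. s1 (u v) v)" by (simp add: sum scale)
    finally have "(\<Sum>x\<in>f ` t. s2 (u (inv f x)) x) = 0" using t(3) by simp
    then have "m2.dependent E" unfolding m2.dependent_explicit
      using t assms(1) img by (intro exI[of _ "f ` t"] exI[of _ "\<lambda>x. u (inv f x)"]) auto
    then show False using E(1) by blast
  qed
  ultimately show ?thesis unfolding free_mod_def by blast
qed

lemma free_mod_log_numerators:
  fixes B :: "('k::field ^ 'n::{finite,linorder}) set set"
  assumes "Qpoly B \<noteq> 0" "\<And>L. L \<in> B \<Longrightarrow> kernel_of_alpha L" "\<And>L. L \<in> B \<Longrightarrow> alpha_coeff L \<noteq> 0" "free_arrangement B"
  shows "free_mod (*s) (log_numerators B)"
proof -
  interpret module_hom "(*s)" form_scale "to_form (Qpoly B)" by (rule module_hom_to_form) fact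
  show ?thesis
    using assms log_forms_eq_image[OF assms(1-3)] unfolding free_arrangement_def
    by (intro free_mod_if_free_mod_image inj_to_form) auto
qed

lemma adjoin_pullback_pairing:
  fixes \<phi> :: "'k::field ^ 'm::finite \<Rightarrow> 'k ^ 'n::finite"
  assumes "\<And>g. g \<in> set gs \<Longrightarrow> pullback \<phi> g = 0" "x \<in> form.adjoin gs M D"
  shows "\<exists>d\<in>D. \<forall>v. pullback \<phi> (pairing x v) = pullback \<phi> (pairing d v)"
  using assms
proof (induction gs arbitrary: x)
  case (Cons g gs)
  then obtain a b where b: "b \<in> form.adjoin gs M D" and x: "x = g *s a + b" by (auto elim: form.add_multiplesE)
  have "\<exists>d\<in>D. \<forall>v. pullback \<phi> (pairing b v) = pullback \<phi> (pairing d v)"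
    using Cons.prems(1) b by (intro Cons.IH) auto
  then show ?case using Cons.prems(1) by (simp add: x)
qed auto

lemma conormal_subset_log_numerators: "finite B \<Longrightarrow> conormal_forms c y (Qpoly B) \<subseteq> log_numerators B"
proof
  fix x assume "finite B" and "x \<in> conormal_forms c y (Qpoly B)"
  then obtain g where x: "x = (\<Sum>b<c. (Qpoly B * g b) *s const_form (y b))" unfolding conormal_forms_in_def by auto
  show "x \<in> log_numerators B" unfolding log_numerators_def x
  proof (intro CollectI ballI)
    fix L v assume "L \<in> B"
    then have "alpha L dvd Qpoly B" unfolding Qpoly_def using \<open>finite B\<close> by (intro dvd_prodI) auto
    then show "alpha L dvd pairing (\<Sum>b<c. (Qpoly B * g b) *s const_form (y b)) v"
      unfolding pairing_sum pairing_simps by (intro dvd_sum dvd_mult2)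
  qed
qed

section \<open>The contradiction from a free restriction\<close>

context
  fixes \<phi> :: "'k::field ^ 'm::{finite,linorder} \<Rightarrow> 'k ^ 'n::{finite,linorder}"
    and \<psi> :: "'k ^ 'n::{finite,linorder} \<Rightarrow> 'k ^ 'm::{finite,linorder}"
    and y w :: "nat \<Rightarrow> 'k ^ 'n::{finite,linorder}" and c :: nat
    and A :: "('k ^ 'n::{finite,linorder}) set set" and N :: "(('k, 'm) mpoly ^ 'm::{finite,linorder}) set"
  assumes \<phi>: "Vector_Spaces.linear (*s) (*s) \<phi>" and \<psi>: "Vector_Spaces.linear (*s) (*s) \<psi>" "\<And>v. \<psi> (\<phi> v) = v"
    "\<And>v. \<phi> (\<psi> v) = v - (\<Sum>b<c. dot (y b) v *s w b)"
    and d: "dual_systems c y w" and c: "c > 0" and y\<phi>: "\<And>b. b < c \<Longrightarrow> pullback \<phi> (lin_poly (y b)) = 0"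
    and A: "finite A" "\<And>L. L \<in> A \<Longrightarrow> hyperplane L" and Q: "pullback \<phi> (Qpoly A) \<noteq> 0" and ess: "\<Inter>A = {0}"
    and N: "free_mod (*s) N" "\<And>f. f \<in> log_numerators A \<Longrightarrow> restrict_form \<phi> f \<in> N"
    and onto: "\<And>g. g \<in> N \<Longrightarrow> \<exists>f\<in>log_numerators A. restrict_form \<phi> f = g"
    and kernel: "\<And>f. f \<in> log_numerators A \<Longrightarrow> restrict_form \<phi> f = 0 \<Longrightarrow>
      f \<in> form.adjoin (lin_polys y c) (log_numerators A) (conormal_forms c y (Qpoly A))"
begin

text \<open>The maximal ideal of the origin, as the kernel of evaluation at 0.\<close>

private abbreviation "\<mm> \<equiv> {g :: ('k, 'n) mpoly. poly_subst (\<lambda>_. 0 :: ('k, 'n) mpoly) g = 0}"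
private abbreviation "small_conormal_forms \<equiv> conormal_forms_in \<mm> c y (Qpoly A)"

lemma subspace_small_conormal_forms: "form.subspace small_conormal_forms"
  by (rule subspace_conormal_forms_in) (auto simp: poly_subst_hom)

lemma scale_conormal_small:
  assumes "poly_subst (\<lambda>_. 0 :: ('k, 'n) mpoly) r = 0" "x \<in> conormal_forms c y (Qpoly A)"
  shows "r *s x \<in> small_conormal_forms"
proof -
  obtain g where "x = (\<Sum>b<c. (Qpoly A * g b) *s const_form (y b))" using assms(2) unfolding conormal_forms_in_def by auto
  then have "r *s x = (\<Sum>b<c. (Qpoly A * (r * g b)) *s const_form (y b))"
    by (simp add: form.scale_sum_right mult_ac)
  then show ?thesis unfolding conormal_forms_in_def
    using assms(1) by (intro CollectI exI[of _ "\<lambda>b. r * g b"]) (simp add: poly_subst_mult)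
qed

text \<open>Restricting coefficients but not differentials removes the multiples of the
  \<open>y b\<close>, and pairing with \<open>w 0\<close> then compares coefficients of dy_0.
  Membership would put \<open>1 - g 0\<close> into the ideal of X for some \<open>g 0\<close>
  without constant term, which is impossible at the origin.\<close>

lemma not_in_small: "Qpoly A *s const_form (y 0) \<notin> form.adjoin (lin_polys y c) (log_numerators A) small_conormal_forms"
proof
  assume "Qpoly A *s const_form (y 0) \<in> form.adjoin (lin_polys y c) (log_numerators A) small_conormal_forms"
  moreover have "pullback \<phi> g = 0" if "g \<in> set (lin_polys y c)" for g using that y\<phi> by auto
  ultimately obtain x where "x \<in> small_conormal_forms"
    and x: "\<And>v. pullback \<phi> (pairing (Qpoly A *s const_form (y 0)) v) = pullback \<phi> (pairing x v)"
    using adjoin_pullback_pairing by metis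
  then obtain g where g: "x = (\<Sum>b<c. (Qpoly A * g b) *s const_form (y b))"
    "poly_subst (\<lambda>_. 0 :: ('k, 'n) mpoly) (g 0) = 0" unfolding conormal_forms_in_def using c by blast
  have "pairing x (w 0) = Qpoly A * g 0" unfolding g(1) by (rule pairing_conormal[OF d c])
  then have "pullback \<phi> (Qpoly A) * (pullback \<phi> (g 0) - 1) = 0"
    using x[of "w 0"] d c by (simp add: algebra_simps)
  then have "pullback \<phi> (1 - g 0) = 0" using Q by simp
  then have "1 - g 0 \<in> ideal_gen (lin_polys y c)"
    by (rule in_ideal_gen_if_pullback_eq_0[OF \<phi> \<psi>])
  moreover have "poly_subst (\<lambda>_. 0 :: ('k, 'n) mpoly) f = 0" if "f \<in> ideal_gen gs" "set gs \<subseteq> range lin_poly" for f gs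
    using that by (induction gs arbitrary: f) (auto simp: poly_subst_add poly_subst_mult)
  ultimately have "poly_subst (\<lambda>_. 0 :: ('k, 'n) mpoly) (1 - g 0) = 0" by fastforce
  then show False using g(2) by (simp add: poly_subst_diff)
qed

text \<open>Up to the kernel of the restriction, every \<open>m t\<close> is a combination of lifts
  \<open>l e\<close> of the basis \<open>E\<close>. Independence of \<open>E\<close> forces the
  total coefficient of each \<open>l e\<close> to vanish on X, hence to lie in the ideal of X. The
  kernel parts are multiplied by the \<open>g t\<close>, which vanish at the origin, and so
  contribute only small conormal forms.\<close>

lemma small_if_restriction_zero:
  assumes T: "finite T" "\<And>t. t \<in> T \<Longrightarrow> m t \<in> log_numerators A" "\<And>t. t \<in> T \<Longrightarrow> poly_subst (\<lambda>_. 0 :: ('k, 'n) mpoly) (g t) = 0"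
    and zero: "restrict_form \<phi> (\<Sum>t\<in>T. g t *s m t) = 0"
  shows "(\<Sum>t\<in>T. g t *s m t) \<in> form.adjoin (lin_polys y c) (log_numerators A) small_conormal_forms"
proof -
  let ?W = "form.adjoin (lin_polys y c) (log_numerators A) small_conormal_forms"
  have W: "form.subspace ?W" by (intro form.subspace_adjoin subspace_log_numerators subspace_small_conormal_forms)
  obtain E where E: "form.independent E" "form.span E = N" using N(1) unfolding free_mod_def by blast
  have "\<forall>e. \<exists>f. e \<in> E \<longrightarrow> f \<in> log_numerators A \<and> restrict_form \<phi> f = e"
    using onto E(2) form.span_superset[of E] by blast
  then obtain l where l: "\<And>e. e \<in> E \<Longrightarrow> l e \<in> log_numerators A" "\<And>e. e \<in> E \<Longrightarrow> restrict_form \<phi> (l e) = e" by metis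
  define r where "r t = form.representation E (restrict_form \<phi> (m t))" for t
  define F where "F = (\<Union>t\<in>T. {e. r t e \<noteq> 0})"
  have F: "finite F" "F \<subseteq> E" "\<And>t. t \<in> T \<Longrightarrow> {e. r t e \<noteq> 0} \<subseteq> F"
    using T(1) form.finite_representation form.representation_ne_zero unfolding F_def r_def by auto
  have span: "restrict_form \<phi> (m t) \<in> form.span E" if "t \<in> T" for t using N(2) T(2) that E(2) by simp
  have expand: "restrict_form \<phi> (m t) = (\<Sum>e\<in>F. r t e *s e)" if "t \<in> T" for t
  proof -
    have "(\<Sum>e\<in>{e. r t e \<noteq> 0}. r t e *s e) = restrict_form \<phi> (m t)"
      unfolding r_def by (rule form.sum_nonzero_representation_eq[OF E(1) span[OF that]])
    moreover have "(\<Sum>e\<in>{e. r t e \<noteq> 0}. r t e *s e) = (\<Sum>e\<in>F. r t e *s e)"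
      using F(1,3) that by (intro sum.mono_neutral_left) auto
    ultimately show ?thesis by simp
  qed
  \<comment> \<open>The coefficients are polynomials on X; they are lifted to V through
    \<open>\<psi>\<close>, so that \<open>\<kappa> t\<close> restricts to zero.\<close>
  define \<kappa> where "\<kappa> t = m t - (\<Sum>e\<in>F. pullback \<psi> (r t e) *s l e)" for t
  have \<kappa>: "\<kappa> t \<in> form.adjoin (lin_polys y c) (log_numerators A) (conormal_forms c y (Qpoly A))" if "t \<in> T" for t
  proof (rule kernel)
    show "\<kappa> t \<in> log_numerators A" unfolding \<kappa>_def using F(2) l(1) T(2) that
      by (intro form.subspace_diff form.subspace_sum form.subspace_scale subspace_log_numerators) auto
    have "(\<Sum>e\<in>F. pullback \<phi> (pullback \<psi> (r t e)) *s restrict_form \<phi> (l e)) = (\<Sum>e\<in>F. r t e *s e)"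
      using F(2) l(2) pullback_section[OF \<phi> \<psi>] by (intro sum.cong) auto
    then show "restrict_form \<phi> (\<kappa> t) = 0"
      unfolding \<kappa>_def restrict_form_hom restrict_form_sum expand[OF that] by simp
  qed
  define s where "s e = (\<Sum>t\<in>T. g t * pullback \<psi> (r t e))" for e
  have "pullback \<phi> (s e) = 0" for e
  proof -
    have "pullback \<phi> (s e) = (\<Sum>t\<in>T. form.representation E (pullback \<phi> (g t) *s restrict_form \<phi> (m t)) e)"
      unfolding s_def using span by (simp add: pullback_section[OF \<phi> \<psi>] form.representation_scale[OF E(1)] r_def)
    also have "\<dots> = form.representation E (\<Sum>t\<in>T. pullback \<phi> (g t) *s restrict_form \<phi> (m t)) e"
      using span by (subst form.representation_sum[OF E(1)]) (auto intro: form.span_scale)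
    also have "(\<Sum>t\<in>T. pullback \<phi> (g t) *s restrict_form \<phi> (m t)) = 0"
      using zero by (simp add: restrict_form_sum restrict_form_hom)
    finally show ?thesis by (simp add: form.representation_zero)
  qed
  then have s: "s e *s l e \<in> ?W" if "e \<in> F" for e
  proof -
    have "s e *s l e \<in> form.adjoin (lin_polys y c) (log_numerators A) {0}"
      using l(1) F(2) that \<open>pullback \<phi> (s e) = 0\<close>
      by (intro form.scale_ideal_gen_in_adjoin in_ideal_gen_if_pullback_eq_0[OF \<phi> \<psi>] subspace_log_numerators) auto
    then show ?thesis
      using form.adjoin_mono[OF order_refl, of "{0}" small_conormal_forms] form.subspace_0[OF subspace_small_conormal_forms] by blast
  qed
  have "(\<Sum>t\<in>T. g t *s m t) = (\<Sum>t\<in>T. g t *s \<kappa> t) + (\<Sum>t\<in>T. \<Sum>e\<in>F. (g t * pullback \<psi> (r t e)) *s l e)"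
    unfolding \<kappa>_def form.scale_right_diff_distrib form.scale_sum_right form.scale_scale sum_subtractf by simp
  also have "(\<Sum>t\<in>T. \<Sum>e\<in>F. (g t * pullback \<psi> (r t e)) *s l e) = (\<Sum>e\<in>F. s e *s l e)"
    unfolding s_def form.scale_sum_left by (rule sum.swap)
  also have "(\<Sum>t\<in>T. g t *s \<kappa> t) + (\<Sum>e\<in>F. s e *s l e) \<in> ?W"
  proof (intro form.subspace_add form.subspace_sum W s)
    fix t assume t: "t \<in> T"
    show "g t *s \<kappa> t \<in> ?W"
      by (rule form.adjoin_scale[OF _ _ \<kappa>[OF t]])
        (auto intro: form.subspace_scale subspace_log_numerators scale_conormal_small T(3)[OF t])
  qed
  finally show ?thesis .
qed

text \<open>
  Essentiality writes \<open>dy\<close> as a combination of the \<open>\<alpha> (d\<alpha> / \<alpha>)\<close>, hence as an element of the maximal ideal times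
  the logarithmic forms, whereas freeness of the restriction would make \<open>dy\<close> part of a basis.
\<close>

lemma restriction_not_free: False
proof -
  let ?T = "alpha_coeff ` A"
  have "y 0 \<in> vec.span ?T"
  proof (rule span_eq_UNIV_if_orthogonal_trivial)
    fix u assume u: "\<And>a. a \<in> ?T \<Longrightarrow> dot a u = 0"
    have "u \<in> L" if "L \<in> A" for L
      using u[of "alpha_coeff L"] that by (subst hyperplane_kernel_of_alpha(1)[OF A(2)[OF that]]) simp
    then show "u = 0" using ess by blast
  qed
  then obtain r where r: "y 0 = (\<Sum>a\<in>?T. r a *s a)" using vec.span_finite[of ?T] A(1) by auto
  have "\<forall>a\<in>?T. \<exists>L\<in>A. alpha_coeff L = a" by blast
  then obtain H where H: "\<And>a. a \<in> ?T \<Longrightarrow> H a \<in> A" "\<And>a. a \<in> ?T \<Longrightarrow> alpha_coeff (H a) = a" by metis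
  \<comment> \<open>The numerator of \<open>d\<alpha> / \<alpha>\<close> over the common
    denominator: the factor of \<open>H a\<close> is cancelled from the defining polynomial.\<close>
  define \<theta> where "\<theta> a = (\<Prod>L\<in>A - {H a}. alpha L) *s const_form a" for a
  have \<theta>: "\<theta> a \<in> log_numerators A" if a: "a \<in> ?T" for a
    unfolding log_numerators_def
  proof (intro CollectI ballI)
    fix L v assume L: "L \<in> A" "v \<in> L"
    show "alpha L dvd pairing (\<theta> a) v"
    proof (cases "L = H a")
      case True
      have "dot (alpha_coeff L) v = 0" using L(2) hyperplane_kernel_of_alpha(1)[OF A(2)[OF L(1)]] by blast
      then have "dot a v = 0" using H(2)[OF a] True by simp
      then show ?thesis by (simp add: \<theta>_def)
    next
      case False
      then have "alpha L dvd (\<Prod>L\<in>A - {H a}. alpha L)" using A(1) L by (intro dvd_prodI) auto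
      then show ?thesis by (simp add: \<theta>_def)
    qed
  qed
  have lin: "lin_poly a *s \<theta> a = Qpoly A *s const_form a" if a: "a \<in> ?T" for a
  proof -
    have "Qpoly A = lin_poly a * (\<Prod>L\<in>A - {H a}. alpha L)"
      unfolding Qpoly_def using A(1) H[OF a] by (subst prod.remove[of A "H a"]) (auto simp: alpha_eq_lin_poly)
    then show ?thesis by (simp add: \<theta>_def)
  qed
  have "(\<Sum>a\<in>?T. (const_poly (r a) * lin_poly a) *s \<theta> a) = (\<Sum>a\<in>?T. (const_poly (r a) * Qpoly A) *s const_form a)"
    unfolding form.scale_scale[symmetric] using lin by (intro sum.cong) auto
  also have "\<dots> = Qpoly A *s const_form (y 0)"
    by (rule form_eqI) (simp add: pairing_sum r dot_sum_left const_poly_sum const_poly_mult sum_distrib_left mult_ac)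
  finally have eq: "(\<Sum>a\<in>?T. (const_poly (r a) * lin_poly a) *s \<theta> a) = Qpoly A *s const_form (y 0)" .
  have "dot (y 0) (\<phi> v) = 0" for v
  proof -
    have "pullback_coeff \<phi> (y 0) = 0" using y\<phi>[OF c] by simp
    then show ?thesis by (metis dot_pullback_coeff[OF \<phi>] dot_simps(7))
  qed
  then have "restrict_form \<phi> (Qpoly A *s const_form (y 0)) = 0"
    by (intro form_eqI) (simp add: pairing_restrict_form[OF \<phi>])
  then have "Qpoly A *s const_form (y 0) \<in> form.adjoin (lin_polys y c) (log_numerators A) small_conormal_forms"
    unfolding eq[symmetric] using A(1) \<theta> by (intro small_if_restriction_zero) (auto simp: poly_subst_mult)
  then show False using not_in_small by simp
qed

end

section \<open>The resolution of the restricted module\<close>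

definition prod_scale :: "('a \<Rightarrow> 'b \<Rightarrow> 'b) \<Rightarrow> ('a \<Rightarrow> 'c \<Rightarrow> 'c) \<Rightarrow> 'a \<Rightarrow> 'b \<times> 'c \<Rightarrow> 'b \<times> 'c" where
  "prod_scale s t r x = (s r (fst x), t r (snd x))"

lemma prod_scale_simps [simp]: "prod_scale s t r (x, u) = (s r x, t r u)" "fst (prod_scale s t r z) = s r (fst z)"
  "snd (prod_scale s t r z) = t r (snd z)"
  by (simp_all add: prod_scale_def)

lemma ring_module_prod_scale:
  assumes "ring_module s" "ring_module t"
  shows "ring_module (prod_scale s t)"
proof -
  interpret s: ring_module s by fact
  interpret t: ring_module t by fact
  show ?thesis
    by unfold_locales (simp_all add: prod_eq_iff s.scale_left_distrib s.scale_right_distrib t.scale_left_distrib t.scale_right_distrib)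
qed

interpretation free: ring_module "fscale :: 'a::comm_ring_1 \<Rightarrow> ('u \<Rightarrow>\<^sub>0 'a) \<Rightarrow> _"
  by (rule ring_module_fscale)

text \<open>All terms of the complex have to share one type, so the resolution, the coefficients of
  the dy_b and the forms each occupy a factor of a product.\<close>

abbreviation cone_scale :: "'a::comm_ring_1 \<Rightarrow> (('u \<Rightarrow>\<^sub>0 'a) \<times> (nat \<Rightarrow>\<^sub>0 'a)) \<times> ('a ^ 'n) \<Rightarrow> (('u \<Rightarrow>\<^sub>0 'a) \<times> (nat \<Rightarrow>\<^sub>0 'a)) \<times> ('a ^ 'n)" where
  "cone_scale \<equiv> prod_scale (prod_scale fscale fscale) (*s)"

interpretation cone: ring_module "cone_scale :: 'a::comm_ring_1 \<Rightarrow> (('u \<Rightarrow>\<^sub>0 'a) \<times> (nat \<Rightarrow>\<^sub>0 'a)) \<times> ('a ^ 'n) \<Rightarrow> _"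
  by (intro ring_module_prod_scale ring_module_fscale ring_module_vec)

lemma (in ring_module) hom_adjoin:
  assumes f: "hom_on scale A scale A' f" and A: "subspace A" and B: "B \<subseteq> A" "f ` B \<subseteq> B'" and x: "x \<in> adjoin gs A B"
  shows "f x \<in> adjoin gs A' B'"
  using x
proof (induction gs arbitrary: x)
  case (Cons g gs)
  then obtain a b where a: "a \<in> A" and b: "b \<in> adjoin gs A B" and x: "x = scale g a + b" by (auto elim: add_multiplesE)
  have "b \<in> A" using adjoin_subset[OF A B(1)] b by blast
  then have eq: "f x = scale g (f a) + f b"
    using a by (simp add: x hom_onD(2,3)[OF f] subspace_scale[OF A])
  show ?case unfolding eq adjoin_simps by (rule add_multiplesI[OF hom_onD(1)[OF f a] Cons.IH[OF b]])
qed (use B in auto)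

text \<open>The coordinates of the splitting \<open>i\<close> are the functionals, the images of the
  basis under \<open>r\<close> the vectors; finite support of \<open>i x\<close> makes the list
  finite.\<close>

lemma projective_has_dual_bases:
  fixes P :: "('u \<Rightarrow>\<^sub>0 'a::comm_ring_1) set"
  assumes "projective_mod fscale P"
  shows "free.has_dual_bases P"
  unfolding free.has_dual_bases_def
proof
  fix x assume x: "x \<in> P"
  obtain i :: "('u \<Rightarrow>\<^sub>0 'a) \<Rightarrow> (('u \<Rightarrow>\<^sub>0 'a) \<Rightarrow>\<^sub>0 'a)" and r where i: "hom_on fscale P fscale UNIV i" and r: "hom_on fscale UNIV fscale P r" and ri: "\<And>x. x \<in> P \<Longrightarrow> r (i x) = x"
    using assms unfolding projective_mod_def by blast
  obtain us where us: "set us = Poly_Mapping.keys (i x)" "distinct us" using finite_distinct_list[OF finite_keys, of "i x"] by blast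
  let ?ts = "map (\<lambda>u. (\<lambda>z. Poly_Mapping.lookup (i z) u, r (Poly_Mapping.single u 1))) us"
  have "x = r (i x)" using ri x by simp
  also have "i x = (\<Sum>u\<in>set us. fscale (Poly_Mapping.lookup (i x) u) (Poly_Mapping.single u 1))"
    unfolding us(1) by (rule poly_mapping_eqI) (auto simp: lookup_sum lookup_single when_def in_keys_iff if_distrib[of "\<lambda>x. _ * x"] cong: if_cong)
  also have "r \<dots> = (\<Sum>u\<in>set us. r (fscale (Poly_Mapping.lookup (i x) u) (Poly_Mapping.single u 1)))"
    by (rule hom_on_sum[OF module_fscale module_fscale _ r]) auto
  also have "\<dots> = (\<Sum>u\<in>set us. fscale (Poly_Mapping.lookup (i x) u) (r (Poly_Mapping.single u 1)))"
    using hom_onD(3)[OF r] by simp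
  also have "\<dots> = (\<Sum>(l, a)\<leftarrow>?ts. fscale (l x) a)"
    using us(2) by (simp add: sum_list_distinct_conv_sum_set[symmetric] o_def)
  finally have "x = (\<Sum>(l, a)\<leftarrow>?ts. fscale (l x) a)" .
  moreover have "hom_on fscale P (*) UNIV l \<and> a \<in> P" if "(l, a) \<in> set ?ts" for l a
    using that hom_onD(2,3)[OF i] hom_onD(1)[OF r] by (auto simp: hom_on_def lookup_add)
  ultimately show "\<exists>ts. (\<forall>(l, a)\<in>set ts. hom_on fscale P (*) UNIV l \<and> a \<in> P) \<and> x = (\<Sum>(l, a)\<leftarrow>ts. fscale (l x) a)"
    by (intro exI[of _ ?ts]) blast
qed

definition cone_part :: "nat \<Rightarrow> nat \<Rightarrow> (nat \<Rightarrow>\<^sub>0 'a::zero) set" where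
  "cone_part c j = (if j = 1 then {u. \<forall>b\<ge>c. Poly_Mapping.lookup u b = 0} else {0})"

lemma subspace_cone_part: "free.subspace (cone_part c j)"
  by (rule free.subspaceI) (auto simp: cone_part_def lookup_add intro: poly_mapping_eqI)

lemma cone_part_eq_sum:
  assumes "u \<in> cone_part c j"
  shows "u = (\<Sum>b<c. fscale (Poly_Mapping.lookup u b) (Poly_Mapping.single b 1))"
proof (rule poly_mapping_eqI)
  fix b
  show "Poly_Mapping.lookup u b = Poly_Mapping.lookup (\<Sum>b<c. fscale (Poly_Mapping.lookup u b) (Poly_Mapping.single b 1)) b"
    using assms by (auto simp: lookup_sum lookup_single when_def cone_part_def if_distrib[of "\<lambda>x. _ * x"] split: if_splits cong: if_cong)
qed

lemma cone_has_dual_bases: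
  fixes P :: "('u \<Rightarrow>\<^sub>0 'a::comm_ring_1) set"
  assumes P: "free.subspace P" "free.has_dual_bases P"
  shows "cone.has_dual_bases ((P \<times> cone_part c j) \<times> {0 :: 'a ^ 'n})"
  unfolding cone.has_dual_bases_def
proof
  let ?M = "(P \<times> (cone_part c j :: (nat \<Rightarrow>\<^sub>0 'a) set)) \<times> {0 :: 'a ^ 'n}"
  fix z assume "z \<in> ?M"
  then obtain x u where z: "z = ((x, u), 0)" and x: "x \<in> P" and u: "u \<in> cone_part c j" by auto
  obtain ts where ts: "\<And>l a. (l, a) \<in> set ts \<Longrightarrow> hom_on fscale P (*) UNIV l \<and> a \<in> P"
    and x_eq: "x = (\<Sum>(l, a)\<leftarrow>ts. fscale (l x) a)"
    using P(2) x unfolding free.has_dual_bases_def by blast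
  define ts1 :: "(((('u \<Rightarrow>\<^sub>0 'a) \<times> (nat \<Rightarrow>\<^sub>0 'a)) \<times> ('a ^ 'n) \<Rightarrow> 'a) \<times> (('u \<Rightarrow>\<^sub>0 'a) \<times> (nat \<Rightarrow>\<^sub>0 'a)) \<times> ('a ^ 'n)) list"
    where "ts1 = map (\<lambda>(l, a). (\<lambda>z. l (fst (fst z)), ((a, 0), 0))) ts"
  define ts2 :: "(((('u \<Rightarrow>\<^sub>0 'a) \<times> (nat \<Rightarrow>\<^sub>0 'a)) \<times> ('a ^ 'n) \<Rightarrow> 'a) \<times> (('u \<Rightarrow>\<^sub>0 'a) \<times> (nat \<Rightarrow>\<^sub>0 'a)) \<times> ('a ^ 'n)) list"
    where "ts2 = (if j = 1 then map (\<lambda>b. (\<lambda>z. Poly_Mapping.lookup (snd (fst z)) b, ((0, Poly_Mapping.single b 1), 0))) [0..<c] else [])"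
  have "(\<Sum>(l, a)\<leftarrow>map (\<lambda>(l, a). (\<lambda>z. l (fst (fst z)), ((a, 0 :: nat \<Rightarrow>\<^sub>0 'a), 0 :: 'a ^ 'n))) ts'. cone_scale (l z) a) =
      ((\<Sum>(l, a)\<leftarrow>ts'. fscale (l x) a, 0), 0)" for ts'
    by (induction ts') (auto simp: z zero_prod_def)
  then have 1: "(\<Sum>(l, a)\<leftarrow>ts1. cone_scale (l z) a) = ((x, 0), 0)" unfolding ts1_def by (rule trans) (simp only: x_eq[symmetric])
  have "(\<Sum>b\<leftarrow>bs. ((0, fscale (Poly_Mapping.lookup u b) (Poly_Mapping.single b 1)), 0)) =
      ((0 :: 'u \<Rightarrow>\<^sub>0 'a, \<Sum>b\<leftarrow>bs. fscale (Poly_Mapping.lookup u b) (Poly_Mapping.single b 1)), 0 :: 'a ^ 'n)" for bs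
    by (induction bs) (auto simp: zero_prod_def)
  then have 2: "(\<Sum>(l, a)\<leftarrow>ts2. cone_scale (l z) a) = ((0, u), 0)"
    using u cone_part_eq_sum[OF u]
    by (auto simp: ts2_def z o_def cone_part_def zero_prod_def interv_sum_list_conv_sum_set_nat atLeast0LessThan split: if_splits)
  have "z = (\<Sum>(l, a)\<leftarrow>ts1 @ ts2. cone_scale (l z) a)"
    by (simp add: 1 2) (simp add: z)
  moreover have "hom_on cone_scale ?M (*) UNIV l \<and> a \<in> ?M" if la: "(l, a) \<in> set (ts1 @ ts2)" for l a
  proof -
    consider "(l, a) \<in> set ts1" | "(l, a) \<in> set ts2" using la by auto
    then show ?thesis
    proof cases
      case 1
      then obtain l' a' where l': "(l', a') \<in> set ts" "l = (\<lambda>z. l' (fst (fst z)))" "a = ((a', 0), 0)"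
        unfolding ts1_def by auto
      have "(0 :: nat \<Rightarrow>\<^sub>0 'a) \<in> cone_part c j" using free.subspace_0[OF subspace_cone_part] .
      then show ?thesis using ts[OF l'(1)] by (auto simp: l'(2,3) hom_on_def)
    next
      case 2
      then show ?thesis using free.subspace_0[OF P(1)]
        by (auto simp: ts2_def hom_on_def lookup_add cone_part_def lookup_single when_def split: if_splits)
    qed
  qed
  ultimately show "\<exists>ts. (\<forall>(l, a)\<in>set ts. hom_on cone_scale ?M (*) UNIV l \<and> a \<in> ?M) \<and> z = (\<Sum>(l, a)\<leftarrow>ts. cone_scale (l z) a)"
    by (intro exI[of _ "ts1 @ ts2"]) blast
qed

lemma (in ring_module) subspace_Times:
  assumes "ring_module t" "subspace A" "module.subspace t B"
  shows "module.subspace (prod_scale scale t) (A \<times> B)"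
proof -
  interpret t: ring_module t by fact
  interpret p: ring_module "prod_scale scale t" by (intro ring_module_prod_scale assms ring_module_axioms)
  show ?thesis
    by (rule p.subspaceI)
      (use assms in \<open>auto simp: zero_prod_def subspace_0 t.subspace_0 subspace_add t.subspace_add subspace_scale t.subspace_scale\<close>)
qed

lemma adjoin_zero_Times: "cone.adjoin gs ({0} \<times> M) ({0} \<times> D) = {0} \<times> form.adjoin gs M D"
proof -
  have img: "{0} \<times> S = (\<lambda>f. (0, f)) ` S" for S by auto
  show ?thesis unfolding img by (rule cone.adjoin_image[OF _ _ ring_module_vec]) (auto simp: zero_prod_def)
qed

text \<open>
  The resolution with the free module \<open>cone_part\<close> on the \<open>dy b\<close> added next to \<open>P 1\<close>, so that it resolves the quotient
  by the \<open>dy b\<close>. Position \<open>0\<close> is zero, position \<open>1\<close> carries the resolved module, position \<open>j + 2\<close> carries \<open>P j\<close>.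
\<close>

definition cone_mods :: "(nat \<Rightarrow> ('u \<Rightarrow>\<^sub>0 'a) set) \<Rightarrow> nat \<Rightarrow> ('a ^ 'n) set \<Rightarrow> nat \<Rightarrow>
    ((('u \<Rightarrow>\<^sub>0 'a::comm_ring_1) \<times> (nat \<Rightarrow>\<^sub>0 'a)) \<times> ('a ^ 'n)) set" where
  "cone_mods P c M i = (case i of 0 \<Rightarrow> {0} | Suc i' \<Rightarrow>
     (case i' of 0 \<Rightarrow> {0} \<times> M | Suc j \<Rightarrow> (P j \<times> cone_part c j) \<times> {0}))"

text \<open>Position 1 is divided by a submodule \<open>D\<close> of its own rather than by the
  multiples of \<open>gs\<close>. It is the module of conormal forms in one application and the
  kernel of the restriction in the other.\<close>

definition cone_rels :: "(nat \<Rightarrow> ('u \<Rightarrow>\<^sub>0 'a) set) \<Rightarrow> nat \<Rightarrow> ('a ^ 'n) set \<Rightarrow> 'a list \<Rightarrow> nat \<Rightarrow>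
    ((('u \<Rightarrow>\<^sub>0 'a::comm_ring_1) \<times> (nat \<Rightarrow>\<^sub>0 'a)) \<times> ('a ^ 'n)) set" where
  "cone_rels P c D gs i = (case i of 0 \<Rightarrow> {0} | Suc i' \<Rightarrow>
     (case i' of 0 \<Rightarrow> {0} \<times> D | Suc j \<Rightarrow> cone.adjoin gs ((P j \<times> cone_part c j) \<times> {0}) {0}))"

text \<open>The augmented mapping cone of \<open>\<epsilon>\<close>, a lift to \<open>P 0\<close> of
  the inclusion of the conormal forms into \<open>M\<close>.\<close>

definition cone_diff :: "(nat \<Rightarrow> ('u \<Rightarrow>\<^sub>0 'a) \<Rightarrow> 'u \<Rightarrow>\<^sub>0 'a) \<Rightarrow> (('u \<Rightarrow>\<^sub>0 'a) \<Rightarrow> 'a ^ 'n) \<Rightarrow> ((nat \<Rightarrow>\<^sub>0 'a) \<Rightarrow> 'u \<Rightarrow>\<^sub>0 'a) \<Rightarrow>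
    nat \<Rightarrow> (('u \<Rightarrow>\<^sub>0 'a::comm_ring_1) \<times> (nat \<Rightarrow>\<^sub>0 'a)) \<times> ('a ^ 'n) \<Rightarrow> (('u \<Rightarrow>\<^sub>0 'a) \<times> (nat \<Rightarrow>\<^sub>0 'a)) \<times> ('a ^ 'n)" where
  "cone_diff d e \<epsilon> i x = (case i of 0 \<Rightarrow> 0 | Suc i' \<Rightarrow>
     (case i' of 0 \<Rightarrow> (0, e (fst (fst x))) | Suc j \<Rightarrow> ((d j (fst (fst x)) + \<epsilon> (snd (fst x)), 0), 0)))"

lemma cone_simps [simp]:
  "cone_mods P c M 0 = {0}" "cone_mods P c M (Suc 0) = {0} \<times> M"
  "cone_mods P c M (Suc (Suc j)) = (P j \<times> cone_part c j) \<times> {0}"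
  "cone_rels P c D gs 0 = {0}" "cone_rels P c D gs (Suc 0) = {0} \<times> D"
  "cone_rels P c D gs (Suc (Suc j)) = cone.adjoin gs ((P j \<times> cone_part c j) \<times> {0}) {0}"
  "cone_diff d e \<epsilon> 0 x = 0" "cone_diff d e \<epsilon> (Suc 0) x = (0, e (fst (fst x)))"
  "cone_diff d e \<epsilon> (Suc (Suc j)) x = ((d j (fst (fst x)) + \<epsilon> (snd (fst x)), 0), 0)"
  by (simp_all add: cone_mods_def cone_rels_def cone_diff_def)

lemma (in ring_module) adjoin_subset_if_multiples:
  assumes "subspace D" "B \<subseteq> D" "\<And>g m. g \<in> set gs \<Longrightarrow> m \<in> M \<Longrightarrow> scale g m \<in> D"
  shows "adjoin gs M B \<subseteq> D"
  using assms(3)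
proof (induction gs)
  case (Cons g gs)
  then have "adjoin gs M B \<subseteq> D" by simp
  then show ?case using Cons.prems by (auto elim!: add_multiplesE intro!: subspace_add[OF assms(1)])
qed (use assms in simp)

lemma hom_on_mono_target: "hom_on s M t N f \<Longrightarrow> N \<subseteq> N' \<Longrightarrow> hom_on s M t N' f"
  by (auto simp: hom_on_def)

lemma subspace_cone_Times:
  fixes P :: "('u \<Rightarrow>\<^sub>0 'a::comm_ring_1) set"
  assumes "free.subspace P"
  shows "cone.subspace ((P \<times> cone_part c j) \<times> {0 :: 'a ^ 'n})"
  by (intro ring_module.subspace_Times ring_module_prod_scale ring_module_fscale ring_module_vec assms subspace_cone_part form.subspace_single_0)

lemma subspace_zero_Times: "form.subspace D \<Longrightarrow> cone.subspace ({0} \<times> D)"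
  using ring_module.subspace_Times[OF ring_module_prod_scale[OF ring_module_fscale ring_module_fscale] ring_module_vec]
    ring_module.axioms(1)[OF ring_module_prod_scale[OF ring_module_fscale ring_module_fscale], THEN module.subspace_single_0] by blast

lemma zero_eq_Times: "{0} = ({0} \<times> {0} :: (('u \<Rightarrow>\<^sub>0 'a::comm_ring_1) \<times> (nat \<Rightarrow>\<^sub>0 'a)) set) \<times> ({0} :: ('a ^ 'n) set)"
  "{0} = ({0} :: (('u \<Rightarrow>\<^sub>0 'a::comm_ring_1) \<times> (nat \<Rightarrow>\<^sub>0 'a)) set) \<times> ({0} :: ('a ^ 'n) set)"
  by (auto simp: zero_prod_def)

context
  fixes P :: "nat \<Rightarrow> ('u \<Rightarrow>\<^sub>0 'a::comm_ring_1) set" and M :: "('a ^ 'n) set" and d e \<epsilon> and c :: nat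
  assumes P: "\<And>j. free.subspace (P j)" and M: "form.subspace M"
    and d: "\<And>j. hom_on fscale (P (Suc j)) fscale (P j) (d j)" "\<And>j x. x \<in> P (Suc (Suc j)) \<Longrightarrow> d j (d (Suc j) x) = 0"
    and e: "hom_on fscale (P 0) (*s) M e" "\<And>x. x \<in> P (Suc 0) \<Longrightarrow> e (d 0 x) = 0"
    and \<epsilon>: "hom_on fscale (cone_part c (Suc 0)) fscale (P 0) \<epsilon>"
begin

lemma \<epsilon>_0: "\<epsilon> 0 = 0"
  by (rule hom_on_zero[OF module_fscale module_fscale subspace_cone_part \<epsilon>])

lemma \<epsilon>_hom: "hom_on fscale (cone_part c (Suc j)) fscale (P j) \<epsilon>"
proof (cases j)
  case (Suc i)
  then show ?thesis using \<epsilon>_0 free.subspace_0[OF P] by (auto simp: hom_on_def cone_part_def)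
qed (use \<epsilon> in simp)

lemma subspace_cone: "cone.subspace ((P j \<times> cone_part c j) \<times> {0 :: 'a ^ 'n})"
  by (rule subspace_cone_Times[OF P])

text \<open>The module at position 1 may be larger than the target of \<open>e\<close>: forms on X
  will enter through all forms with logarithmic restriction, of which \<open>e\<close> reaches only
  the logarithmic ones.\<close>

lemma complex_cone:
  assumes M': "form.subspace M'" "M \<subseteq> M'" and D: "form.subspace D" "D \<subseteq> M'"
    and \<epsilon>D: "\<And>u. u \<in> cone_part c (Suc 0) \<Longrightarrow> e (\<epsilon> u) \<in> D"
    and gsD: "\<And>g m. g \<in> set gs \<Longrightarrow> m \<in> M \<Longrightarrow> g *s m \<in> D"
  shows "cone.complex_on (cone_mods P c M') (cone_rels P c D gs) (cone_diff d e \<epsilon>)"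
proof -
  have hom1: "hom_on cone_scale ((P 0 \<times> cone_part c 0) \<times> {0}) cone_scale ({0} \<times> M) (cone_diff d e \<epsilon> (Suc 0))"
    using hom_onD[OF e(1)] by (auto simp: hom_on_def zero_prod_def)
  have hom2: "hom_on cone_scale (cone_mods P c M' (Suc (Suc (Suc j)))) cone_scale (cone_mods P c M' (Suc (Suc j))) (cone_diff d e \<epsilon> (Suc (Suc j)))" for j
    using hom_onD[OF d(1)[of j]] hom_onD[OF \<epsilon>_hom[of j]] free.subspace_0[OF subspace_cone_part]
    by (auto simp: hom_on_def zero_prod_def free.subspace_add[OF P] free.scale_right_distrib algebra_simps)
  show ?thesis unfolding cone.complex_on_def
  proof (intro allI)
    fix i
    consider "i = 0" | "i = Suc 0" | j where "i = Suc (Suc j)" by (metis not0_implies_Suc)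
    then show "cone.subspace (cone_mods P c M' i) \<and> cone.subspace (cone_rels P c D gs i) \<and> cone_rels P c D gs i \<subseteq> cone_mods P c M' i \<and>
         hom_on cone_scale (cone_mods P c M' (Suc i)) cone_scale (cone_mods P c M' i) (cone_diff d e \<epsilon> i) \<and>
         cone_diff d e \<epsilon> i ` cone_rels P c D gs (Suc i) \<subseteq> cone_rels P c D gs i \<and>
         (\<forall>x\<in>cone_mods P c M' (Suc (Suc i)). cone_diff d e \<epsilon> i (cone_diff d e \<epsilon> (Suc i) x) \<in> cone_rels P c D gs i)"
    proof cases
      case 1
      then show ?thesis by (auto simp: hom_on_def cone.subspace_single_0)
    next
      case i: 2
      have "cone_diff d e \<epsilon> (Suc 0) x \<in> {0} \<times> D" if "x \<in> cone.adjoin gs ((P 0 \<times> cone_part c 0) \<times> {0}) {0}" for x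
      proof -
        have "cone_diff d e \<epsilon> (Suc 0) 0 = 0"
          using hom_on_zero[OF module_fscale form.module_axioms P e(1)] by (simp add: zero_prod_def)
        then have "cone_diff d e \<epsilon> (Suc 0) x \<in> cone.adjoin gs ({0} \<times> M) {0}"
          using cone.subspace_0[OF subspace_cone] by (intro cone.hom_adjoin[OF hom1 subspace_cone _ _ that]) auto
        also have "\<dots> = {0} \<times> form.adjoin gs M {0}" unfolding zero_eq_Times(2) adjoin_zero_Times ..
        also have "\<dots> \<subseteq> {0} \<times> D"
          using form.adjoin_subset_if_multiples[OF D(1), of "{0}" gs M] gsD form.subspace_0[OF D(1)] by blast
        finally show ?thesis .
      qed
      moreover have "cone_diff d e \<epsilon> (Suc 0) (cone_diff d e \<epsilon> (Suc (Suc 0)) x) \<in> {0} \<times> D"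
        if x: "x \<in> cone_mods P c M' (Suc (Suc (Suc 0)))" for x
      proof -
        obtain z u where z: "x = ((z, u), 0)" "z \<in> P (Suc 0)" "u \<in> cone_part c (Suc 0)" using x by auto
        have "e (d 0 z + \<epsilon> u) = e (d 0 z) + e (\<epsilon> u)"
          using z hom_onD(1)[OF d(1)] hom_onD(1)[OF \<epsilon>] by (intro hom_onD(2)[OF e(1)]) auto
        then show ?thesis using e(2) \<epsilon>D z by simp
      qed
      moreover have "hom_on cone_scale ((P 0 \<times> cone_part c 0) \<times> {0}) cone_scale ({0} \<times> M') (cone_diff d e \<epsilon> (Suc 0))"
        by (rule hom_on_mono_target[OF hom1]) (use M'(2) in auto)
      ultimately show ?thesis unfolding i cone_simps(2,3,5,6)
        using M' D subspace_zero_Times by blast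
    next
      case i: (3 j)
      have zero: "cone_diff d e \<epsilon> (Suc (Suc j)) 0 = 0"
        using hom_on_zero[OF module_fscale module_fscale P d(1)] \<epsilon>_0 by (simp add: zero_prod_def)
      have "cone_diff d e \<epsilon> (Suc (Suc j)) x \<in> cone_rels P c D gs (Suc (Suc j))" if "x \<in> cone_rels P c D gs (Suc (Suc (Suc j)))" for x
        unfolding cone_simps(6)
        by (rule cone.hom_adjoin[OF hom2[of j, unfolded cone_simps(3)] subspace_cone _ _ that[unfolded cone_simps(6)]])
          (use zero cone.subspace_0[OF subspace_cone[of "Suc j"]] in auto)
      then have img: "cone_diff d e \<epsilon> i ` cone_rels P c D gs (Suc i) \<subseteq> cone_rels P c D gs i"
        unfolding i by blast
      have comp: "cone_diff d e \<epsilon> i (cone_diff d e \<epsilon> (Suc i) x) = 0" if "x \<in> cone_mods P c M' (Suc (Suc i))" for x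
        using that d(2) \<epsilon>_0 unfolding i by (auto simp: cone_part_def zero_prod_def)
      have sub: "cone.subspace (cone_mods P c M' i)" "cone.subspace (cone_rels P c D gs i)" "cone_rels P c D gs i \<subseteq> cone_mods P c M' i"
        unfolding i cone_simps using cone.subspace_0[OF subspace_cone[of j]]
        by (intro subspace_cone cone.subspace_adjoin cone.subspace_single_0 cone.adjoin_subset; simp)+
      show ?thesis
      proof (intro conjI ballI)
        fix x assume "x \<in> cone_mods P c M' (Suc (Suc i))"
        then show "cone_diff d e \<epsilon> i (cone_diff d e \<epsilon> (Suc i) x) \<in> cone_rels P c D gs i"
          using cone.subspace_0[OF sub(2)] by (simp only: comp)
      qed (use img sub hom2[of j] in \<open>simp_all only: i\<close>)
    qed
  qed
qed

text \<open>The submodule \<open>D\<close> is free on the elements \<open>e (\<epsilon> u)\<close>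
  of a basis, by \<open>inj\<close>. Adding that basis next to \<open>P 1\<close> therefore turns a
  resolution of \<open>M\<close> into one of \<open>M / D\<close>.\<close>

lemma cone_exact:
  assumes D: "form.subspace D" "D \<subseteq> M" "D = (\<lambda>u. e (\<epsilon> u)) ` cone_part c (Suc 0)"
    and inj: "\<And>u. u \<in> cone_part c (Suc 0) \<Longrightarrow> e (\<epsilon> u) = 0 \<Longrightarrow> u = 0"
    and onto: "e ` P 0 = M" and exact_0: "\<And>x. x \<in> P 0 \<Longrightarrow> e x = 0 \<Longrightarrow> x \<in> d 0 ` P (Suc 0)"
    and exact: "\<And>j x. x \<in> P (Suc j) \<Longrightarrow> d j x = 0 \<Longrightarrow> x \<in> d (Suc j) ` P (Suc (Suc j))"
    and x: "x \<in> cone_mods P c M (Suc i)" "cone_diff d e \<epsilon> i x \<in> cone_rels P c D [] i"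
  shows "x \<in> cone.boundaries (cone_mods P c M) (cone_rels P c D []) (cone_diff d e \<epsilon>) (Suc i)"
proof -
  have cx: "cone.complex_on (cone_mods P c M) (cone_rels P c D []) (cone_diff d e \<epsilon>)"
    by (rule complex_cone) (use D M in auto)
  have \<epsilon>_diff: "\<epsilon> u \<in> P 0" if "u \<in> cone_part c (Suc 0)" for u using hom_onD(1)[OF \<epsilon> that] .
  have zero: "(0 :: nat \<Rightarrow>\<^sub>0 'a) \<in> cone_part c j" for j by (rule free.subspace_0[OF subspace_cone_part])
  have "\<exists>z\<in>cone_mods P c M (Suc (Suc i)). x = cone_diff d e \<epsilon> (Suc i) z"
  proof -
    consider "i = 0" | "i = Suc 0" | "i = Suc (Suc 0)" | j where "i = Suc (Suc (Suc j))" by (metis not0_implies_Suc)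
    then show ?thesis
    proof cases
      case 1
      then obtain z where "z \<in> P 0" "x = (0, e z)" using x(1) onto by auto
      then show ?thesis using 1 zero by (intro bexI[of _ "((z, 0), 0)"]) auto
    next
      case 2
      then obtain z where z: "x = ((z, 0), 0)" "z \<in> P 0" using x(1) by (auto simp: cone_part_def)
      then obtain u where u: "u \<in> cone_part c (Suc 0)" "e z = e (\<epsilon> u)" using x(2) 2 D(3) by auto
      have "e (z - \<epsilon> u) = e z - e (\<epsilon> u)"
        using z(2) \<epsilon>_diff[OF u(1)] by (intro hom_on_diff[OF module_fscale form.module_axioms P e(1)])
      then have "z - \<epsilon> u \<in> d 0 ` P (Suc 0)" using z(2) \<epsilon>_diff[OF u(1)] u(2) by (intro exact_0 free.subspace_diff P) auto
      then obtain z' where "z' \<in> P (Suc 0)" "z - \<epsilon> u = d 0 z'" by blast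
      then show ?thesis unfolding 2 z(1) using u(1)
        by (intro bexI[of _ "((z', u), 0)"]) (auto simp: algebra_simps)
    next
      case 3
      then obtain z u where z: "x = ((z, u), 0)" "z \<in> P (Suc 0)" "u \<in> cone_part c (Suc 0)" using x(1) by auto
      have 0: "d 0 z + \<epsilon> u = 0" using x(2) unfolding 3 z(1) by (simp add: zero_prod_def)
      have "e (d 0 z + \<epsilon> u) = e (d 0 z) + e (\<epsilon> u)"
        using z hom_onD(1)[OF d(1)] \<epsilon>_diff by (intro hom_onD(2)[OF e(1)]) auto
      then have "e (\<epsilon> u) = 0" unfolding 0 using e(2) z(2) hom_on_zero[OF module_fscale form.module_axioms P e(1)] by simp
      then have u: "u = 0" by (rule inj[OF z(3)])
      then obtain z' where "z' \<in> P (Suc (Suc 0))" "z = d (Suc 0) z'" using exact[OF z(2)] 0 \<epsilon>_0 by auto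
      then show ?thesis unfolding 3 z(1) u using \<epsilon>_0 zero by (intro bexI[of _ "((z', 0), 0)"]) auto
    next
      case (4 j)
      then obtain z where z: "x = ((z, 0), 0)" "z \<in> P (Suc (Suc j))" using x(1) by (auto simp: cone_part_def)
      have "d (Suc j) z = 0" using x(2) \<epsilon>_0 unfolding 4 z(1) by (simp add: zero_prod_def)
      then obtain z' where "z' \<in> P (Suc (Suc (Suc j)))" "z = d (Suc (Suc j)) z'" using exact[OF z(2)] by auto
      then show ?thesis unfolding 4 z(1) using \<epsilon>_0 zero by (intro bexI[of _ "((z', 0), 0)"]) auto
    qed
  qed
  then show ?thesis using cone.boundary_in_boundaries[OF cx] by auto
qed

end

lemma lin_polys_split:
  assumes "lin_polys y c = hs @ g # gs"
  obtains j where "j < c" "g = lin_poly (y j)" "gs = lin_polys y j"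
  using assms
proof (induction c arbitrary: hs thesis)
  case (Suc c)
  show ?case
  proof (cases hs)
    case Nil
    then show ?thesis using Suc.prems(1)[of c] Suc.prems(2) by simp
  next
    case (Cons h hs')
    then have "lin_polys y c = hs' @ g # gs" using Suc.prems(2) by simp
    from Suc.IH[OF _ this] obtain j where "j < c" "g = lin_poly (y j)" "gs = lin_polys y j" by blast
    then show ?thesis using Suc.prems(1)[of j] by simp
  qed
qed simp

lemma Qpoly_nonzero:
  assumes "finite A" "\<And>L. L \<in> A \<Longrightarrow> hyperplane L"
  shows "Qpoly A \<noteq> 0"
  using assms hyperplane_kernel_of_alpha(2) by (auto simp: Qpoly_def alpha_eq_lin_poly)

section \<open>Comparison of the logarithmic modules on V and on X\<close>

context
  fixes \<phi> :: "'k::field ^ 'm::{finite,linorder} \<Rightarrow> 'k ^ 'n::{finite,linorder}"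
    and A :: "('k ^ 'n::{finite,linorder}) set set" and c p :: nat
    and y v :: "nat \<Rightarrow> 'k ^ 'n::{finite,linorder}"
    and P :: "nat \<Rightarrow> ('u \<Rightarrow>\<^sub>0 ('k, 'n) mpoly) set" and d and e :: "('u \<Rightarrow>\<^sub>0 ('k, 'n) mpoly) \<Rightarrow> ('k, 'n) mpoly ^ 'n::{finite,linorder}"
    and l :: "nat \<Rightarrow> 'u \<Rightarrow>\<^sub>0 ('k, 'n) mpoly"
  assumes \<phi>: "Vector_Spaces.linear (*s) (*s) \<phi>" "inj \<phi>"
    and range: "\<And>u. u \<in> range \<phi> \<longleftrightarrow> (\<forall>b<c. dot (y b) u = 0)"
    and yv: "dual_systems CARD('n) y v" and c: "c + 3 \<le> CARD('n)" and p: "c + p + 2 \<le> CARD('n)"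
    and A: "finite A" "\<And>L. L \<in> A \<Longrightarrow> hyperplane L"
    and flats: "\<And>F. F \<subseteq> A \<Longrightarrow> range \<phi> \<inter> \<Inter>F \<noteq> {0} \<Longrightarrow> \<exists>w. dual_systems c y w \<and> (\<forall>b<c. w b \<in> \<Inter>F)"
    and P: "\<And>j. free.subspace (P j)" "\<And>j. projective_mod fscale (P j)" "\<And>j. j > p \<Longrightarrow> P j = {0}"
    and d: "\<And>j. hom_on fscale (P (Suc j)) fscale (P j) (d j)"
    and e: "hom_on fscale (P 0) (*s) (log_numerators A) e" "e ` P 0 = log_numerators A"
    and exact: "{x \<in> P 0. e x = 0} = d 0 ` P 1" "\<And>j. {x \<in> P (Suc j). d j x = 0} = d (Suc j) ` P (Suc (Suc j))"
    and l: "\<And>b. b < c \<Longrightarrow> l b \<in> P 0 \<and> e (l b) = Qpoly A *s const_form (y b)"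
begin

private abbreviation M where "M \<equiv> log_numerators A"
private abbreviation N where "N \<equiv> log_numerators ((\<lambda>L. \<phi> -` L) ` A)"
private abbreviation D where "D \<equiv> conormal_forms c y (Qpoly A)"
text \<open>The module \<open>N\<close> over the ring of X is presented as the subquotient of
  \<open>M\<^sub>X\<close> by \<open>K\<^sub>X\<close>, a module over the ring of V in the type of
  the complex. By \<open>exists_restriction\<close> every element of \<open>N\<close> is
  reached.\<close>

private abbreviation M\<^sub>X where "M\<^sub>X \<equiv> {f. restrict_form \<phi> f \<in> N}"
private abbreviation K\<^sub>X where "K\<^sub>X \<equiv> {f. restrict_form \<phi> f = 0}"
private abbreviation lift where "lift u \<equiv> \<Sum>b<c. fscale (Poly_Mapping.lookup u b) (l b)"
private abbreviation "gs \<equiv> lin_polys y c"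

lemma dual_c: "dual_systems c y v"
  using yv c by simp

lemma pullback_y: "b < c \<Longrightarrow> pullback \<phi> (lin_poly (y b)) = 0"
proof -
  assume b: "b < c"
  have "pullback_coeff \<phi> (y b) = 0"
    by (rule dot_eq_0_imp) (use range b in \<open>auto simp: dot_pullback_coeff[OF \<phi>(1)]\<close>)
  then show ?thesis by simp
qed

lemma pullback_gs: "g \<in> set gs \<Longrightarrow> pullback \<phi> g = 0"
  using pullback_y by auto

lemma restrict_conormal: "f \<in> D \<Longrightarrow> restrict_form \<phi> f = 0"
proof -
  assume "f \<in> D"
  then obtain g where f: "f = (\<Sum>b<c. (Qpoly A * g b) *s const_form (y b))" unfolding conormal_forms_in_def by auto
  have "dot (y b) (\<phi> u) = 0" if "b < c" for b u using range[of "\<phi> u"] that by simp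
  then have "restrict_form \<phi> (const_form (y b)) = 0" if "b < c" for b
    using that by (intro form_eqI) (simp add: pairing_restrict_form[OF \<phi>(1)])
  then show ?thesis by (simp add: f restrict_form_sum restrict_form_hom)
qed

lemma restrict_M: "f \<in> M \<Longrightarrow> restrict_form \<phi> f \<in> N"
proof (rule restrict_form_log_numerators_general[OF \<phi>(1)])
  show "kernel_of_alpha L" if "L \<in> A" for L by (rule hyperplane_kernel_of_alpha(1)[OF A(2)[OF that]])
  show "kernel_of_alpha L'" if "L' \<in> (\<lambda>L. \<phi> -` L) ` A" for L' by (rule kernel_of_alpha_vimage[OF \<phi>(1) A(2) that])
qed auto

lemma subspaces: "form.subspace M" "form.subspace D" "form.subspace M\<^sub>X" "form.subspace K\<^sub>X" "D \<subseteq> M" "M \<subseteq> M\<^sub>X" "K\<^sub>X \<subseteq> M\<^sub>X"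
proof -
  show "form.subspace M" by (rule subspace_log_numerators)
  show "form.subspace D" by (rule subspace_conormal_forms)
  show "form.subspace M\<^sub>X"
    by (rule form.subspaceI)
      (auto simp: restrict_form_hom intro: form.subspace_0 form.subspace_add form.subspace_scale subspace_log_numerators)
  show "form.subspace K\<^sub>X" by (rule form.subspaceI) (auto simp: restrict_form_hom)
  show "D \<subseteq> M" by (rule conormal_subset_log_numerators[OF A(1)])
  show "M \<subseteq> M\<^sub>X" using restrict_M by blast
  show "K\<^sub>X \<subseteq> M\<^sub>X" using form.subspace_0[OF subspace_log_numerators] by auto
qed

lemma lift_hom: "hom_on fscale (cone_part c (Suc 0)) fscale (P 0) lift"
  unfolding hom_on_def using l
  by (auto simp: lookup_add free.scale_left_distrib sum.distrib free.scale_sum_right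
      intro!: free.subspace_sum free.subspace_scale P(1))

lemma e_lift: "e (lift u) = (\<Sum>b<c. (Qpoly A * Poly_Mapping.lookup u b) *s const_form (y b))"
proof -
  have "e (lift u) = (\<Sum>b<c. e (fscale (Poly_Mapping.lookup u b) (l b)))"
    using l by (intro hom_on_sum[OF module_fscale form.module_axioms P(1) e(1)] free.subspace_scale[OF P(1)]) auto
  also have "\<dots> = (\<Sum>b<c. (Qpoly A * Poly_Mapping.lookup u b) *s const_form (y b))"
    using l hom_onD(3)[OF e(1)] by (intro sum.cong) (auto simp: mult.commute)
  finally show ?thesis .
qed

lemma e_lift_image: "D = (\<lambda>u. e (lift u)) ` cone_part c (Suc 0)"
proof (intro equalityI subsetI)
  fix f assume "f \<in> D"
  then obtain g where f: "f = (\<Sum>b<c. (Qpoly A * g b) *s const_form (y b))" unfolding conormal_forms_in_def by auto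
  define u where "u = (\<Sum>b<c. Poly_Mapping.single b (g b))"
  have u: "Poly_Mapping.lookup u b = (if b < c then g b else 0)" for b
    by (auto simp: u_def lookup_sum lookup_single when_def)
  have "f = e (lift u)" unfolding f e_lift by (simp add: u)
  moreover have "u \<in> cone_part c (Suc 0)" by (simp add: cone_part_def u)
  ultimately show "f \<in> (\<lambda>u. e (lift u)) ` cone_part c (Suc 0)" by blast
next
  fix f assume "f \<in> (\<lambda>u. e (lift u)) ` cone_part c (Suc 0)"
  then obtain u where "f = (\<Sum>b<c. (Qpoly A * Poly_Mapping.lookup u b) *s const_form (y b))" unfolding e_lift by auto
  then show "f \<in> D" using conormal_formsI[of c _ "Qpoly A" "Poly_Mapping.lookup u" y] by simp
qed

lemma e_lift_inj:
  assumes "u \<in> cone_part c (Suc 0)" "e (lift u) = 0"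
  shows "u = 0"
proof (rule poly_mapping_eqI)
  fix b
  show "Poly_Mapping.lookup u b = Poly_Mapping.lookup 0 b"
  proof (cases "b < c")
    case True
    have "Qpoly A * Poly_Mapping.lookup u b = pairing (e (lift u)) (v b)"
      unfolding e_lift by (rule pairing_conormal[OF dual_c True, symmetric])
    then show ?thesis using assms(2) Qpoly_nonzero[OF A] by simp
  next
    case False
    then show ?thesis using assms(1) by (simp add: cone_part_def)
  qed
qed

lemma comp: "x \<in> P (Suc (Suc j)) \<Longrightarrow> d j (d (Suc j) x) = 0" "x \<in> P (Suc 0) \<Longrightarrow> e (d 0 x) = 0"
  using exact(2)[of j] exact(1) by auto

lemma complex_1: "cone.complex_on (cone_mods P c M) (cone_rels P c D []) (cone_diff d e lift)"
proof (rule complex_cone[OF P(1) subspaces(1) d comp(1) e(1) comp(2) lift_hom])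
  show "e (lift u) \<in> D" if "u \<in> cone_part c (Suc 0)" for u using e_lift_image that by blast
qed (simp_all add: subspaces(1,2,5))

lemma complex_2: "cone.complex_on (cone_mods P c M\<^sub>X) (cone_rels P c K\<^sub>X gs) (cone_diff d e lift)"
proof (rule complex_cone[OF P(1) subspaces(1) d comp(1) e(1) comp(2) lift_hom])
  show "e (lift u) \<in> K\<^sub>X" if "u \<in> cone_part c (Suc 0)" for u using e_lift_image that restrict_conormal by blast
  show "g *s m \<in> K\<^sub>X" if "g \<in> set gs" for g m using pullback_gs[OF that] by (simp add: restrict_form_hom)
qed (assumption | rule subspaces)+

lemma regular_projective:
  assumes "j < CARD('n)" "x \<in> (P i \<times> cone_part c i) \<times> {0}"
    and "cone_scale (lin_poly (y j)) x \<in> cone.adjoin (lin_polys y j) ((P i \<times> cone_part c i) \<times> {0}) {0}"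
  shows "x \<in> cone.adjoin (lin_polys y j) ((P i \<times> cone_part c i) \<times> {0}) {0}"
  by (rule cone.regular_if_dual_bases[OF subspace_cone_Times[OF P(1)]
        cone_has_dual_bases[OF P(1) projective_has_dual_bases[OF P(2)]] assms(2,3)])
    (rule lin_poly_regular[OF yv assms(1)])

text \<open>Before division by the \<open>y b\<close> the complex resolves \<open>M / D\<close> and
  is exact. The \<open>y b\<close> are regular on its projective terms, and on \<open>M / D\<close>
  after inverting \<open>h\<close>, so reduction modulo them creates only homology that vanishes
  after inverting \<open>h\<close>.\<close>

lemma torsion_1:
  assumes B: "B \<subseteq> A" "\<And>L b. L \<in> B \<Longrightarrow> b < c \<Longrightarrow> w b \<in> L" and w: "dual_systems c y w"
    and h: "h = (\<Prod>L\<in>A - B. alpha L)"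
  shows "cone.torsion_at h (cone_mods P c M) (\<lambda>i. cone.adjoin gs (cone_mods P c M i) (cone_rels P c D [] i)) (cone_diff d e lift) i"
proof (rule cone.torsion_at_adjoin[OF complex_1])
  show "cone.torsion_at h (cone_mods P c M) (cone_rels P c D []) (cone_diff d e lift) i" for i
    unfolding cone.torsion_at_def
  proof (intro ballI impI)
    fix x assume x: "x \<in> cone_mods P c M (Suc i)" "cone_diff d e lift i x \<in> cone_rels P c D [] i"
    have "x \<in> cone.boundaries (cone_mods P c M) (cone_rels P c D []) (cone_diff d e lift) (Suc i)"
    proof (rule cone_exact[OF P(1) subspaces(1) d comp(1) e(1) comp(2) lift_hom subspaces(2,5) e_lift_image e_lift_inj e(2) _ _ x])
      show "x \<in> d 0 ` P (Suc 0)" if "x \<in> P 0" "e x = 0" for x using exact(1) that by auto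
      show "x \<in> d (Suc j) ` P (Suc (Suc j))" if "x \<in> P (Suc j)" "d j x = 0" for j x using exact(2)[of j] that by auto
    qed auto
    then show "\<exists>s. cone_scale (h ^ s) x \<in> cone.boundaries (cone_mods P c M) (cone_rels P c D []) (cone_diff d e lift) (Suc i)"
      by (intro exI[of _ 0]) (simp add: cone.scale_one)
  qed
next
  fix hs g gs' i x assume "gs = hs @ g # gs'" and x: "x \<in> cone_mods P c M i"
    and gx: "cone_scale g x \<in> cone.adjoin gs' (cone_mods P c M i) (cone_rels P c D [] i)"
  then obtain j where j: "j < c" "g = lin_poly (y j)" "gs' = lin_polys y j" by (metis lin_polys_split)
  consider "i = 0" | "i = Suc 0" | k where "i = Suc (Suc k)" by (metis not0_implies_Suc)
  then show "\<exists>s. cone_scale (h ^ s) x \<in> cone.adjoin gs' (cone_mods P c M i) (cone_rels P c D [] i)"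
  proof cases
    case 1
    then have "x \<in> cone.adjoin gs' (cone_mods P c M i) (cone_rels P c D [] i)"
      using x cone.subspace_0[OF cone.subspace_adjoin[OF cone.subspace_single_0 cone.subspace_single_0]] by auto
    then show ?thesis by (intro exI[of _ 0]) (simp add: cone.scale_one)
  next
    case 2
    then obtain f where f: "x = (0, f)" "f \<in> M" using x by auto
    have "lin_poly (y j) *s f \<in> form.adjoin (lin_polys y j) M D"
      using gx unfolding 2 cone_simps adjoin_zero_Times f j by simp
    then have "h *s f \<in> form.adjoin (lin_polys y j) M D"
      using A B finite_subset[OF B(1) A(1)]
      by (intro regular_mod_conormal_local[OF _ _ B(2) w A(1) B(1) h f(2) j(1)]) auto
    then show ?thesis unfolding 2 cone_simps adjoin_zero_Times f j
      by (intro exI[of _ 1]) (simp add: zero_prod_def)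
  next
    case (3 k)
    have "x \<in> cone.adjoin (lin_polys y j) ((P k \<times> cone_part c k) \<times> {0}) {0}"
      by (rule regular_projective[of j])
        (use j(1) c in simp, use x gx in \<open>simp_all only: 3 cone_simps cone.adjoin_simps j\<close>)
    then have "x \<in> cone.adjoin gs' (cone_mods P c M i) (cone_rels P c D [] i)"
      by (simp only: 3 cone_simps cone.adjoin_simps j)
    then show ?thesis by (intro exI[of _ 0]) (simp add: cone.scale_one)
  qed
qed simp

private abbreviation "mods \<equiv> cone_mods P c M\<^sub>X"
private abbreviation "rels \<equiv> cone_rels P c K\<^sub>X gs"
private abbreviation "diff \<equiv> cone_diff d e lift"

lemma boundaries_1_eq_2:
  "cone.boundaries (cone_mods P c M) (\<lambda>i. cone.adjoin gs (cone_mods P c M i) (cone_rels P c D [] i)) diff (Suc (Suc j)) =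
   cone.boundaries mods rels diff (Suc (Suc j))"
  by (simp add: cone.boundaries_def)

text \<open>Inverting the product leaves the hyperplanes \<open>B\<close> that contain the flat, and
  the flat contains directions \<open>w\<close> transversal to X. At position 1, forms on X extend
  along \<open>w\<close>. At position 2, a form restricting to zero is locally a combination of
  multiples of the \<open>y b\<close> and conormal forms, which leads back to
  \<open>torsion_1\<close>. From position 3 on, the cycles and boundaries are those of
  \<open>torsion_1\<close>.\<close>

lemma torsion_2:
  assumes F: "F \<subseteq> A" "range \<phi> \<inter> \<Inter>F \<noteq> {0}"
  shows "cone.torsion_at (\<Prod>L\<in>{L\<in>A. \<not> \<Inter>F \<subseteq> L}. alpha L) mods rels diff i"
proof -
  define B where "B = {L\<in>A. \<Inter>F \<subseteq> L}"
  define h where "h = (\<Prod>L\<in>A - B. alpha L)"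
  have h_eq: "(\<Prod>L\<in>{L\<in>A. \<not> \<Inter>F \<subseteq> L}. alpha L) = h"
    unfolding h_def B_def by (intro prod.cong) auto
  obtain w where w: "dual_systems c y w" "\<And>b. b < c \<Longrightarrow> w b \<in> \<Inter>F" using flats[OF F] by blast
  have B: "B \<subseteq> A" "\<And>L b. L \<in> B \<Longrightarrow> b < c \<Longrightarrow> w b \<in> L" using w(2) by (auto simp: B_def)
  have hyp: "\<And>L. L \<in> B \<Longrightarrow> hyperplane L" using A(2) B(1) by blast
  obtain \<psi> where \<psi>: "Vector_Spaces.linear (*s) (*s) \<psi>" "\<And>v. \<psi> (\<phi> v) = v"
    "\<And>v. \<phi> (\<psi> v) = v - (\<Sum>b<c. dot (y b) v *s w b)"
    using exists_linear_section[OF \<phi> range w(1)] by blast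
  note torsion = torsion_1[OF B w(1) h_def]
  have zero: "(0 :: nat \<Rightarrow>\<^sub>0 ('k, 'n) mpoly) \<in> cone_part c j" for j by (rule free.subspace_0[OF subspace_cone_part])
  have "\<exists>s. cone_scale (h ^ s) x \<in> cone.boundaries mods rels diff (Suc i)"
    if x: "x \<in> mods (Suc i)" "diff i x \<in> rels i" for x
  proof -
    consider "i = 0" | "i = Suc 0" | j where "i = Suc (Suc j)" by (metis not0_implies_Suc)
    then show ?thesis
    proof cases
      case 1
      obtain f where f: "x = (0, f)" "restrict_form \<phi> f \<in> N" using x(1) unfolding 1 by auto
      define f' where "f' = restrict_form \<psi> (restrict_form \<phi> f)"
      have fB: "restrict_form \<phi> f \<in> log_numerators ((\<lambda>L. \<phi> -` L) ` B)"
        using log_numerators_antimono[OF image_mono[OF B(1)]] f(2) by blast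
      have "f' \<in> log_numerators B" unfolding f'_def
        by (rule restrict_form_section_log_numerators[OF \<phi>(1) \<psi> hyp B(2) fB])
      then have "h *s f' \<in> M" unfolding h_def by (rule scale_log_numerators[OF A(1) B(1)])
      then obtain z where z: "z \<in> P 0" "e z = h *s f'" using e(2) by (metis imageE)
      have "h *s f - h *s f' \<in> K\<^sub>X"
        by (simp add: restrict_form_hom f'_def restrict_form_section[OF \<phi>(1) \<psi>])
      then have "diff (Suc 0) ((z, 0), 0) + (0, h *s f - h *s f') \<in> cone.boundaries mods rels diff (Suc 0)"
        using z(1) zero by (intro cone.boundariesI) auto
      also have "diff (Suc 0) ((z, 0), 0) + (0, h *s f - h *s f') = cone_scale (h ^ 1) x"
        by (simp add: z(2) f(1) zero_prod_def)
      finally show ?thesis unfolding 1 by blast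
    next
      case 2
      obtain z where z: "x = ((z, 0), 0)" "z \<in> P 0" using x(1) unfolding 2 by (auto simp: cone_part_def)
      have rz: "restrict_form \<phi> (e z) = 0" using x(2) unfolding 2 z(1) by simp
      \<comment> \<open>Multiplication by \<open>h\<close> turns a cycle of the complex ending in
        \<open>N\<close> into a cycle of the one treated in \<open>torsion_1\<close>.\<close>
      have "h *s e z \<in> form.adjoin gs M D"
      proof (rule in_adjoin_if_restriction_zero_local[OF finite_subset[OF B(1) A(1)] hyp B(2) w(1) A(1) B(1) h_def hom_onD(1)[OF e(1) z(2)]])
        fix u assume "\<And>b. b < c \<Longrightarrow> dot (y b) u = 0"
        then obtain u' where u: "u = \<phi> u'" using range[of u] by auto
        have "pullback \<phi> (pairing (e z) u) = 0"
          unfolding u pairing_restrict_form[OF \<phi>(1), symmetric] rz by simp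
        then show "pairing (e z) u \<in> ideal_gen gs"
          by (rule in_ideal_gen_if_pullback_eq_0[OF \<phi>(1) \<psi>])
      qed
      moreover have "e (fscale h z) = h *s e z" by (rule hom_onD(3)[OF e(1) z(2)])
      ultimately have "diff (Suc 0) (cone_scale h x) \<in> cone.adjoin gs (cone_mods P c M (Suc 0)) (cone_rels P c D [] (Suc 0))"
        unfolding cone_simps adjoin_zero_Times z(1) by simp
      moreover have "cone_scale h x \<in> cone_mods P c M (Suc (Suc 0))"
        using z zero free.subspace_scale[OF P(1)] by simp
      ultimately obtain s where "cone_scale (h ^ s) (cone_scale h x) \<in> cone.boundaries mods rels diff (Suc (Suc 0))"
        using torsion[of "Suc 0"] unfolding cone.torsion_at_def boundaries_1_eq_2 by blast
      then have "cone_scale (h ^ Suc s) x \<in> cone.boundaries mods rels diff (Suc i)"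
        unfolding cone.scale_scale 2 by (simp only: power_Suc2)
      then show ?thesis by blast
    next
      case (3 j)
      have "x \<in> cone_mods P c M (Suc (Suc (Suc j)))" using x(1) unfolding 3 cone_simps .
      moreover have "diff (Suc (Suc j)) x \<in> cone.adjoin gs (cone_mods P c M (Suc (Suc j))) (cone_rels P c D [] (Suc (Suc j)))"
        using x(2) unfolding 3 cone_simps cone.adjoin_simps .
      ultimately show ?thesis
        using torsion[of "Suc (Suc j)"] unfolding cone.torsion_at_def boundaries_1_eq_2 3 by blast
    qed
  qed
  then show ?thesis unfolding h_eq cone.torsion_at_def by blast
qed

text \<open>The polynomials of which some power carries \<open>x\<close> into the boundaries form a
  radical ideal. It contains the \<open>y b\<close>, which carry \<open>x\<close> into the
  relations, and for each flat meeting X nontrivially the product from \<open>torsion_2\<close>;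
  \<open>flats_nullstellensatz\<close> then yields every linear form.\<close>

lemma torsion_lin_poly: "cone.torsion_at (lin_poly a) mods rels diff i"
  unfolding cone.torsion_at_def
proof (intro ballI impI)
  fix x assume x: "x \<in> mods (Suc i)" "diff i x \<in> rels i"
  let ?Z = "cone.boundaries mods rels diff (Suc i)"
  let ?I = "{g. cone_scale g x \<in> ?Z}"
  let ?J = "{g. \<exists>s. g ^ s \<in> ?I}"
  have Z: "cone.subspace ?Z" by (rule cone.subspace_boundaries[OF complex_2])
  have "lin_poly a \<in> ?J"
  proof (rule flats_nullstellensatz[OF A(1), where X = "range \<phi>" and K = "set gs"])
    show "radical_ideal ?J"
    proof (rule radical_ideal_radical)
      show "0 \<in> ?I" using cone.subspace_0[OF Z] by (simp only: mem_Collect_eq cone.scale_zero_left)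
      show "f + g \<in> ?I" if "f \<in> ?I" "g \<in> ?I" for f g
        using that cone.subspace_add[OF Z] by (simp only: mem_Collect_eq cone.scale_left_distrib)
      show "f * g \<in> ?I" if "g \<in> ?I" for f g
        using that cone.subspace_scale[OF Z] by (simp only: mem_Collect_eq cone.scale_scale[symmetric])
    qed
    show "set gs \<subseteq> ?J"
    proof
      fix g assume g: "g \<in> set gs"
      have "cone_scale g x \<in> rels (Suc i)"
      proof (cases i)
        case 0
        then obtain f where "x = (0, f)" using x(1) by auto
        then show ?thesis unfolding 0 using pullback_gs[OF g] by (simp add: restrict_form_hom zero_prod_def)
      next
        case (Suc j)
        have "x \<in> (P j \<times> cone_part c j) \<times> {0}" using x(1) unfolding Suc cone_simps .
        then show ?thesis unfolding Suc cone_simps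
          by (rule cone.scale_in_adjoin[OF subspace_cone_Times[OF P(1)] cone.subspace_single_0 g])
      qed
      then have "cone_scale (g ^ 1) x \<in> ?Z" using cone.boundaries_superset[OF complex_2, of "Suc i"] by auto
      then show "g \<in> ?J" by blast
    qed
    show "(\<Prod>L\<in>{L\<in>A. \<not> \<Inter>F \<subseteq> L}. alpha L) \<in> ?J"
      if "F \<subseteq> A" "range \<phi> \<inter> \<Inter>F \<noteq> {0}" for F
      using torsion_2[OF that, of i] x unfolding cone.torsion_at_def by blast
    \<comment> \<open>If the hyperplanes of \<open>F\<close> meet X only in 0, their forms and the
      \<open>y b\<close> have no common zero but 0, so they span all linear forms.\<close>
    show "lin_poly a \<in> J" if F: "F \<subseteq> A" "range \<phi> \<inter> \<Inter>F = {0}" and J: "radical_ideal J" "set gs \<subseteq> J" "\<And>L. L \<in> F \<Longrightarrow> alpha L \<in> J" for F J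
    proof (rule lin_poly_in_ideal_if_span[of _ "alpha_coeff ` F \<union> y ` {..<c}"])
      show "a \<in> vec.span (alpha_coeff ` F \<union> y ` {..<c})"
      proof (rule span_eq_UNIV_if_orthogonal_trivial)
        fix u assume u: "\<And>a. a \<in> alpha_coeff ` F \<union> y ` {..<c} \<Longrightarrow> dot a u = 0"
        have "u \<in> L" if "L \<in> F" for L
          using u[of "alpha_coeff L"] that F(1)
          by (subst hyperplane_kernel_of_alpha(1)[of L]) (auto intro: A(2))
        moreover have "u \<in> range \<phi>" unfolding range using u by blast
        ultimately show "u = 0" using F(2) by blast
      qed
      show "lin_poly s \<in> J" if "s \<in> alpha_coeff ` F \<union> y ` {..<c}" for s
        using that J(2,3) by (auto simp: alpha_eq_lin_poly)
    qed (use radical_idealD(1-3)[OF J(1)] in blast)+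
  qed
  then show "\<exists>s. cone_scale (lin_poly a ^ s) x \<in> ?Z" by blast
qed

lemma exists_restriction:
  obtains f where "restrict_form \<phi> f = g"
proof -
  obtain \<psi> where "Vector_Spaces.linear (*s) (*s) \<psi>" "\<And>v. \<psi> (\<phi> v) = v" "\<And>u. \<phi> (\<psi> u) = u - (\<Sum>b<c. dot (y b) u *s v b)"
    using exists_linear_section[OF \<phi> range dual_c] by blast
  then show ?thesis using that restrict_form_section[OF \<phi>(1)] by blast
qed

lemma pullback_coordinates:
  assumes j: "c \<le> j" "j < CARD('n)"
  shows "pullback_coeff \<phi> (y j) \<noteq> 0"
    "i < CARD('n) \<Longrightarrow> i \<noteq> j \<Longrightarrow> \<not> lin_poly (pullback_coeff \<phi> (y i)) dvd lin_poly (pullback_coeff \<phi> (y j))"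
proof -
  have "v j \<in> range \<phi>" unfolding range using yv j by auto
  then obtain u where u: "v j = \<phi> u" by blast
  have dot: "dot (pullback_coeff \<phi> (y i)) u = (if i = j then 1 else 0)" if "i < CARD('n)" for i
    using yv j(2) that by (simp add: dot_pullback_coeff[OF \<phi>(1)] flip: u)
  show "pullback_coeff \<phi> (y j) \<noteq> 0" using dot[OF j(2)] by auto
  show "\<not> lin_poly (pullback_coeff \<phi> (y i)) dvd lin_poly (pullback_coeff \<phi> (y j))" if "i < CARD('n)" "i \<noteq> j"
    using lin_poly_dvd_lin_polyD[of "pullback_coeff \<phi> (y i)" "pullback_coeff \<phi> (y j)" u] dot j(2) that by auto
qed

text \<open>The forms from index \<open>c\<close> on restrict to coordinates of X. Position 1 asks
  for two regular elements on \<open>N\<close>, which \<open>log_numerators_cancel\<close> provides;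
  the later positions are projective modules modulo the earlier forms, where the whole sequence of
  coordinates is regular.\<close>

lemma regular_coordinates:
  "cone.regular_upto (map (\<lambda>i. lin_poly (y i)) [c..<CARD('n)]) i (mods i) (rels i)"
proof -
  consider "i = 0" | "i = Suc 0" | j where "i = Suc (Suc j)" by (metis not0_implies_Suc)
  then show ?thesis
  proof cases
    case 1
    then show ?thesis by (cases "[c..<CARD('n)]") auto
  next
    case 2
    have upt: "map (\<lambda>i. lin_poly (y i)) [c..<CARD('n)] =
        lin_poly (y c) # lin_poly (y (Suc c)) # map (\<lambda>i. lin_poly (y i)) [Suc (Suc c)..<CARD('n)]"
      using c by (simp add: upt_conv_Cons)
    let ?a = "pullback_coeff \<phi> (y c)" and ?b = "pullback_coeff \<phi> (y (Suc c))"
    have a: "?a \<noteq> 0" "\<not> lin_poly ?a dvd lin_poly ?b"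
      using pullback_coordinates(1)[of c] pullback_coordinates(2)[of "Suc c" c] c by auto
    have reg1: "x \<in> {0} \<times> K\<^sub>X" if x: "x \<in> {0} \<times> M\<^sub>X" and zx: "cone_scale (lin_poly (y c)) x \<in> {0} \<times> K\<^sub>X" for x
    proof -
      obtain f where f: "x = (0, f)" using x by auto
      then have "restrict_form \<phi> (lin_poly (y c) *s f) = 0" using zx by simp
      then have "lin_poly ?a *s restrict_form \<phi> f = 0" by (simp add: restrict_form_hom)
      then have "restrict_form \<phi> f $ i = 0" for i
        using a(1) by (metis lin_poly_eq_0_iff mult_eq_0_iff vector_smult_component zero_index)
      then have "restrict_form \<phi> f = 0" by (simp add: vec_eq_iff)
      then show ?thesis by (simp add: f)
    qed
    have reg2: "x \<in> cone.add_multiples (lin_poly (y c)) ({0} \<times> M\<^sub>X) ({0} \<times> K\<^sub>X)"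
      if x: "x \<in> {0} \<times> M\<^sub>X" and zx: "cone_scale (lin_poly (y (Suc c))) x \<in> cone.add_multiples (lin_poly (y c)) ({0} \<times> M\<^sub>X) ({0} \<times> K\<^sub>X)" for x
    proof -
      obtain f where f: "x = (0, f)" "restrict_form \<phi> f \<in> N" using x by auto
      obtain s t where "s \<in> {0} \<times> M\<^sub>X" "t \<in> {0} \<times> K\<^sub>X" "cone_scale (lin_poly (y (Suc c))) x = cone_scale (lin_poly (y c)) s + t"
        using zx by (rule cone.add_multiplesE)
      then obtain f' k where f': "restrict_form \<phi> f' \<in> N" "restrict_form \<phi> k = 0"
        "lin_poly (y (Suc c)) *s f = lin_poly (y c) *s f' + k" unfolding f by auto
      have "restrict_form \<phi> (lin_poly (y (Suc c)) *s f) = restrict_form \<phi> (lin_poly (y c) *s f' + k)"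
        unfolding f'(3) ..
      then have "lin_poly ?b *s restrict_form \<phi> f = lin_poly ?a *s restrict_form \<phi> f'"
        by (simp add: restrict_form_hom f'(2))
      then obtain g where g: "g \<in> N" "restrict_form \<phi> f = lin_poly ?a *s g"
        using log_numerators_cancel[OF a f(2) f'(1)] by blast
      obtain f0 where f0: "restrict_form \<phi> f0 = g" using exists_restriction .
      have "x = cone_scale (lin_poly (y c)) (0, f0) + (0, f - lin_poly (y c) *s f0)"
        unfolding f(1) by (simp add: zero_prod_def)
      also have "\<dots> \<in> cone.add_multiples (lin_poly (y c)) ({0} \<times> M\<^sub>X) ({0} \<times> K\<^sub>X)"
        using g f0 by (intro cone.add_multiplesI) (auto simp: restrict_form_hom)
      finally show ?thesis .
    qed
    show ?thesis unfolding 2 upt cone.regular_upto.simps cone_simps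
      by (intro conjI impI ballI) (erule (1) reg1, erule (1) reg2, simp)
  next
    case (3 j)
    show ?thesis unfolding 3 cone_simps
      by (rule cone.regular_upto_if_dual_bases[OF subspace_cone_Times[OF P(1)]
            cone_has_dual_bases[OF P(1) projective_has_dual_bases[OF P(2)]]])
        (rule lin_poly_regular[OF yv])
  qed
qed

lemma cone_acyclic:
  assumes "x \<in> mods (Suc i)" "diff i x \<in> rels i"
  shows "x \<in> cone.boundaries mods rels diff (Suc i)"
proof (rule cone.acyclicity[OF complex_2 _ regular_coordinates _ assms])
  \<comment> \<open>\<open>P i\<close> stands at position i + 2 and is zero for i > p, and the dy_b
    stand at position 3; hence the bounds on p and k clear all positions beyond dim X.\<close>
  show "mods j \<subseteq> rels j" if "length (map (\<lambda>i. lin_poly (y i)) [c..<CARD('n)]) < j" for j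
  proof -
    have "CARD('n) - c < j" using that by simp
    then have "j = Suc (Suc (j - 2))" "j - 2 > p" "j - 2 > 1" using c p by auto
    then obtain j' where j': "j = Suc (Suc j')" "j' > p" "j' > 1" by blast
    have "mods j = {0}" using P(3)[OF j'(2)] j'(3) by (simp add: j'(1) cone_part_def zero_prod_def)
    then show ?thesis using cone.subspace_0[OF cone.complexD(2)[OF complex_2]] by auto
  qed
  show "cone.torsion_at z mods rels diff j" if "z \<in> set (map (\<lambda>i. lin_poly (y i)) [c..<CARD('n)])" for z j
    using that torsion_lin_poly by auto
qed

lemma restriction_onto:
  assumes "g \<in> N"
  shows "\<exists>f\<in>M. restrict_form \<phi> f = g"
proof -
  obtain f0 where f0: "restrict_form \<phi> f0 = g" using exists_restriction .
  have "(0, f0) \<in> cone.boundaries mods rels diff (Suc 0)"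
    using assms f0 by (intro cone_acyclic) auto
  then obtain z b where z: "z \<in> mods (Suc (Suc 0))" and b: "b \<in> rels (Suc 0)" and eq: "(0, f0) = diff (Suc 0) z + b"
    by (rule cone.boundariesE)
  have "e (fst (fst z)) \<in> M" using z hom_onD(1)[OF e(1)] by auto
  moreover have "f0 = e (fst (fst z)) + snd b" using arg_cong[OF eq, of snd] by simp
  then have "restrict_form \<phi> (e (fst (fst z))) = g" using b f0 by (auto simp: restrict_form_hom)
  ultimately show ?thesis by blast
qed

lemma restriction_kernel:
  assumes f: "f \<in> M" "restrict_form \<phi> f = 0"
  shows "f \<in> form.adjoin gs M D"
proof -
  obtain z where z: "z \<in> P 0" "e z = f" using e(2) f(1) by (metis imageE)
  have zero: "(0 :: nat \<Rightarrow>\<^sub>0 ('k, 'n) mpoly) \<in> cone_part c 0" by (rule free.subspace_0[OF subspace_cone_part])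
  have "((z, 0), 0) \<in> cone.boundaries mods rels diff (Suc (Suc 0))"
    using z f(2) zero by (intro cone_acyclic) auto
  then obtain s b where s: "s \<in> mods (Suc (Suc (Suc 0)))" and b: "b \<in> rels (Suc (Suc 0))"
    and eq: "((z, 0), 0) = diff (Suc (Suc 0)) s + b"
    by (rule cone.boundariesE)
  let ?B = "\<lambda>i. cone.adjoin gs (cone_mods P c M i) (cone_rels P c D [] i)"
  \<comment> \<open>The boundary found for the complex ending in \<open>N\<close> is read again in
    the one ending in \<open>M\<close> modulo conormal forms and multiples of the
    \<open>y b\<close>. There its differential is a relation, which is the claim about
    \<open>f\<close>.\<close>
  note cx = cone.complex_adjoin[OF complex_1, of gs]
  have s': "s \<in> cone_mods P c M (Suc (Suc (Suc 0)))" using s by simp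
  have b': "b \<in> ?B (Suc (Suc 0))" using b by simp
  have "diff (Suc 0) (diff (Suc (Suc 0)) s + b) = diff (Suc 0) (diff (Suc (Suc 0)) s) + diff (Suc 0) b"
    by (rule cone.complex_hom(2)[OF cx cone.complex_hom(1)[OF cx s'] cone.complexD(3)[OF cx b']])
  also have "\<dots> \<in> ?B (Suc 0)"
    by (rule cone.subspace_add[OF cone.complexD(2)[OF cx] cone.complexD(6)[OF cx s'] cone.complexD(5)[OF cx b']])
  finally have "(0, f) \<in> ?B (Suc 0)" unfolding eq[symmetric] by (simp add: z(2))
  then show ?thesis unfolding cone_simps adjoin_zero_Times by simp
qed

end

section \<open>Passing to numerators\<close>

lemma projdim_eq_enatD:
  fixes s :: "'a::comm_ring_1 \<Rightarrow> 'b::ab_group_add \<Rightarrow> 'b"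
  assumes "projdim s M = enat n"
  obtains P :: "nat \<Rightarrow> ('b \<times> 'a \<times> nat \<Rightarrow>\<^sub>0 'a) set" and d e where "projective_resolution s M fscale n P d e"
proof -
  let ?S = "{enat n | n. \<exists>(P :: nat \<Rightarrow> ('b \<times> 'a \<times> nat \<Rightarrow>\<^sub>0 'a) set) d e. projective_resolution s M fscale n P d e}"
  have "Inf ?S = enat n" using assms unfolding projdim_def .
  moreover from this have "?S \<noteq> {}" by (auto simp: Inf_enat_def split: if_splits)
  ultimately have "enat n \<in> ?S" unfolding Inf_enat_def by (metis (mono_tags, lifting) LeastI ex_in_conv)
  then show ?thesis using that by auto
qed

lemma projective_resolutionD:
  assumes "projective_resolution s M t n P d e"
  shows "module.subspace t (P i)" "projective_mod t (P i)" "i > n \<Longrightarrow> P i = {0}" "hom_on t (P 0) s M e"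
    "hom_on t (P (Suc i)) t (P i) (d i)" "e ` P 0 = M" "{x \<in> P 0. e x = 0} = d 0 ` P 1"
    "{x \<in> P (Suc i). d i x = 0} = d (Suc i) ` P (Suc (Suc i))"
  using assms unfolding projective_resolution_def by (elim conjE, simp only:)+

text \<open>Numerators and forms are isomorphic modules through the common denominator, so only the
  augmentation of the resolution has to be changed.\<close>

lemma numerator_resolution:
  fixes A :: "('k::field ^ 'n::{finite,linorder}) set set"
  assumes A: "finite A" "\<And>L. L \<in> A \<Longrightarrow> hyperplane L"
    and res: "projective_resolution form_scale (log_forms A) fscale p P d e"
  obtains e' where "hom_on fscale (P 0) (*s) (log_numerators A) e'" "e' ` P 0 = log_numerators A"
    "{x \<in> P 0. e' x = 0} = d 0 ` P 1"
proof -
  have Q: "Qpoly A \<noteq> 0" by (rule Qpoly_nonzero[OF A])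
  interpret h: module_hom "(*s)" form_scale "to_form (Qpoly A)" by (rule module_hom_to_form[OF Q])
  note inj = inj_to_form[OF Q]
  have img: "log_forms A = to_form (Qpoly A) ` log_numerators A"
    using A hyperplane_kernel_of_alpha by (intro log_forms_eq_image[OF Q]) blast+
  define e' where "e' x = inv (to_form (Qpoly A)) (e x)" for x
  note e = projective_resolutionD(4,6,7)[OF res] and P = projective_resolutionD(1)[OF res]
  have e': "to_form (Qpoly A) (e' x) = e x" if "x \<in> P 0" for x
    unfolding e'_def using hom_onD(1)[OF e(1) that] by (intro f_inv_into_f) (auto simp: img)
  have eqI: "e' x = f" if "x \<in> P 0" "e x = to_form (Qpoly A) f" for x f
    using e'[OF that(1)] that(2) inj by (simp add: inj_eq)
  show ?thesis
  proof (rule that[of e'])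
    show "hom_on fscale (P 0) (*s) (log_numerators A) e'"
      unfolding hom_on_def
    proof (intro conjI ballI allI)
      fix x assume x: "x \<in> P 0"
      then obtain f where "f \<in> log_numerators A" "e x = to_form (Qpoly A) f" using hom_onD(1)[OF e(1)] img by blast
      then show "e' x \<in> log_numerators A" using eqI[OF x] by simp
      show "e' (fscale r x) = r *s e' x" for r
        using x by (intro eqI free.subspace_scale[OF P]) (simp_all add: hom_onD(3)[OF e(1)] h.scale e')
      show "e' (x + x') = e' x + e' x'" if "x' \<in> P 0" for x'
        using x that by (intro eqI free.subspace_add[OF P]) (simp_all add: hom_onD(2)[OF e(1)] h.add e')
    qed
    have "e' ` P 0 = inv (to_form (Qpoly A)) ` e ` P 0" by (auto simp: e'_def)
    then show "e' ` P 0 = log_numerators A"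
      unfolding e(2) img using inj by (simp add: image_image)
    have "e' x = 0 \<longleftrightarrow> e x = 0" if "x \<in> P 0" for x
      using eqI[OF that, of 0] e'[OF that] by auto
    then show "{x \<in> P 0. e' x = 0} = d 0 ` P 1" using e(3) by auto
  qed
qed

theorem theorem3p7:
  fixes A' :: "('k::field ^ 'n::{finite,linorder}) set set"
    and X :: "('k ^ 'n::{finite,linorder}) set"
    and \<phi> :: "'k ^ 'm::{finite,linorder} \<Rightarrow> 'k ^ 'n::{finite,linorder}"
    and p k :: nat
  assumes "central_arrangement A'"
    and "essential A'"
    and "projdim form_scale (log_forms A') = enat p"
    and "int p < int CARD('n) - 2"
    and "vec.subspace X"
    and "X \<notin> intersection_lattice A'"
    and "generic_wrt X A'"
    and "k = vec.dim X"
    and "k \<ge> 3"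
    and "p \<le> k - 2"
    and "coordinates \<phi> X"
  shows "\<not> free_arrangement (in_coordinates \<phi> (restricted_arrangement A' X))"
proof
  assume free: "free_arrangement (in_coordinates \<phi> (restricted_arrangement A' X))"
  define c where "c = codim X"
  have A: "finite A'" "\<And>L. L \<in> A' \<Longrightarrow> hyperplane L" using assms(1) by (auto simp: central_arrangement_def)
  have \<phi>: "Vector_Spaces.linear (*s) (*s) \<phi>" "inj \<phi>" and X: "X = range \<phi>" using assms(11) by (auto simp: coordinates_def)
  have sum: "c + k = CARD('n)" using dim_le_CARD[of X] assms(8) by (simp add: c_def codim_def)
  have c: "c + 3 \<le> CARD('n)" and p: "c + p + 2 \<le> CARD('n)" using sum assms(9,10) by auto
  have "c \<noteq> 0"
  proof
    assume "c = 0"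
    then have "vec.dim X = vec.dim (UNIV :: ('k ^ 'n::{finite,linorder}) set)"
      using sum assms(8) by (simp add: vec.dim_UNIV card_cart_basis)
    then have "X = UNIV" using assms(5) by (intro vec.subspace_dim_equal) auto
    then have "X = \<Inter>{}" by simp
    then show False using assms(6) unfolding intersection_lattice_def by blast
  qed
  then have c0: "c > 0" by simp
  obtain y v where yv: "dual_systems CARD('n) y v" and Xy: "\<And>u. u \<in> X \<longleftrightarrow> (\<forall>b<c. dot (y b) u = 0)"
    using adapted_dual_systems[OF assms(5)] unfolding c_def by blast
  have range: "u \<in> range \<phi> \<longleftrightarrow> (\<forall>b<c. dot (y b) u = 0)" for u using Xy X by simp
  have yc: "dual_systems c y v" using yv sum by simp
  \<comment> \<open>Since X and the flat span V, each \<open>v b\<close> can be moved into the flat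
    by a vector of X. All \<open>y a\<close> with \<open>a < c\<close> vanish on that vector, so
    duality is kept.\<close>
  have flats: "\<exists>w. dual_systems c y w \<and> (\<forall>b<c. w b \<in> \<Inter>F)" if F: "F \<subseteq> A'" "range \<phi> \<inter> \<Inter>F \<noteq> {0}" for F
  proof -
    have "v b \<in> {x + y |x y. x \<in> X \<and> y \<in> \<Inter>F}" for b
      unfolding generic_sum_eq_UNIV[OF assms(1,5,7) F(1) F(2)[folded X]] by simp
    then have "\<exists>x w. x \<in> X \<and> w \<in> \<Inter>F \<and> v b = x + w" for b by blast
    then obtain x w where xw: "\<And>b. x b \<in> X" "\<And>b. w b \<in> \<Inter>F" "\<And>b. v b = x b + w b" by metis
    have "dot (y a) (w b) = dot (y a) (v b)" if "a < c" for a b using xw(1)[of b] that Xy by (simp add: xw(3))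
    then show ?thesis using yc xw(2) by (intro exI[of _ w]) simp
  qed
  \<comment> \<open>If X lay in \<open>L\<close>, the codimension formula for the flat
    \<open>L\<close>, of codimension 1, would give codim X = codim X + 1. Consequently every
    \<open>alpha L\<close> stays nonzero on X.\<close>
  have proper: "\<exists>u. \<phi> u \<notin> L" if L: "L \<in> A'" for L
  proof (rule ccontr)
    assume "\<not> ?thesis"
    then have "X \<inter> L = X" using X by auto
    moreover have "\<Inter>{L} \<in> intersection_lattice A'" unfolding intersection_lattice_def using L by blast
    then have "codim (X \<inter> \<Inter>{L}) = codim X + codim (\<Inter>{L})"
      using assms(7) A(2)[OF L] sum assms(9) unfolding generic_wrt_def by (auto simp: hyperplane_def c_def)
    ultimately show False using A(2)[OF L] by (simp add: hyperplane_def)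
  qed
  let ?B = "(\<lambda>L. \<phi> -` L) ` A'"
  have B_eq: "in_coordinates \<phi> (restricted_arrangement A' X) = ?B"
  proof -
    have "in_coordinates \<phi> (restricted_arrangement A' X) = (\<lambda>L. \<phi> -` (L \<inter> X)) ` A'"
      unfolding in_coordinates_def restricted_arrangement_def by blast
    also have "\<dots> = ?B" unfolding X by (intro image_cong) auto
    finally show ?thesis .
  qed
  have kerB: "kernel_of_alpha L'" and nzB: "alpha_coeff L' \<noteq> 0" if L': "L' \<in> ?B" for L'
  proof -
    obtain L where L: "L' = \<phi> -` L" "L \<in> A'" using L' by blast
    show ker: "kernel_of_alpha L'" by (rule kernel_of_alpha_vimage[OF \<phi>(1) A(2) L'])
    show "alpha_coeff L' \<noteq> 0"
    proof
      assume "alpha_coeff L' = 0"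
      then have "L' = UNIV" using ker by simp
      then show False using proper[OF L(2)] L(1) by blast
    qed
  qed
  have freeN: "free_mod (*s) (log_numerators ?B)"
  proof (rule free_mod_log_numerators)
    show "Qpoly ?B \<noteq> 0" using A(1) nzB by (auto simp: Qpoly_def alpha_eq_lin_poly)
    show "free_arrangement ?B" using free unfolding B_eq .
  qed (use kerB nzB in blast)+
  have Q: "pullback \<phi> (Qpoly A') \<noteq> 0"
  proof -
    have "pullback_coeff \<phi> (alpha_coeff L) \<noteq> 0" if L: "L \<in> A'" for L
    proof
      assume 0: "pullback_coeff \<phi> (alpha_coeff L) = 0"
      have "dot (alpha_coeff L) (\<phi> u) = 0" for u using dot_pullback_coeff[OF \<phi>(1), of "alpha_coeff L" u] 0 by simp
      then show False using proper[OF L] hyperplane_kernel_of_alpha(1)[OF A(2)[OF L]] by blast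
    qed
    then show ?thesis using A(1) by (simp add: Qpoly_def alpha_eq_lin_poly)
  qed
  obtain P :: "nat \<Rightarrow> (('k, 'n) rational_form \<times> ('k, 'n) mpoly \<times> nat \<Rightarrow>\<^sub>0 ('k, 'n) mpoly) set" and d e
    where res: "projective_resolution form_scale (log_forms A') fscale p P d e"
    using projdim_eq_enatD[OF assms(3)] by blast
  obtain e' where e': "hom_on fscale (P 0) (*s) (log_numerators A') e'" "e' ` P 0 = log_numerators A'"
    and exact0: "{x \<in> P 0. e' x = 0} = d 0 ` P 1"
    using numerator_resolution[OF A res] by blast
  note P = projective_resolutionD(1-3)[OF res] and d = projective_resolutionD(5)[OF res]
    and exact = projective_resolutionD(8)[OF res]
  \<comment> \<open>Lifts of the dy_b to the first term of the resolution; they define the map that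
    attaches the extra free module to it.\<close>
  have "\<forall>b. \<exists>x. b < c \<longrightarrow> x \<in> P 0 \<and> e' x = Qpoly A' *s const_form (y b)"
  proof
    fix b
    have "Qpoly A' *s const_form (y b) \<in> log_numerators A'"
      unfolding log_numerators_def Qpoly_def using A(1) by (auto intro: dvd_mult2 dvd_prodI)
    then show "\<exists>x. b < c \<longrightarrow> x \<in> P 0 \<and> e' x = Qpoly A' *s const_form (y b)" using e'(2) by (metis imageE)
  qed
  then obtain l where l: "\<And>b. b < c \<Longrightarrow> l b \<in> P 0 \<and> e' (l b) = Qpoly A' *s const_form (y b)" by metis
  obtain \<psi> where \<psi>: "Vector_Spaces.linear (*s) (*s) \<psi>" "\<And>u. \<psi> (\<phi> u) = u"
    "\<And>u. \<phi> (\<psi> u) = u - (\<Sum>b<c. dot (y b) u *s v b)"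
    using exists_linear_section[OF \<phi> range yc] by blast
  show False
  proof (rule restriction_not_free[OF \<phi>(1) \<psi> yc c0 _ A Q _ freeN])
    show "pullback \<phi> (lin_poly (y b)) = 0" if "b < c" for b
      by (rule pullback_y[OF \<phi> range yv c p A flats P d e' exact0 exact l that])
    show "restrict_form \<phi> f \<in> log_numerators ?B" if "f \<in> log_numerators A'" for f
      by (rule restrict_M[OF \<phi> range yv c p A flats P d e' exact0 exact l that])
    show "\<exists>f\<in>log_numerators A'. restrict_form \<phi> f = g" if "g \<in> log_numerators ?B" for g
      by (rule restriction_onto[OF \<phi> range yv c p A flats P d e' exact0 exact l that])
    show "f \<in> form.adjoin (lin_polys y c) (log_numerators A') (conormal_forms c y (Qpoly A'))"
      if "f \<in> log_numerators A'" "restrict_form \<phi> f = 0" for f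
      by (rule restriction_kernel[OF \<phi> range yv c p A flats P d e' exact0 exact l that])
    show "\<Inter>A' = {0}" using assms(2) by (simp add: essential_def)
  qed
qed

end
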